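(* Let $d := p\cdot n$ satisfy $\log^3 n \ll d \ll n$. Suppose that $i=i(n)\in\mathbb{N}$ is such that $c=c(n):=d^i/n \to A\in\mathbb{R}_+$ (a positive real constant). Then asymptotically almost surely $G\in\mathcal{G}(n,p)$ satisfies \[ \left(\log d - 3\log\log n\right)\frac{1}{A} \le \zeta(G) \le (1+o(1))\left(\log d + 2\log\log n\right)\frac{e^A}{1-e^{-A}}. \] As a result, if $d\ge (\log n)^{3+\epsilon}$ for some $\epsilon>0$, then a.a.s. $\zeta(G)=\Theta\!\left(\frac{n\log d}{d^i}\right)$.
   Context: $\mathcal{G}(n,p)$ is the binomial random graph on vertex set $[n]$ where each pair is an edge independently with probability $p=p(n)$. A property holds asymptotically almost surely (a.a.s.) if its probability tends to $1$ as $n\to\infty$. Notation: $f\ll g$ means $f/g\to 0$; $\log$ is the natural logarithm. Localization game with $k$ sensors on a connected graph $G$: in round $1$ the cops choose a set $S_1\subseteq V(G)$ with $|S_1|=k$, then the (invisible) robber chooses a vertex $v_1$; in each round $t\ge 2$ the cops choose a new set $S_t$ of size $k$ (based on all previous information), then the robber moves to a vertex $v_t$ at distance at most $1$ from $v_{t-1}$. After each round the cops learn the vector of graph distances from the robber's current vertex to the vertices of $S_t$. The cops win in round $t$ if every two walks $(w_1,\dots,w_t)$, $(x_1,\dots,x_t)$ (consecutive vertices equal or adjacent) which produce the same sequence of distance vectors with respect to $(S_1,\dots,S_t)$ satisfy $w_t=x_t$. The localization number $\zeta(G)$ is the least $k$ such that the cops can win in finite time against every robber strategy. *)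

theory Defs
  imports "HOL-Probability.Probability" "HOL-Library.Landau_Symbols" "HOL-Library.Extended_Nat"
begin

text \<open>
  A simple graph is given by its vertex set \<open>V\<close> and its edge set \<open>E\<close>, a set of two-element
  subsets of \<open>V\<close>.
\<close>

definition adj :: "'a set set \<Rightarrow> 'a rel" where
  "adj E = {(u, v). {u, v} \<in> E}"

text \<open>Least length of a walk; vertices in different components are at distance \<open>\<infinity>\<close>.\<close>

definition gdist :: "'a set set \<Rightarrow> 'a \<Rightarrow> 'a \<Rightarrow> enat" where
  "gdist E u v = (INF l \<in> {l. (u, v) \<in> adj E ^^ l}. enat l)"

section \<open>The localization game\<close>

text \<open>Rounds are numbered from 1, so the value of a walk at 0 is irrelevant.\<close>

definition game_walk :: "'a set \<Rightarrow> 'a set set \<Rightarrow> nat \<Rightarrow> (nat \<Rightarrow> 'a) \<Rightarrow> bool" where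
  "game_walk V E t w \<longleftrightarrow>
     (\<forall>j\<in>{1..t}. w j \<in> V) \<and> (\<forall>j\<in>{1..<t}. w (Suc j) = w j \<or> (w j, w (Suc j)) \<in> adj E)"

text \<open>The distance vector, indexed by the sensors themselves rather than by an ordering of them.\<close>

definition dist_vec :: "'a set set \<Rightarrow> 'a set \<Rightarrow> 'a \<Rightarrow> 'a \<Rightarrow> enat" where
  "dist_vec E S v = (\<lambda>s\<in>S. gdist E v s)"

text \<open>
  A (deterministic) cop strategy maps the list of distance vectors observed so far to the next
  sensor set. The earlier sensor sets are determined by the strategy and the earlier
  observations, so this list is all the information the cops have.
\<close>

type_synonym 'a cop_strategy = "('a \<Rightarrow> enat) list \<Rightarrow> 'a set"

definition valid_strategy :: "'a set \<Rightarrow> nat \<Rightarrow> 'a cop_strategy \<Rightarrow> bool" where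
  "valid_strategy V k \<sigma> \<longleftrightarrow> (\<forall>h. \<sigma> h \<subseteq> V \<and> card (\<sigma> h) = k)"

text \<open>The observations of rounds \<open>1, \<dots>, t\<close> when the robber follows the trajectory \<open>v\<close>.\<close>

primrec observations ::
    "'a set set \<Rightarrow> 'a cop_strategy \<Rightarrow> (nat \<Rightarrow> 'a) \<Rightarrow> nat \<Rightarrow> ('a \<Rightarrow> enat) list" where
  "observations E \<sigma> v 0 = []"
| "observations E \<sigma> v (Suc t) =
     observations E \<sigma> v t @ [dist_vec E (\<sigma> (observations E \<sigma> v t)) (v (Suc t))]"

definition sensors :: "'a set set \<Rightarrow> 'a cop_strategy \<Rightarrow> (nat \<Rightarrow> 'a) \<Rightarrow> nat \<Rightarrow> 'a set" where
  "sensors E \<sigma> v j = \<sigma> (observations E \<sigma> v (j - 1))"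

text \<open>
  The cops win in round \<open>t\<close> if any two walks which, with respect to the sensor sets actually
  played, produce the sequence of distance vectors actually observed, end in the same vertex.
\<close>

definition cops_win_in_round ::
    "'a set \<Rightarrow> 'a set set \<Rightarrow> 'a cop_strategy \<Rightarrow> (nat \<Rightarrow> 'a) \<Rightarrow> nat \<Rightarrow> bool" where
  "cops_win_in_round V E \<sigma> v t \<longleftrightarrow>
     (\<forall>w x. game_walk V E t w \<and> game_walk V E t x \<and>
        (\<forall>j\<in>{1..t}. dist_vec E (sensors E \<sigma> v j) (w j) = dist_vec E (sensors E \<sigma> v j) (v j)) \<and>
        (\<forall>j\<in>{1..t}. dist_vec E (sensors E \<sigma> v j) (x j) = dist_vec E (sensors E \<sigma> v j) (v j))
        \<longrightarrow> w t = x t)"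

text \<open>
  Against a fixed deterministic cop strategy, every robber strategy (however well informed)
  results in some infinite trajectory, and every trajectory arises in this way.
\<close>

definition cops_can_win :: "'a set \<Rightarrow> 'a set set \<Rightarrow> nat \<Rightarrow> bool" where
  "cops_can_win V E k \<longleftrightarrow>
     (\<exists>\<sigma>. valid_strategy V k \<sigma> \<and>
        (\<forall>v. (\<forall>t. game_walk V E t v) \<longrightarrow> (\<exists>t\<ge>1. cops_win_in_round V E \<sigma> v t)))"

definition localization_number :: "'a set \<Rightarrow> 'a set set \<Rightarrow> nat" where
  "localization_number V E = (LEAST k. cops_can_win V E k)"

section \<open>The binomial random graph\<close>

definition vertex_pairs :: "nat \<Rightarrow> nat set set" where
  "vertex_pairs n = {e. e \<subseteq> {1..n} \<and> card e = 2}"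

text \<open>The random edge set of a binomial random graph on the vertex set \<open>{1..n}\<close>.\<close>

definition gnp :: "nat \<Rightarrow> real \<Rightarrow> nat set set pmf" where
  "gnp n q = map_pmf (\<lambda>f. {e \<in> vertex_pairs n. f e})
     (Pi_pmf (vertex_pairs n) False (\<lambda>_. bernoulli_pmf q))"

definition aas :: "(nat \<Rightarrow> real) \<Rightarrow> (nat \<Rightarrow> nat set set \<Rightarrow> bool) \<Rightarrow> bool" where
  "aas p P \<longleftrightarrow> (\<lambda>n. measure_pmf.prob (gnp n (p n)) {E. P n E}) \<longlonglongrightarrow> 1"

abbreviation zeta_gnp :: "nat \<Rightarrow> nat set set \<Rightarrow> real" where
  "zeta_gnp n E \<equiv> real (localization_number {1..n} E)"

end

theory Submission
  imports Defs "HOL-Real_Asymp.Real_Asymp"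
begin

text \<open>
  Write \<open>G\<close> for the random graph and put \<open>i = r + 2\<close>. Every set \<open>X\<close> with \<open>d |X| \<lless> n\<close> has about
  \<open>d |X|\<close> neighbours (a union bound over all \<open>X\<close>), so balls of radius \<open>i - 1\<close> around few vertices
  have about \<open>d^(i - 1)\<close> elements and are nearly disjoint. Once these balls are exposed, each
  remaining vertex is independently at distance at most \<open>i\<close> from a given centre with probability
  about \<open>1 - e^(-A)\<close>.

  Upper bound: two distinct vertices are separated by a proportion \<open>2 e^(-A) (1 - e^(-A))\<close> of all
  possible sensors. By averaging, for every set \<open>U\<close> some \<open>k\<close> sensors leave at most
  \<open>|U|\<^sup>2 / (d\<^sup>2 log^4 n)\<close> unseparated pairs, and applying this to the closed neighbourhood of the
  set of possible robber positions makes that set shrink in every round.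

  Lower bound: the robber survives if, for all \<open>v\<close> and all sets \<open>S\<close> of \<open>k\<close> sensors, two neighbours
  of \<open>v\<close> have equal distance vectors. For \<open>u\<close> adjacent to \<open>v\<close> the distance from \<open>u\<close> to \<open>s\<close> in \<open>G\<close> is
  determined by the distance in \<open>G - v\<close>, and the neighbourhood of \<open>v\<close> is independent of \<open>G - v\<close>. So the
  vectors behave like independent samples from a product distribution \<open>\<pi>\<close>, and a birthday estimate
  bounds the probability of no collision by roughly \<open>exp (- d \<parallel>\<pi>\<parallel>\<^sub>2 / 16)\<close>. It matters to use
  \<open>\<parallel>\<pi>\<parallel>\<^sub>2\<close> rather than the largest atom \<open>e^(-A k)\<close>: as \<open>\<parallel>\<pi>\<parallel>\<^sub>2\<close> exceeds it by an exponential factor, the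
  argument tolerates an arbitrarily slow convergence of \<open>d^i / n\<close> to \<open>A\<close>.
\<close>

section \<open>Product distributions and random subsets\<close>

text \<open>All but few vertices are farther than \<open>i - 1\<close> from a given sensor, and the
  diameter is at most \<open>i + 1\<close>, so a sensor reveals essentially one bit: whether the
  distance is at most \<open>i\<close>. The powers of the logarithm have separate origins. A
  relative error \<open>\<epsilon>\<close> in each of the \<open>i\<close> expansion steps is
  harmless only if \<open>i * \<epsilon>\<close> tends to 0, which
  \<open>\<epsilon> = 1 / log n\<close> achieves; concentration with that error needs
  \<open>\<epsilon>\<^sup>2 * d\<close> to dominate \<open>log n\<close>, that is, d above log^3 n.
  In the lower bound the union runs over exp(O(log^2 n)) choices of a vertex and a sensor set;
  subtracting 3 log log n leaves an exponent of order log^3 n. In the upper bound the 2 log log n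
  leaves a factor log^4 n that absorbs constants. The obstacle is dependence: expansion is a
  property of the whole graph, and conditioning on it would destroy the independence of the
  unexposed edges. It is therefore used only through the sizes of the exposed sets, which the
  exposed edges determine. The factor 1 + o(1) comes from a bound for each fixed positive error and
  a diagonal argument.\<close>

definition random_subset :: "'a set \<Rightarrow> real \<Rightarrow> 'a set pmf" where
  "random_subset Y q = map_pmf (\<lambda>h. {y\<in>Y. h y}) (Pi_pmf Y False (\<lambda>_. bernoulli_pmf q))"

lemma pmf_random_subset:
  assumes "finite Y"
  shows "pmf (random_subset Y q) A = (if A \<subseteq> Y then \<Prod>y\<in>Y. pmf (bernoulli_pmf q) (y \<in> A) else 0)"
proof (cases "A \<subseteq> Y")
  case True
  have "pmf (random_subset Y q) A
      = measure_pmf.prob (Pi_pmf Y False (\<lambda>_. bernoulli_pmf q)) (Pi Y (\<lambda>y. {y \<in> A}))"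
    unfolding random_subset_def pmf_map using True by (intro arg_cong[where f = "measure _"]) auto
  then show ?thesis using assms True by (simp add: measure_Pi_pmf_Pi measure_pmf_single)
next
  case False
  then have "(\<lambda>h. {y\<in>Y. h y}) -` {A} = {}" by auto
  then show ?thesis using False unfolding random_subset_def pmf_map by simp
qed

text \<open>Injectivity of \<open>c\<close> on \<open>Sigma W Y\<close> means that different blocks
  read different coordinates and are therefore independent. It is used with
  \<open>c w y = {w, y}\<close> for edges between disjoint vertex sets, and with
  \<open>c j y = y\<close> to cut one random subset into disjoint pieces.\<close>

lemma map_Pi_pmf_blocks:
  assumes fin: "finite I" "finite W" "\<And>w. w \<in> W \<Longrightarrow> finite (Y w)"
    and inj: "inj_on (\<lambda>(w, y). c w y) (Sigma W Y)"
    and sub: "\<And>w y. w \<in> W \<Longrightarrow> y \<in> Y w \<Longrightarrow> c w y \<in> I"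
  shows "map_pmf (\<lambda>f w. if w \<in> W then {y\<in>Y w. f (c w y)} else {}) (Pi_pmf I False (\<lambda>_. bernoulli_pmf q))
       = Pi_pmf W {} (\<lambda>w. random_subset (Y w) q)"
proof (rule pmf_eqI)
  fix g :: "'b \<Rightarrow> 'c set"
  let ?F = "\<lambda>f w. if w \<in> W then {y\<in>Y w. f (c w y)} else {}"
  let ?M = "Pi_pmf I False (\<lambda>_. bernoulli_pmf q)"
  show "pmf (map_pmf ?F ?M) g = pmf (Pi_pmf W {} (\<lambda>w. random_subset (Y w) q)) g"
  proof (cases "(\<forall>w\<in>W. g w \<subseteq> Y w) \<and> (\<forall>w. w \<notin> W \<longrightarrow> g w = {})")
    case True
    define B where "B = (\<lambda>e. {b. \<forall>w\<in>W. \<forall>y\<in>Y w. e = c w y \<longrightarrow> b = (y \<in> g w)})"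
    let ?J = "(\<lambda>(w, y). c w y) ` Sigma W Y"
    have "?F -` {g} = Pi I B"
    proof (intro set_eqI)
      fix f :: "'a \<Rightarrow> bool"
      have "f \<in> ?F -` {g} \<longleftrightarrow> (\<forall>w\<in>W. {y\<in>Y w. f (c w y)} = g w)"
      proof -
        have "f \<in> ?F -` {g} \<longleftrightarrow> (\<forall>w. ?F f w = g w)" by (simp only: vimage_eq singleton_iff fun_eq_iff)
        then show ?thesis using True by (metis (no_types, lifting))
      qed
      also have "\<dots> \<longleftrightarrow> (\<forall>w\<in>W. \<forall>y\<in>Y w. f (c w y) = (y \<in> g w))"
        using True by (intro ball_cong refl) blast
      also have "\<dots> \<longleftrightarrow> f \<in> Pi I B"
        unfolding Pi_iff B_def mem_Collect_eq using sub by metis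
      finally show "f \<in> ?F -` {g} \<longleftrightarrow> f \<in> Pi I B" .
    qed
    then have "pmf (map_pmf ?F ?M) g = (\<Prod>e\<in>I. measure_pmf.prob (bernoulli_pmf q) (B e))"
      unfolding pmf_map by (simp add: measure_Pi_pmf_Pi fin)
    also have "\<dots> = (\<Prod>e\<in>?J. measure_pmf.prob (bernoulli_pmf q) (B e))"
    proof (rule prod.mono_neutral_right)
      show "\<forall>e\<in>I - ?J. measure_pmf.prob (bernoulli_pmf q) (B e) = 1"
      proof
        fix e assume "e \<in> I - ?J"
        then have "B e = UNIV" unfolding B_def by auto
        then show "measure_pmf.prob (bernoulli_pmf q) (B e) = 1" by simp
      qed
    qed (use fin sub in auto)
    also have "\<dots> = (\<Prod>(w, y)\<in>Sigma W Y. measure_pmf.prob (bernoulli_pmf q) (B (c w y)))"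
      by (subst prod.reindex[OF inj]) (auto simp: case_prod_unfold)
    also have "\<dots> = (\<Prod>(w, y)\<in>Sigma W Y. pmf (bernoulli_pmf q) (y \<in> g w))"
    proof (rule prod.cong[OF refl], clarify)
      fix w y assume wy: "w \<in> W" "y \<in> Y w"
      have "B (c w y) = {y \<in> g w}"
      proof -
        have "(w, y) = (w', y')" if "w' \<in> W" "y' \<in> Y w'" "c w y = c w' y'" for w' y'
          using inj_onD[OF inj, of "(w, y)" "(w', y')"] that wy by simp
        then show ?thesis using wy unfolding B_def by blast
      qed
      then show "measure_pmf.prob (bernoulli_pmf q) (B (c w y)) = pmf (bernoulli_pmf q) (y \<in> g w)"
        by (simp add: measure_pmf_single)
    qed
    also have "\<dots> = (\<Prod>w\<in>W. \<Prod>y\<in>Y w. pmf (bernoulli_pmf q) (y \<in> g w))"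
      by (rule prod.Sigma[symmetric]) (use fin in auto)
    also have "\<dots> = (\<Prod>w\<in>W. pmf (random_subset (Y w) q) (g w))"
      using True fin by (intro prod.cong) (auto simp: pmf_random_subset)
    finally show ?thesis using True fin by (simp add: pmf_Pi')
  next
    case False
    then have "?F -` {g} = {}" by (auto split: if_splits)
    moreover have "pmf (Pi_pmf W {} (\<lambda>w. random_subset (Y w) q)) g = 0"
    proof (cases "\<forall>w. w \<notin> W \<longrightarrow> g w = {}")
      case True
      with False obtain w where "w \<in> W" "\<not> g w \<subseteq> Y w" by auto
      then show ?thesis using fin by (auto simp: pmf_Pi' True pmf_random_subset)
    qed (use fin in \<open>auto intro: pmf_Pi_outside\<close>)
    ultimately show ?thesis unfolding pmf_map by simp
  qed
qed

lemma prob_random_subset_disjoint_family: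
  assumes "finite Y" "finite J" "\<And>j. j \<in> J \<Longrightarrow> Z j \<subseteq> Y" "disjoint_family_on Z J"
  shows "measure_pmf.prob (random_subset Y q) {A. \<forall>j\<in>J. A \<inter> Z j \<in> X j}
       = (\<Prod>j\<in>J. measure_pmf.prob (random_subset (Z j) q) (X j))"
proof -
  have fin: "finite (Z j)" if "j \<in> J" for j
    by (rule finite_subset[OF assms(3)[OF that] assms(1)])
  have "j = k" if "j \<in> J" "k \<in> J" "y \<in> Z j" "y \<in> Z k" for j k y
    using disjoint_family_onD[OF assms(4) that(1,2)] that(3,4) by blast
  then have inj: "inj_on (\<lambda>(j, y). y) (Sigma J Z)"
    by (auto simp: inj_on_def)
  have blocks: "map_pmf (\<lambda>f j. if j \<in> J then {y \<in> Z j. f y} else {}) (Pi_pmf Y False (\<lambda>_. bernoulli_pmf q))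
      = Pi_pmf J {} (\<lambda>j. random_subset (Z j) q)"
    using map_Pi_pmf_blocks[where c = "\<lambda>j y. y", OF assms(1,2) fin inj] assms(3) by blast
  have "(\<Prod>j\<in>J. measure_pmf.prob (random_subset (Z j) q) (X j))
      = measure_pmf.prob (Pi_pmf J {} (\<lambda>j. random_subset (Z j) q)) (Pi J X)"
    using assms by (simp add: measure_Pi_pmf_Pi)
  also have "\<dots> = measure_pmf.prob (random_subset Y q) {A. \<forall>j\<in>J. A \<inter> Z j \<in> X j}"
    unfolding blocks[symmetric] unfolding random_subset_def measure_map_pmf
  proof (rule arg_cong[where f = "measure _"], auto simp: Pi_iff, goal_cases)
    case (1 x j)
    then have "{y \<in> Z j. x y} = {y \<in> Y. x y} \<inter> Z j" using assms(3) by auto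
    then show ?case using 1 by auto
  next
    case (2 x j)
    then have "{y \<in> Z j. x y} = {y \<in> Y. x y} \<inter> Z j" using assms(3) by auto
    then show ?case using 2 by auto
  qed
  finally show ?thesis ..
qed

lemma prob_random_subset_empty:
  assumes "finite Z" "0 \<le> q" "q \<le> 1"
  shows "measure_pmf.prob (random_subset Z q) {{}} = (1 - q) ^ card Z"
  using assms by (simp add: measure_pmf_single pmf_random_subset)

lemma prob_random_subset_hit:
  assumes "finite Z" "0 \<le> q" "q \<le> 1"
  shows "measure_pmf.prob (random_subset Z q) {A. A \<noteq> {}} = 1 - (1 - q) ^ card Z"
proof -
  have "{A. A \<noteq> {}} = space (random_subset Z q) - {{}}" by auto
  then show ?thesis
    using measure_pmf.prob_compl[of "{{}}" "random_subset Z q"] prob_random_subset_empty[OF assms] by simp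
qed

lemma prob_random_subset_avoid:
  assumes "finite Y" "Z \<subseteq> Y" "0 \<le> q" "q \<le> 1"
  shows "measure_pmf.prob (random_subset Y q) {A. A \<inter> Z = {}} = (1 - q) ^ card Z"
  using prob_random_subset_disjoint_family[of Y "{()}" "\<lambda>_. Z" q "\<lambda>_. {{}}"] assms
  by (simp add: prob_random_subset_empty disjoint_family_on_def finite_subset[OF assms(2,1)])

section \<open>Resampling the coordinates outside an explored region\<close>

lemma prob_bind_pmf_le:
  assumes "\<And>x. x \<in> set_pmf M \<Longrightarrow> measure_pmf.prob (N x) X \<le> \<beta>" "0 \<le> \<beta>"
  shows "measure_pmf.prob (bind_pmf M N) X \<le> \<beta>"
proof -
  have "emeasure (bind_pmf M N) X = (\<integral>\<^sup>+x. emeasure (N x) X \<partial>M)" by simp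
  also have "\<dots> \<le> (\<integral>\<^sup>+x. ennreal \<beta> \<partial>M)"
    by (intro nn_integral_mono_AE) (use assms in \<open>auto simp: AE_measure_pmf_iff measure_pmf.emeasure_eq_measure intro!: ennreal_leI\<close>)
  also have "\<dots> = ennreal \<beta>" by simp
  finally show ?thesis using assms(2) by (simp add: measure_pmf.emeasure_eq_measure)
qed

definition override_off :: "('a \<Rightarrow> 'b) \<Rightarrow> 'a set \<Rightarrow> ('a \<Rightarrow> 'b) \<Rightarrow> 'a \<Rightarrow> 'b" where
  "override_off g Q g' = (\<lambda>e. if e \<in> Q then g e else g' e)"

text \<open>Here \<open>Q g\<close> is the region explored in the configuration \<open>g\<close>; the stopping property \<open>stop\<close> makes
  the part outside independent of the exploration, so it can be resampled.\<close>

lemma resample_Pi_pmf: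
  assumes fin: "finite I"
    and stop: "\<And>g g'. (\<And>e. e \<in> Q g \<Longrightarrow> g' e = g e) \<Longrightarrow> Q g' = Q g"
    and QI: "\<And>g. Q g \<subseteq> I"
  shows "bind_pmf (Pi_pmf I d P) (\<lambda>g. map_pmf (override_off g (Q g)) (Pi_pmf I d P)) = Pi_pmf I d P"
proof (rule pmf_eqI)
  fix h
  let ?M = "Pi_pmf I d P"
  \<comment> \<open>By \<open>stop\<close>, \<open>override_off g (Q g) g'\<close> equals
    \<open>h\<close> exactly if \<open>g\<close> agrees with \<open>h\<close> on \<open>Q h\<close>
    and \<open>g'\<close> agrees with \<open>h\<close> off \<open>Q h\<close>. These two events
    concern independent configurations, so their probabilities multiply.\<close>
  define B where "B = {g'. \<forall>e. e \<notin> Q h \<longrightarrow> g' e = h e}"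
  define A where "A = {g. \<forall>e\<in>Q h. g e = h e}"
  have AQ: "Q g = Q h" if "g \<in> A" for g using stop[of h g] that unfolding A_def by auto
  have eq: "override_off g (Q g) -` {h} = (if g \<in> A then B else {})" for g
  proof (cases "g \<in> A")
    case True
    then have "override_off g (Q g) g' = h \<longleftrightarrow> g' \<in> B" for g'
      using True unfolding override_off_def A_def B_def fun_eq_iff AQ[OF True] mem_Collect_eq by metis
    then show ?thesis using True by auto
  next
    case False
    have "g \<in> A" if "override_off g (Q g) g' = h" for g'
    proof -
      have "Q h = Q g"
        by (rule stop) (use that in \<open>auto simp: override_off_def\<close>)
      then show ?thesis unfolding A_def using that by (auto simp: override_off_def)
    qed
    then show ?thesis using False by auto
  qed
  have "pmf (bind_pmf ?M (\<lambda>g. map_pmf (override_off g (Q g)) ?M)) h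
      = (\<integral>g. measure_pmf.prob ?M B * indicator A g \<partial>?M)"
    unfolding pmf_bind pmf_map eq by (intro Bochner_Integration.integral_cong) auto
  also have "\<dots> = measure_pmf.prob ?M B * measure_pmf.prob ?M A" by simp
  also have "measure_pmf.prob ?M A = (\<Prod>e\<in>Q h. pmf (P e) (h e))"
  proof -
    have "A = Pi I (\<lambda>e. if e \<in> Q h then {h e} else UNIV)" using QI[of h]
      unfolding A_def by (auto simp: Pi_iff) (metis (full_types) singletonD subsetD)
    then have "measure_pmf.prob ?M A = (\<Prod>e\<in>I. if e \<in> Q h then pmf (P e) (h e) else 1)"
      using fin by (simp add: measure_Pi_pmf_Pi measure_pmf_single if_distrib cong: if_cong)
    also have "\<dots> = (\<Prod>e\<in>Q h. pmf (P e) (h e))"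
      using fin QI[of h] by (simp add: prod.If_cases Int_absorb1)
    finally show ?thesis .
  qed
  also have "measure_pmf.prob ?M B = (if \<forall>e. e \<notin> I \<longrightarrow> h e = d then \<Prod>e\<in>I - Q h. pmf (P e) (h e) else 0)"
  proof (cases "\<forall>e. e \<notin> I \<longrightarrow> h e = d")
    case True
    have "B = PiE_dflt I d (\<lambda>e. if e \<in> Q h then UNIV else {h e})" (is "_ = ?P")
    proof (intro set_eqI iffI)
      fix f assume "f \<in> B"
      then have f: "\<And>e. e \<notin> Q h \<Longrightarrow> f e = h e" unfolding B_def by blast
      have "e \<notin> Q h" if "e \<notin> I" for e using that QI by blast
      then show "f \<in> ?P" using f True unfolding PiE_dflt_def by simp
    next
      fix f assume "f \<in> ?P"
      then have f: "\<And>e. e \<in> I \<Longrightarrow> f e \<in> (if e \<in> Q h then UNIV else {h e})" "\<And>e. e \<notin> I \<Longrightarrow> f e = d"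
        unfolding PiE_dflt_def by blast+
      have "f e = h e" if "e \<notin> Q h" for e
        using f(1)[of e] f(2)[of e] True that by (cases "e \<in> I") auto
      then show "f \<in> B" unfolding B_def by blast
    qed
    then have "measure_pmf.prob ?M B = (\<Prod>e\<in>I. if e \<in> Q h then 1 else pmf (P e) (h e))"
      using fin by (simp add: measure_Pi_pmf_PiE_dflt measure_pmf_single if_distrib cong: if_cong)
    also have "\<dots> = (\<Prod>e\<in>I - Q h. pmf (P e) (h e))"
      using fin by (simp add: prod.If_cases Diff_eq)
    finally show ?thesis using True by simp
  next
    case False
    then obtain e where e: "e \<notin> I" "h e \<noteq> d" by auto
    have "f \<notin> B" if "f \<in> set_pmf ?M" for f
    proof -
      have "f e = d" using set_Pi_pmf_subset[OF fin, of d P] that e(1) by blast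
      then show ?thesis using e QI[of h] unfolding B_def by auto
    qed
    then have "B \<inter> set_pmf ?M = {}" by blast
    then show ?thesis using False by (metis measure_Int_set_pmf measure_empty)
  qed
  finally show "pmf (bind_pmf ?M (\<lambda>g. map_pmf (override_off g (Q g)) ?M)) h = pmf ?M h"
    using fin QI[of h] by (auto simp: pmf_Pi prod.subset_diff[of "Q h" I])
qed


lemma prob_bind_pmf:
  "measure_pmf.prob (bind_pmf M N) X = (\<integral>x. measure_pmf.prob (N x) X \<partial>M)"
proof -
  have "ennreal (measure_pmf.prob (bind_pmf M N) X) = (\<integral>\<^sup>+x. ennreal (measure_pmf.prob (N x) X) \<partial>M)"
    by (simp flip: measure_pmf.emeasure_eq_measure)
  also have "\<dots> = ennreal (\<integral>x. measure_pmf.prob (N x) X \<partial>M)"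
    by (intro nn_integral_eq_integral measure_pmf.integrable_const_bound[where B = 1]) auto
  finally show ?thesis by (simp add: integral_nonneg_AE)
qed

text \<open>By \<open>good\<close>, resampling cannot turn a bad exploration into a good one. So
  after averaging over \<open>g\<close> only good \<open>g\<close> contribute, and for each of them
  the bound \<open>le\<close> concerns fresh randomness alone.\<close>

lemma prob_resample_le:
  assumes fin: "finite I"
    and stop: "\<And>g g'. (\<And>e. e \<in> Q g \<Longrightarrow> g' e = g e) \<Longrightarrow> Q g' = Q g"
    and QI: "\<And>g. Q g \<subseteq> I"
    and good: "\<And>g g'. G (override_off g (Q g) g') \<Longrightarrow> G g"
    and le: "\<And>g. G g \<Longrightarrow> measure_pmf.prob (Pi_pmf I d P) {g'. R (override_off g (Q g) g')} \<le> \<beta>"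
    and "0 \<le> \<beta>"
  shows "measure_pmf.prob (Pi_pmf I d P) {g. G g \<and> R g} \<le> \<beta>"
proof -
  have "measure_pmf.prob (bind_pmf (Pi_pmf I d P) (\<lambda>g. map_pmf (override_off g (Q g)) (Pi_pmf I d P)))
      {g. G g \<and> R g} \<le> \<beta>"
  proof (rule prob_bind_pmf_le)
    fix g
    show "measure_pmf.prob (map_pmf (override_off g (Q g)) (Pi_pmf I d P)) {g. G g \<and> R g} \<le> \<beta>"
    proof (cases "G g")
      case True
      have "measure_pmf.prob (map_pmf (override_off g (Q g)) (Pi_pmf I d P)) {g. G g \<and> R g}
          \<le> measure_pmf.prob (Pi_pmf I d P) {g'. R (override_off g (Q g) g')}"
        by (auto intro!: measure_pmf.finite_measure_mono)
      also have "\<dots> \<le> \<beta>" by (rule le[OF True])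
      finally show ?thesis .
    next
      case False
      then have "g' \<notin> override_off g (Q g) -` {g. G g \<and> R g}" for g' using good[of g g'] by auto
      then have "override_off g (Q g) -` {g. G g \<and> R g} = {}" by blast
      then show ?thesis using \<open>0 \<le> \<beta>\<close> by (simp only: measure_map_pmf measure_empty)
    qed
  qed fact
  moreover have "bind_pmf (Pi_pmf I d P) (\<lambda>g. map_pmf (override_off g (Q g)) (Pi_pmf I d P)) = Pi_pmf I d P"
    using fin stop QI by (rule resample_Pi_pmf)
  ultimately show ?thesis by simp
qed

text \<open>The terms of order 0 and 1 in \<open>v\<close> of the expanded product; the omitted ones
  are nonnegative. In the induction below \<open>u x\<close> is the factor for \<open>m\<close>
  vertices and \<open>v x\<close> its increment when a vertex is added; the sum runs over the
  possible labels of that vertex.\<close>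

lemma prod_add_ge:
  fixes u v :: "'a \<Rightarrow> real"
  assumes "finite X" "\<And>x. x \<in> X \<Longrightarrow> 0 \<le> u x" "\<And>x. x \<in> X \<Longrightarrow> 0 \<le> v x"
  shows "(\<Prod>x\<in>X. u x) + (\<Sum>x\<in>X. v x * (\<Prod>y\<in>X - {x}. u y)) \<le> (\<Prod>x\<in>X. u x + v x)"
  using assms
proof (induction X rule: finite_induct)
  case (insert a X)
  have "(\<Sum>x\<in>X. v x * (\<Prod>y\<in>insert a X - {x}. u y)) = u a * (\<Sum>x\<in>X. v x * (\<Prod>y\<in>X - {x}. u y))"
    unfolding sum_distrib_left
  proof (rule sum.cong[OF refl])
    fix x assume "x \<in> X"
    then have "insert a X - {x} = insert a (X - {x})" using insert.hyps by auto
    then show "v x * (\<Prod>y\<in>insert a X - {x}. u y) = u a * (v x * (\<Prod>y\<in>X - {x}. u y))"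
      using insert.hyps by simp
  qed
  moreover have "insert a X - {a} = X" using insert.hyps by auto
  ultimately have "(\<Prod>x\<in>insert a X. u x) + (\<Sum>x\<in>insert a X. v x * (\<Prod>y\<in>insert a X - {x}. u y))
      = u a * ((\<Prod>x\<in>X. u x) + (\<Sum>x\<in>X. v x * (\<Prod>y\<in>X - {x}. u y))) + v a * (\<Prod>x\<in>X. u x)"
    using insert.hyps by (simp add: algebra_simps)
  also have "\<dots> \<le> u a * (\<Prod>x\<in>X. u x + v x) + v a * (\<Prod>x\<in>X. u x + v x)"
    using insert by (intro add_mono mult_left_mono prod_mono) auto
  also have "\<dots> = (\<Prod>x\<in>insert a X. u x + v x)" using insert.hyps by (simp add: algebra_simps)
  finally show ?case .
qed simp

text \<open>The induction adds one vertex at a time; its label then becomes forbidden, whence the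
  quantification over \<open>X\<close>.\<close>

lemma prob_labels_distinct_le:
  fixes N :: "'b option pmf"
  assumes "finite W" "finite X" and q0: "pmf N None > 0"
  shows "measure_pmf.prob (Pi_pmf W None (\<lambda>_. N))
      {g. (\<forall>u\<in>W. g u \<in> insert None (Some ` X)) \<and> (\<forall>u\<in>W. \<forall>u'\<in>W. u \<noteq> u' \<longrightarrow> g u = g u' \<longrightarrow> g u = None)}
    \<le> pmf N None ^ card W * (\<Prod>x\<in>X. 1 + real (card W) * pmf N (Some x) / pmf N None)"
  using assms(1,2)
proof (induction W arbitrary: X rule: finite_induct)
  case empty
  then show ?case by simp
next
  case (insert w W)
  let ?C = "\<lambda>W X. {g. (\<forall>u\<in>W. g u \<in> insert None (Some ` X)) \<and> (\<forall>u\<in>W. \<forall>u'\<in>W. u \<noteq> u' \<longrightarrow> g u = g u' \<longrightarrow> g u = None)}"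
  let ?M = "Pi_pmf W None (\<lambda>_. N)"
  define q where "q = pmf N None"
  define \<rho> where "\<rho> = (\<lambda>x. pmf N (Some x))"
  define \<phi> where "\<phi> = (\<lambda>y. measure_pmf.prob ?M {f. f(w := y) \<in> ?C (insert w W) X})"
  define m where "m = real (card W)"
  have "measure_pmf.prob (Pi_pmf (insert w W) None (\<lambda>_. N)) (?C (insert w W) X) = (\<integral>y. \<phi> y \<partial>N)"
    unfolding Pi_pmf_insert'[OF insert.hyps] prob_bind_pmf \<phi>_def map_pmf_def[symmetric] measure_map_pmf
    by (simp add: vimage_def)
  also have "\<dots> = (\<Sum>y\<in>insert None (Some ` X). \<phi> y * pmf N y)"
  proof (rule integral_measure_pmf_real)
    fix y assume "y \<in> set_pmf N" "\<phi> y \<noteq> 0"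
    then have "{f. f(w := y) \<in> ?C (insert w W) X} \<noteq> {}" unfolding \<phi>_def by (metis measure_empty)
    then obtain f where "f \<in> {f. f(w := y) \<in> ?C (insert w W) X}" by (meson ex_in_conv)
    then have "\<forall>u\<in>insert w W. (f(w := y)) u \<in> insert None (Some ` X)"
      unfolding mem_Collect_eq by (rule conjunct1)
    then have "(f(w := y)) w \<in> insert None (Some ` X)" by (rule bspec) simp
    then show "y \<in> insert None (Some ` X)" by simp
  qed (use insert.prems in simp)
  also have "\<dots> = q * \<phi> None + (\<Sum>x\<in>X. \<rho> x * \<phi> (Some x))"
    using insert.prems by (subst sum.insert) (auto simp: sum.reindex q_def \<rho>_def mult.commute)
  also have "\<dots> \<le> q * (q ^ card W * (\<Prod>x\<in>X. 1 + m * \<rho> x / q))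
      + (\<Sum>x\<in>X. \<rho> x * (q ^ card W * (\<Prod>y\<in>X - {x}. 1 + m * \<rho> y / q)))"
  proof (intro add_mono mult_left_mono sum_mono)
    have "\<phi> None \<le> measure_pmf.prob ?M (?C W X)"
      unfolding \<phi>_def
    proof (rule measure_pmf.finite_measure_mono, rule subsetI)
      fix f assume "f \<in> {f. f(w := None) \<in> ?C (insert w W) X}"
      moreover have "(f(w := None)) u = f u" if "u \<in> W" for u using that insert.hyps by auto
      ultimately show "f \<in> ?C W X" by (smt (verit) insertCI mem_Collect_eq)
    qed simp
    then show "\<phi> None \<le> q ^ card W * (\<Prod>x\<in>X. 1 + m * \<rho> x / q)"
      using insert.IH[OF insert.prems] by (simp add: q_def m_def \<rho>_def)
    fix x assume "x \<in> X"
    have "\<phi> (Some x) \<le> measure_pmf.prob ?M (?C W (X - {x}))"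
      unfolding \<phi>_def
    proof (rule measure_pmf.finite_measure_mono, rule subsetI)
      fix f assume "f \<in> {f. f(w := Some x) \<in> ?C (insert w W) X}"
      then have a: "\<And>u. u \<in> insert w W \<Longrightarrow> (f(w := Some x)) u \<in> insert None (Some ` X)"
        and b: "\<And>u u'. u \<in> insert w W \<Longrightarrow> u' \<in> insert w W \<Longrightarrow> u \<noteq> u'
          \<Longrightarrow> (f(w := Some x)) u = (f(w := Some x)) u' \<Longrightarrow> (f(w := Some x)) u = None"
        unfolding mem_Collect_eq by metis+
      have c: "u \<noteq> w" if "u \<in> W" for u using that insert.hyps by auto
      have "f u \<in> insert None (Some ` (X - {x}))" if "u \<in> W" for u
        using a[of u] b[of u w] c[OF that] that by auto
      moreover have "f u = None" if "u \<in> W" "u' \<in> W" "u \<noteq> u'" "f u = f u'" for u u'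
        using b[of u u'] c that by auto
      ultimately show "f \<in> ?C W (X - {x})" by blast
    qed simp
    then show "\<phi> (Some x) \<le> q ^ card W * (\<Prod>y\<in>X - {x}. 1 + m * \<rho> y / q)"
      using insert.IH[of "X - {x}"] insert.prems by (simp add: q_def m_def \<rho>_def)
  qed (auto simp: q_def \<rho>_def)
  also have "\<dots> = q ^ Suc (card W) * ((\<Prod>x\<in>X. 1 + m * \<rho> x / q)
      + (\<Sum>x\<in>X. \<rho> x / q * (\<Prod>y\<in>X - {x}. 1 + m * \<rho> y / q)))"
    using q0 unfolding q_def by (simp add: sum_distrib_left field_simps)
  also have "\<dots> \<le> q ^ Suc (card W) * (\<Prod>x\<in>X. 1 + m * \<rho> x / q + \<rho> x / q)"
    using insert.prems q0 by (intro mult_left_mono prod_add_ge) (auto simp: q_def \<rho>_def m_def)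
  also have "\<dots> = q ^ card (insert w W) * (\<Prod>x\<in>X. 1 + real (card (insert w W)) * \<rho> x / q)"
    using insert.hyps by (simp add: m_def algebra_simps add_divide_distrib)
  finally show ?case by (simp add: q_def \<rho>_def)
qed

text \<open>With \<open>s = sqrt (1 + y)\<close> one has \<open>ln (1 + y) = 2 * ln s \<le> 2 * (s -
  1) = y - (s - 1)\<^sup>2\<close>. The saving is quadratic for small \<open>y\<close> and linear
  for large \<open>y\<close>; the birthday bound needs both, as it assumes nothing about the size of
  single label probabilities.\<close>

lemma ln_add_one_le_quadratic:
  fixes y :: real
  assumes "0 \<le> y"
  shows "ln (1 + y) \<le> y - y\<^sup>2 / (4 * (1 + y))"
proof -
  define s where "s = sqrt (1 + y)"
  have s: "s \<ge> 1" "s\<^sup>2 = 1 + y" using assms unfolding s_def by auto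
  have "ln (1 + y) = 2 * ln s" using s by (metis ln_realpow less_le_trans of_nat_numeral zero_less_one)
  also have "\<dots> \<le> 2 * (s - 1)" using s ln_le_minus_one[of s] by simp
  also have "\<dots> = y - (s - 1)\<^sup>2" using s by (simp add: power2_diff)
  finally have "ln (1 + y) \<le> y - (s - 1)\<^sup>2" .
  moreover have "(s - 1)\<^sup>2 \<ge> y\<^sup>2 / (4 * (1 + y))"
  proof -
    have "y\<^sup>2 = (s - 1)\<^sup>2 * (s + 1)\<^sup>2" using s by (simp flip: power_mult_distrib add: algebra_simps power2_eq_square)
    also have "\<dots> \<le> (s - 1)\<^sup>2 * (2 * s)\<^sup>2" using s by (intro mult_left_mono power_mono) auto
    also have "\<dots> = (s - 1)\<^sup>2 * (4 * (1 + y))" using s by (simp add: power_mult_distrib)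
    finally show ?thesis using assms by (simp add: field_simps)
  qed
  ultimately show ?thesis by simp
qed

section \<open>Balls and distances\<close>

primrec nball :: "'a set set \<Rightarrow> 'a set \<Rightarrow> nat \<Rightarrow> 'a set" where
  "nball E S 0 = S"
| "nball E S (Suc j) = nball E S j \<union> {w. \<exists>u\<in>nball E S j. {u, w} \<in> E}"

lemma nball_mono: "S \<subseteq> S' \<Longrightarrow> nball E S j \<subseteq> nball E S' j"
  by (induction j) auto

lemma nball_le: "j \<le> k \<Longrightarrow> nball E S j \<subseteq> nball E S k"
  by (induction rule: dec_induct) auto

lemma nball_graph_mono: "E \<subseteq> E' \<Longrightarrow> nball E S j \<subseteq> nball E' S j"
  by (induction j) auto

lemma nball_UN: "nball E S j = (\<Union>s\<in>S. nball E {s} j)"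
  by (induction j) auto

lemma mem_nball_iff: "w \<in> nball E {s} j \<longleftrightarrow> (\<exists>l\<le>j. (w, s) \<in> adj E ^^ l)"
proof (induction j arbitrary: w)
  case (Suc j)
  have sym: "{u, w} \<in> E \<longleftrightarrow> (w, u) \<in> adj E" for u by (simp add: adj_def insert_commute)
  have "w \<in> nball E {s} (Suc j) \<longleftrightarrow> (\<exists>l\<le>j. (w, s) \<in> adj E ^^ l) \<or> (\<exists>u. (w, u) \<in> adj E \<and> (\<exists>l\<le>j. (u, s) \<in> adj E ^^ l))"
    using Suc.IH sym by auto
  also have "\<dots> \<longleftrightarrow> (\<exists>l\<le>j. (w, s) \<in> adj E ^^ l) \<or> (\<exists>l\<le>j. (w, s) \<in> adj E ^^ Suc l)"
    by (metis relpow_Suc_D2 relpow_Suc_I2)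
  also have "\<dots> \<longleftrightarrow> (\<exists>l\<le>Suc j. (w, s) \<in> adj E ^^ l)" (is "?l \<longleftrightarrow> ?r")
  proof
    assume ?r
    then obtain l where l: "l \<le> Suc j" "(w, s) \<in> adj E ^^ l" by blast
    then show ?l by (cases l) (auto simp del: relpow.simps(2) intro: exI[of _ 0])
  qed (metis Suc_le_mono le_SucI)
  finally show ?case .
qed simp

lemma gdist_le_iff: "gdist E w s \<le> enat j \<longleftrightarrow> w \<in> nball E {s} j"
proof -
  let ?L = "{l. (w, s) \<in> adj E ^^ l}"
  have "gdist E w s \<le> enat j \<longleftrightarrow> (\<exists>l\<in>?L. l \<le> j)"
  proof
    assume le: "gdist E w s \<le> enat j"
    have ne: "?L \<noteq> {}"
    proof
      assume "?L = {}"
      then have "gdist E w s = \<infinity>" unfolding gdist_def by (simp add: top_enat_def)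
      then show False using le by simp
    qed
    then have "enat ` ?L \<noteq> {}" by blast
    then have "Inf (enat ` ?L) \<in> enat ` ?L" by (rule wellorder_InfI[OF someI_ex[OF ex_in_conv[THEN iffD2]]])
    then obtain l where "l \<in> ?L" "gdist E w s = enat l" unfolding gdist_def by blast
    then show "\<exists>l\<in>?L. l \<le> j" using le by auto
  next
    assume "\<exists>l\<in>?L. l \<le> j"
    then obtain l where l: "l \<in> ?L" "l \<le> j" by blast
    then have "gdist E w s \<le> enat l" unfolding gdist_def by (intro INF_lower) auto
    also have "\<dots> \<le> enat j" using l by simp
    finally show "gdist E w s \<le> enat j" .
  qed
  then show ?thesis by (auto simp: mem_nball_iff)
qed

lemma enat_eqI_le: "(\<And>j. a \<le> enat j \<longleftrightarrow> b \<le> enat j) \<Longrightarrow> a = b"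
  by (metis antisym enat_ord_code(3) le_cases not_infinity_eq order_refl)

lemma gdist_eqI: "(\<And>j. u \<in> nball E {s} j \<longleftrightarrow> u' \<in> nball E {s} j) \<Longrightarrow> gdist E u s = gdist E u' s"
  by (rule enat_eqI_le) (simp add: gdist_le_iff)

text \<open>To build the ball of radius \<open>Suc r\<close> it suffices to look at edges with an
  end in the ball of radius \<open>r\<close>. Because of this extra step, exposing the edges at a
  ball also determines the next larger one.\<close>

lemma nball_agree:
  assumes "\<And>e. e \<inter> nball E S r \<noteq> {} \<Longrightarrow> e \<in> E' \<longleftrightarrow> e \<in> E" "A \<subseteq> S" "j \<le> Suc r"
  shows "nball E' A j = nball E A j"
  using assms(3)
proof (induction j)
  case (Suc j)
  have IH: "nball E' A j = nball E A j" using Suc by simp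
  have "nball E A j \<subseteq> nball E S r"
    using nball_le[of j r E A] nball_mono[OF assms(2), of E r] Suc.prems by auto
  then have "{u, w} \<in> E' \<longleftrightarrow> {u, w} \<in> E" if "u \<in> nball E A j" for u w
    using assms(1)[of "{u, w}"] that by blast
  then show ?case using IH by auto
qed simp

definition delete_vertices :: "'a set set \<Rightarrow> 'a set \<Rightarrow> 'a set set" where
  "delete_vertices E D = {e\<in>E. e \<inter> D = {}}"

text \<open>A path from \<open>s\<close> to \<open>w\<close> survives the deletion unless it visits
  \<open>v\<close>, and then \<open>v\<close> is reached strictly earlier than
  \<open>w\<close>.\<close>

lemma nball_delete_vertex:
  assumes "w \<noteq> v" "w \<in> nball E {s} j"
  shows "w \<in> nball (delete_vertices E {v}) {s} j \<or> (\<exists>l<j. v \<in> nball E {s} l)"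
  using assms
proof (induction j arbitrary: w)
  case (Suc j)
  show ?case
  proof (cases "w \<in> nball E {s} j")
    case True
    then show ?thesis using Suc.IH[OF Suc.prems(1)] by (auto intro: less_SucI)
  next
    case False
    then obtain u where u: "u \<in> nball E {s} j" "{u, w} \<in> E" using Suc.prems by auto
    show ?thesis
    proof (cases "u = v")
      case False
      then have "{u, w} \<in> delete_vertices E {v}" using u Suc.prems unfolding delete_vertices_def by auto
      then show ?thesis using Suc.IH[OF False u(1)] by (auto intro: less_SucI)
    qed (use u in auto)
  qed
qed auto

text \<open>The alternative through \<open>v\<close> does not mention \<open>u\<close>: the detour
  via \<open>v\<close> has the same length for all neighbours of \<open>v\<close>. So neighbours
  that agree in \<open>G - v\<close> also agree in \<open>G\<close>.\<close>

lemma nball_neighbour_iff: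
  assumes "{u, v} \<in> E" "u \<noteq> v" 
  shows "u \<in> nball E {s} (Suc j) \<longleftrightarrow> u \<in> nball (delete_vertices E {v}) {s} (Suc j) \<or> v \<in> nball E {s} j"
proof
  assume "u \<in> nball E {s} (Suc j)"
  from nball_delete_vertex[OF assms(2) this]
  show "u \<in> nball (delete_vertices E {v}) {s} (Suc j) \<or> v \<in> nball E {s} j"
    using nball_le[of _ j E "{s}"] by (auto simp: less_Suc_eq_le)
next
  have "delete_vertices E {v} \<subseteq> E" unfolding delete_vertices_def by auto
  then have sub: "nball (delete_vertices E {v}) {s} (Suc j) \<subseteq> nball E {s} (Suc j)"
    by (rule nball_graph_mono)
  assume "u \<in> nball (delete_vertices E {v}) {s} (Suc j) \<or> v \<in> nball E {s} j"
  then show "u \<in> nball E {s} (Suc j)"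
  proof
    assume "v \<in> nball E {s} j"
    then show ?thesis using assms(1) by (auto simp: insert_commute)
  qed (use sub in blast)
qed

text \<open>The radii fall into three ranges: up to \<open>r + 1\<close> membership can only be due
  to \<open>v\<close>, at \<open>r + 2\<close> it agrees by \<open>eq\<close>, and from
  \<open>r + 3\<close> on both vertices are inside.\<close>

lemma gdist_eq_of_neighbours:
  assumes u: "{u, v} \<in> E" "u \<noteq> v" and u': "{u', v} \<in> E" "u' \<noteq> v"
    and far: "u \<notin> nball (delete_vertices E {v}) {s} (Suc r)" "u' \<notin> nball (delete_vertices E {v}) {s} (Suc r)"
    and eq: "u \<in> nball (delete_vertices E {v}) {s} (Suc (Suc r)) \<longleftrightarrow> u' \<in> nball (delete_vertices E {v}) {s} (Suc (Suc r))"
    and near: "u \<in> nball E {s} (Suc (Suc (Suc r)))" "u' \<in> nball E {s} (Suc (Suc (Suc r)))"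
  shows "gdist E u s = gdist E u' s"
proof (rule gdist_eqI)
  fix j
  let ?E = "delete_vertices E {v}"
  show "u \<in> nball E {s} j \<longleftrightarrow> u' \<in> nball E {s} j"
  proof (cases j)
    case 0
    then show ?thesis using far nball_le[of 0 "Suc r" ?E "{s}"] by auto
  next
    case (Suc k)
    consider "Suc k \<le> Suc r" | "Suc k = Suc (Suc r)" | "Suc (Suc (Suc r)) \<le> Suc k" by linarith
    then show ?thesis
    proof cases
      case 1
      then have "u \<notin> nball ?E {s} (Suc k)" "u' \<notin> nball ?E {s} (Suc k)"
        using far nball_le[OF 1, of ?E "{s}"] by (meson subsetD)+
      then show ?thesis unfolding Suc nball_neighbour_iff[OF u] nball_neighbour_iff[OF u'] by simp
    next
      case 2
      then show ?thesis using eq unfolding Suc nball_neighbour_iff[OF u] nball_neighbour_iff[OF u'] by simp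
    next
      case 3
      then show ?thesis using near nball_le[OF 3, of E "{s}"] unfolding Suc by (meson subsetD)
    qed
  qed
qed

text \<open>If the diameter is at most \<open>r + 3\<close>, twins have the same distance vector with respect to \<open>S\<close>.\<close>

definition twins :: "'a set set \<Rightarrow> nat \<Rightarrow> 'a \<Rightarrow> 'a set \<Rightarrow> bool" where
  "twins E r v S \<longleftrightarrow> (\<exists>u u'. u \<noteq> u' \<and> {u, v} \<in> E \<and> {u', v} \<in> E \<and>
    (\<forall>s\<in>S. u \<notin> nball (delete_vertices E {v}) {s} (Suc r) \<and>
      u' \<notin> nball (delete_vertices E {v}) {s} (Suc r) \<and>
      (u \<in> nball (delete_vertices E {v}) {s} (Suc (Suc r)) \<longleftrightarrow>
       u' \<in> nball (delete_vertices E {v}) {s} (Suc (Suc r)))))"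

text \<open>Handles a sensor on \<open>v\<close> itself, about which \<open>G - v\<close> says
  nothing: both neighbours are at distance 1 from it.\<close>

lemma gdist_neighbours_self:
  assumes "{u, v} \<in> E" "u \<noteq> v" "{u', v} \<in> E" "u' \<noteq> v"
  shows "gdist E u v = gdist E u' v"
proof (rule gdist_eqI)
  fix j
  have "w \<in> nball E {v} (Suc k)" if "{w, v} \<in> E" for w k
  proof -
    have "w \<in> nball E {v} (Suc 0)" using that by (simp add: insert_commute)
    moreover have "nball E {v} (Suc 0) \<subseteq> nball E {v} (Suc k)" by (rule nball_le) simp
    ultimately show ?thesis by (rule rev_subsetD)
  qed
  then show "u \<in> nball E {v} j \<longleftrightarrow> u' \<in> nball E {v} j" using assms by (cases j) (auto simp del: nball.simps(2))
qed

text \<open>As the cop strategy is deterministic, the robber may be assumed to know the next sensor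
  set. From \<open>v\<close> the robber moves to one vertex of a pair of neighbours which that set
  cannot distinguish; the walk ending in the other vertex explains the same observations, so the
  position is never determined.\<close>

lemma not_cops_can_win:
  assumes "z \<in> V"
    and pair: "\<And>v S. v \<in> V \<Longrightarrow> S \<subseteq> V \<Longrightarrow> card S = k \<Longrightarrow>
      \<exists>a\<in>V. \<exists>b\<in>V. a \<noteq> b \<and> {a, v} \<in> E \<and> {b, v} \<in> E \<and> (\<forall>s\<in>S. gdist E a s = gdist E b s)"
  shows "\<not> cops_can_win V E k"
proof
  assume "cops_can_win V E k"
  then obtain \<sigma> where valid: "valid_strategy V k \<sigma>"
    and win: "\<And>v. (\<And>t. game_walk V E t v) \<Longrightarrow> \<exists>t\<ge>1. cops_win_in_round V E \<sigma> v t"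
    unfolding cops_can_win_def by metis
  define P where "P = (\<lambda>S v a b. a \<in> V \<and> b \<in> V \<and> a \<noteq> b \<and> {a, v} \<in> E \<and> {b, v} \<in> E
      \<and> (\<forall>s\<in>S. gdist E a s = gdist E b s))"
  have ex: "\<exists>ab. P (\<sigma> h) v (fst ab) (snd ab)" if "v \<in> V" for h v
    using pair[OF that, of "\<sigma> h"] valid unfolding valid_strategy_def P_def by fastforce
  define ch where "ch = (\<lambda>h v. SOME ab. P (\<sigma> h) v (fst ab) (snd ab))"
  have ch: "P (\<sigma> h) v (fst (ch h v)) (snd (ch h v))" if "v \<in> V" for h v
    unfolding ch_def using ex[OF that] by (rule someI_ex)
  \<comment> \<open>The state consists of the past observations and the present position. The
    position \<open>z\<close> at time 0 precedes the game; it only fixes whose neighbours are used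
    in round 1.\<close>
  define st where "st = rec_nat ([] :: ('a \<Rightarrow> enat) list, z)
      (\<lambda>_ (h, x). let a = fst (ch h x) in (h @ [dist_vec E (\<sigma> h) a], a))"
  define v where "v = (\<lambda>t. snd (st t))"
  have st0: "st 0 = ([], z)" unfolding st_def by simp
  have stS: "st (Suc t) = (fst (st t) @ [dist_vec E (\<sigma> (fst (st t))) (v (Suc t))], fst (ch (fst (st t)) (v t)))" for t
    unfolding st_def v_def by (simp add: case_prod_unfold Let_def)
  have obs: "observations E \<sigma> v t = fst (st t)" for t
    by (induction t) (simp_all add: st0 stS)
  have vS: "v (Suc t) = fst (ch (fst (st t)) (v t))" for t
    using stS[of t] unfolding v_def by (metis snd_conv)
  have vV: "v t \<in> V" for t
  proof (induction t)
    case 0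
    then show ?case using assms(1) by (simp add: v_def st0)
  next
    case (Suc t)
    from ch[OF this, of "fst (st t)"] show ?case unfolding vS[of t] P_def by blast
  qed
  have step: "P (\<sigma> (observations E \<sigma> v t)) (v t) (v (Suc t)) (snd (ch (fst (st t)) (v t)))" for t
    using ch[OF vV[of t], of "fst (st t)"] by (simp add: obs vS)
  have adjv: "(v t, v (Suc t)) \<in> adj E" for t
    using step[of t] unfolding P_def adj_def by (simp add: insert_commute)
  have walk: "game_walk V E t v" for t
    unfolding game_walk_def using vV adjv by blast
  then obtain t where t: "t \<ge> 1" "cops_win_in_round V E \<sigma> v t" using win by blast
  define b where "b = snd (ch (fst (st (t - 1))) (v (t - 1)))"
  have Pb: "P (\<sigma> (observations E \<sigma> v (t - 1))) (v (t - 1)) (v t) b"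
    using step[of "t - 1"] t(1) unfolding b_def by simp
  have "game_walk V E t (v(t := b))"
    unfolding game_walk_def
  proof (intro conjI ballI)
    fix j assume "j \<in> {1..t}"
    then show "(v(t := b)) j \<in> V" using Pb vV unfolding P_def by auto
  next
    fix j assume j: "j \<in> {1..<t}"
    show "(v(t := b)) (Suc j) = (v(t := b)) j \<or> ((v(t := b)) j, (v(t := b)) (Suc j)) \<in> adj E"
    proof (cases "Suc j = t")
      case True
      then have "j = t - 1" by simp
      then show ?thesis using True Pb unfolding P_def adj_def by (auto simp: insert_commute)
    qed (use j adjv in auto)
  qed
  moreover have "dist_vec E (sensors E \<sigma> v j) ((v(t := b)) j) = dist_vec E (sensors E \<sigma> v j) (v j)"
    if "j \<in> {1..t}" for j
    using Pb that unfolding P_def sensors_def dist_vec_def by auto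
  ultimately have "v t = (v(t := b)) t"
    using t(2) walk unfolding cops_win_in_round_def by blast
  then show False using Pb unfolding P_def by simp
qed

text \<open>Ensures that the \<open>LEAST\<close> in \<open>localization_number\<close> is attained:
  the sensor on the robber's own vertex reads distance 0, so one round is enough.\<close>

lemma cops_can_win_all_sensors:
  assumes "finite V"
  shows "cops_can_win V E (card V)"
  unfolding cops_can_win_def
proof (intro exI[of _ "\<lambda>_. V"] conjI allI impI)
  fix v assume "\<forall>t. game_walk V E t v"
  have eq: "x = v 1" if "x \<in> V" "v 1 \<in> V" "dist_vec E V x = dist_vec E V (v 1)" for x
  proof -
    have "gdist E x (v 1) = gdist E (v 1) (v 1)"
      using fun_cong[OF that(3), of "v 1"] that(2) unfolding dist_vec_def by simp
    moreover have "gdist E (v 1) (v 1) \<le> enat 0" unfolding gdist_le_iff by simp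
    ultimately show ?thesis using gdist_le_iff[of E x "v 1" 0] by simp
  qed
  have "v 1 \<in> V" using \<open>\<forall>t. game_walk V E t v\<close> unfolding game_walk_def by (metis atLeastAtMost_singleton insertI1)
  then have "cops_win_in_round V E (\<lambda>_. V) v 1"
    unfolding cops_win_in_round_def game_walk_def sensors_def using eq by (simp del: One_nat_def) metis
  then show "\<exists>t\<ge>1. cops_win_in_round V E (\<lambda>_. V) v t" by blast
qed (auto simp: valid_strategy_def)

lemma localization_number_le: "cops_can_win V E k \<Longrightarrow> localization_number V E \<le> k"
  unfolding localization_number_def by (rule Least_le)

lemma le_localization_number:
  assumes "finite V" "\<And>k. real k < b \<Longrightarrow> \<not> cops_can_win V E k"
  shows "b \<le> real (localization_number V E)"
proof -
  have "cops_can_win V E (localization_number V E)"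
    unfolding localization_number_def using cops_can_win_all_sensors[OF assms(1)] by (rule LeastI)
  then show ?thesis using assms(2) not_le by blast
qed

section \<open>A strategy for the cops\<close>

text \<open>Greedy choice: averaged over \<open>z\<close>, a sensor leaves at most the fraction
  \<open>1 - s\<close> of the remaining pairs unseparated, so some sensor does at least as well. The
  chosen sensor may repeat, hence \<open>card S \<le> k\<close> rather than equality.\<close>

lemma exists_separating_sensors:
  fixes s :: real
  assumes V: "finite V" "V \<noteq> {}" and P: "finite P" and s: "s \<le> 1"
    and sep: "\<And>x y. (x, y) \<in> P \<Longrightarrow> s * card V \<le> card {z\<in>V. gdist E x z \<noteq> gdist E y z}"
  shows "\<exists>S\<subseteq>V. card S \<le> k \<and> real (card {(x, y)\<in>P. \<forall>z\<in>S. gdist E x z = gdist E y z}) \<le> (1 - s) ^ k * card P"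
proof (induction k)
  case 0
  show ?case by (intro exI[of _ "{}"]) (auto intro!: card_mono P)
next
  case (Suc k)
  then obtain S where S: "S \<subseteq> V" "card S \<le> k"
    "real (card {(x, y)\<in>P. \<forall>z\<in>S. gdist E x z = gdist E y z}) \<le> (1 - s) ^ k * card P" by blast
  define R where "R = {(x, y)\<in>P. \<forall>z\<in>S. gdist E x z = gdist E y z}"
  have R: "finite R" "R \<subseteq> P" using P unfolding R_def by (auto intro: finite_subset)
  define B where "B = (\<lambda>z. {(x, y)\<in>R. gdist E x z = gdist E y z})"
  have "(\<Sum>z\<in>V. real (card (B z))) = (\<Sum>z\<in>V. \<Sum>(x, y)\<in>R. if gdist E x z = gdist E y z then 1 else 0)"
    using R unfolding B_def by (intro sum.cong refl) (simp add: sum.If_cases case_prod_unfold Int_def)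
  also have "\<dots> = (\<Sum>(x, y)\<in>R. \<Sum>z\<in>V. if gdist E x z = gdist E y z then 1 else 0)"
    by (subst sum.swap) (simp add: case_prod_unfold)
  also have "\<dots> \<le> (\<Sum>(x, y)\<in>R. (1 - s) * card V)"
  proof (rule sum_mono, clarify)
    fix x y assume "(x, y) \<in> R"
    then have "s * card V \<le> card {z\<in>V. gdist E x z \<noteq> gdist E y z}" using R sep by auto
    moreover have "card V = card {z\<in>V. gdist E x z \<noteq> gdist E y z} + card {z\<in>V. gdist E x z = gdist E y z}"
      using V by (subst card_Un_disjoint[symmetric]) (auto intro: arg_cong[where f = card])
    ultimately show "(\<Sum>z\<in>V. if gdist E x z = gdist E y z then 1 else 0) \<le> (1 - s) * card V"
      using V by (simp add: sum.If_cases Int_def algebra_simps)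
  qed
  also have "\<dots> = card R * ((1 - s) * card V)" by (simp add: case_prod_unfold)
  finally have le: "(\<Sum>z\<in>V. real (card (B z))) \<le> (\<Sum>z\<in>V. (1 - s) * card R)" by (simp add: mult_ac)
  have "\<exists>z\<in>V. real (card (B z)) \<le> (1 - s) * card R"
  proof (rule ccontr)
    assume "\<not> ?thesis"
    then have "(\<Sum>z\<in>V. (1 - s) * card R) < (\<Sum>z\<in>V. real (card (B z)))"
      using V by (intro sum_strict_mono) auto
    then show False using le by linarith
  qed
  then obtain z where z: "z \<in> V" "real (card (B z)) \<le> (1 - s) * card R" by blast
  have "{(x, y)\<in>P. \<forall>z\<in>insert z S. gdist E x z = gdist E y z} = B z"
    unfolding B_def R_def by auto
  moreover have "real (card (B z)) \<le> (1 - s) ^ Suc k * card P"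
    using z(2) mult_left_mono[OF S(3)[folded R_def], of "1 - s"] s by (simp add: mult_ac)
  moreover have "card (insert z S) \<le> Suc k" using S(1,2) V(1) by (simp add: card_insert_if finite_subset)
  ultimately show ?case using z S by (intro exI[of _ "insert z S"]) auto
qed

text \<open>A class with at least \<open>m\<close> vertices would contain at least
  \<open>m\<^sup>2 / 2\<close> ordered unseparated pairs, but at most
  \<open>(D * m)\<^sup>2 * (1 - s) ^ k\<close>, hence at most \<open>m\<^sup>2 / 4\<close>, remain.
  In the game \<open>m\<close> is the previous number of candidates and \<open>D\<close> the growth
  factor of a closed neighbourhood.\<close>

lemma exists_sensors_small_classes:
  fixes s D :: real
  assumes V: "finite V" "k \<le> card V" and s: "s \<le> 1"
    and sep: "\<And>x y. x \<in> V \<Longrightarrow> y \<in> V \<Longrightarrow> x \<noteq> y \<Longrightarrow> s * card V \<le> card {z\<in>V. gdist E x z \<noteq> gdist E y z}"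
    and U: "U \<subseteq> V" "card U \<le> D * m" and m: "2 \<le> m" and small: "D\<^sup>2 * (1 - s) ^ k \<le> 1 / 4"
  shows "\<exists>S\<subseteq>V. card S = k \<and> (\<forall>C\<subseteq>U. (\<forall>x\<in>C. \<forall>y\<in>C. dist_vec E S x = dist_vec E S y) \<longrightarrow> card C < m)"
proof (cases "V = {}")
  case True
  then have "k = 0" using V by simp
  then show ?thesis using m U True by (intro exI[of _ "{}"]) auto
next
  case False
  define P where "P = {(x, y)\<in>U \<times> U. x \<noteq> y}"
  have finU: "finite U" using U V finite_subset by blast
  then have finP: "finite P" unfolding P_def by (auto intro: finite_subset[of _ "U \<times> U"])
  have cP: "card P \<le> card U * card U"
    unfolding card_cartesian_product[symmetric] using finU by (intro card_mono) (auto simp: P_def)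
  obtain S where S: "S \<subseteq> V" "card S \<le> k"
    "real (card {(x, y)\<in>P. \<forall>z\<in>S. gdist E x z = gdist E y z}) \<le> (1 - s) ^ k * card P"
  proof -
    have "\<exists>S\<subseteq>V. card S \<le> k \<and> real (card {(x, y)\<in>P. \<forall>z\<in>S. gdist E x z = gdist E y z}) \<le> (1 - s) ^ k * card P"
      using V(1) False finP s by (rule exists_separating_sensors) (use sep U in \<open>auto simp: P_def\<close>)
    then show ?thesis using that by blast
  qed
  \<comment> \<open>Padding to exactly \<open>k\<close> sensors only refines the classes.\<close>
  obtain S' where S': "S \<subseteq> S'" "S' \<subseteq> V" "card S' = k"
    using exists_subset_between[OF S(2) V(2) S(1) V(1)] by metis
  have key: "card C < m" if C: "C \<subseteq> U" "\<And>x y. x \<in> C \<Longrightarrow> y \<in> C \<Longrightarrow> dist_vec E S' x = dist_vec E S' y" for C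
  proof (rule ccontr)
    assume "\<not> card C < m"
    then have Cm: "m \<le> card C" by simp
    have finC: "finite C" using C finU finite_subset by blast
    let ?R = "{(x, y)\<in>P. \<forall>z\<in>S. gdist E x z = gdist E y z}"
    have sub: "(C \<times> C) - (\<lambda>x. (x, x)) ` C \<subseteq> ?R"
    proof clarify
      fix x y assume xy: "x \<in> C" "y \<in> C" "(x, y) \<notin> (\<lambda>x. (x, x)) ` C"
      then have "x \<noteq> y" by auto
      moreover have "gdist E x z = gdist E y z" if "z \<in> S" for z
        using fun_cong[OF C(2)[OF xy(1,2)], of z] that S' unfolding dist_vec_def by auto
      ultimately show "(x, y) \<in> P \<and> (\<forall>z\<in>S. gdist E x z = gdist E y z)"
        using xy C unfolding P_def by auto
    qed
    have "card ((C \<times> C) - (\<lambda>x. (x, x)) ` C) = card (C \<times> C) - card ((\<lambda>x. (x, x)) ` C)"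
      using finC by (intro card_Diff_subset) auto
    also have "\<dots> = card C * card C - card C"
      by (subst card_image) (auto simp: inj_on_def card_cartesian_product)
    finally have "card C * card C - card C \<le> card ?R"
      using card_mono[OF _ sub] finP by (metis (no_types, lifting) finite_subset mem_Collect_eq subsetI case_prodE)
    moreover have "m * m \<le> 2 * (card C * card C - card C)"
    proof -
      have "m * m \<le> card C * card C" using Cm by (intro mult_mono) auto
      moreover have "2 * card C \<le> card C * card C" using Cm m by (intro mult_right_mono) auto
      ultimately show ?thesis by linarith
    qed
    ultimately have "m * m \<le> 2 * card ?R" by linarith
    then have "real (m * m) \<le> real (2 * card ?R)" by (simp only: of_nat_le_iff)
    then have "real (m * m) \<le> 2 * real (card ?R)" by (simp only: of_nat_mult of_nat_numeral)
    also have "\<dots> \<le> 2 * ((1 - s) ^ k * real (card P))" using S(3) by simp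
    also have "\<dots> \<le> 2 * ((1 - s) ^ k * (D * m)\<^sup>2)"
    proof -
      have "real (card P) \<le> real (card U) * real (card U)" using cP by (simp flip: of_nat_mult)
      also have "\<dots> \<le> (D * m)\<^sup>2" unfolding power2_eq_square using U(2) by (intro mult_mono) (auto intro: order_trans[OF of_nat_0_le_iff])
      finally show ?thesis using s by (intro mult_left_mono) auto
    qed
    also have "\<dots> = 2 * (D\<^sup>2 * (1 - s) ^ k) * (real m)\<^sup>2" by (simp add: power_mult_distrib)
    also have "\<dots> \<le> 2 * (1 / 4) * (real m)\<^sup>2"
      by (intro mult_right_mono mult_left_mono small) simp_all
    finally have "real m * real m \<le> 1 / 2 * (real m * real m)"
      unfolding power2_eq_square of_nat_mult by linarith
    moreover have "0 < real m * real m" using m by simp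
    ultimately show False by linarith
  qed
  show ?thesis
  proof (intro exI[of _ S'] conjI allI impI S'(2,3))
    fix C assume "C \<subseteq> U" and "\<forall>x\<in>C. \<forall>y\<in>C. dist_vec E S' x = dist_vec E S' y"
    then show "card C < m" using key[of C] by blast
  qed
qed

definition closed_nbhd :: "'a set \<Rightarrow> 'a set set \<Rightarrow> 'a set \<Rightarrow> 'a set" where
  "closed_nbhd V E R = R \<union> {w\<in>V. \<exists>u\<in>R. (u, w) \<in> adj E}"

lemma cops_can_win_if_shrinking:
  assumes fin: "finite V" "k \<le> card V"
    and shrink: "\<And>R. R \<subseteq> V \<Longrightarrow> 2 \<le> card R \<Longrightarrow>
      \<exists>S\<subseteq>V. card S = k \<and>
        (\<forall>C\<subseteq>closed_nbhd V E R. (\<forall>x\<in>C. \<forall>y\<in>C. dist_vec E S x = dist_vec E S y) \<longrightarrow> card C < card R)"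
  shows "cops_can_win V E k"
proof -
  define good where "good = (\<lambda>R S. S \<subseteq> V \<and> card S = k \<and> (2 \<le> card R \<and> R \<subseteq> V \<longrightarrow>
    (\<forall>C\<subseteq>closed_nbhd V E R. (\<forall>x\<in>C. \<forall>y\<in>C. dist_vec E S x = dist_vec E S y) \<longrightarrow> card C < card R)))"
  have "\<exists>S. good R S" for R
  proof (cases "2 \<le> card R \<and> R \<subseteq> V")
    case True
    then show ?thesis using shrink[of R] unfolding good_def by blast
  next
    case False
    obtain S where "S \<subseteq> V" "card S = k" using obtain_subset_with_card_n[OF fin(2)] by blast
    then show ?thesis using False unfolding good_def by blast
  qed
  then obtain ch where ch: "\<And>R. good R (ch R)" by metis
  txt \<open>The state consists of the candidate set after the last round and the set available in the next one.\<close>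
  define upd where "upd = (\<lambda>(R, U) f. let R' = {u\<in>U. dist_vec E (ch R) u = f} in (R', closed_nbhd V E R'))"
  \<comment> \<open>In the state before round 1 every vertex is possible, and \<open>{}\<close> is a
    placeholder for which \<open>good\<close> demands no more than \<open>k\<close> vertices of
    \<open>V\<close>.\<close>
  define st where "st = foldl upd ({}, V)"
  define \<sigma> where "\<sigma> = (\<lambda>h. ch (fst (st h)))"
  have valid: "valid_strategy V k \<sigma>" using ch unfolding valid_strategy_def \<sigma>_def good_def by auto
  have st0: "st [] = ({}, V)" unfolding st_def by simp
  have st1: "fst (st (h @ [f])) = {u\<in>snd (st h). dist_vec E (\<sigma> h) u = f}"
    and st2: "snd (st (h @ [f])) = closed_nbhd V E (fst (st (h @ [f])))" for h f
    unfolding st_def \<sigma>_def upd_def by (auto simp: case_prod_unfold Let_def)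
  have sub: "fst (st h) \<subseteq> V \<and> snd (st h) \<subseteq> V" for h
    by (induction h rule: rev_induct) (auto simp: st0 st1 st2 closed_nbhd_def)
  have "\<exists>t\<ge>1. cops_win_in_round V E \<sigma> v t" if walk: "\<And>t. game_walk V E t v" for v
  proof -
    define R where "R = (\<lambda>t. fst (st (observations E \<sigma> v t)))"
    \<comment> \<open>\<open>R t\<close> contains the end of every walk that explains the
      observations, not only the robber's; this is what turns a set with at most one element into a
      win.\<close>
    have mem: "w t \<in> R t" if "1 \<le> t" "game_walk V E t w"
      "\<And>j. j \<in> {1..t} \<Longrightarrow> dist_vec E (sensors E \<sigma> v j) (w j) = dist_vec E (sensors E \<sigma> v j) (v j)" for w t
      using that
    proof (induction t)
      case (Suc t)
      have d: "dist_vec E (\<sigma> (observations E \<sigma> v t)) (w (Suc t)) = dist_vec E (\<sigma> (observations E \<sigma> v t)) (v (Suc t))"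
        using Suc.prems(3)[of "Suc t"] unfolding sensors_def by simp
      have wV: "w (Suc t) \<in> V" using Suc.prems(2) unfolding game_walk_def by auto
      have "w (Suc t) \<in> snd (st (observations E \<sigma> v t))"
      proof (cases t)
        case 0
        then show ?thesis using wV by (simp add: st0)
      next
        case (Suc t')
        have "game_walk V E t w" using Suc.prems(2) unfolding game_walk_def by auto
        then have "w t \<in> R t" using Suc.IH Suc Suc.prems(3) by simp
        moreover have "w (Suc t) = w t \<or> (w t, w (Suc t)) \<in> adj E"
          using Suc.prems(2) Suc unfolding game_walk_def by auto
        moreover have "snd (st (observations E \<sigma> v t)) = closed_nbhd V E (R t)"
          unfolding R_def Suc by (simp add: st2)
        ultimately show ?thesis using wV unfolding closed_nbhd_def by auto
      qed
      then show ?case using d unfolding R_def by (simp add: st1)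
    qed simp
    have RV: "R t \<subseteq> V" "finite (R t)" for t
      using sub fin(1) finite_subset unfolding R_def by blast+
    have step: "card (R (Suc t)) < card (R t)" if "1 \<le> t" "2 \<le> card (R t)" for t
    proof -
      obtain t' where t': "t = Suc t'" using \<open>1 \<le> t\<close> by (cases t) auto
      have Suc: "R (Suc t) = {u\<in>snd (st (observations E \<sigma> v t)).
          dist_vec E (ch (R t)) u = dist_vec E (ch (R t)) (v (Suc t))}"
        unfolding R_def by (simp add: st1 \<sigma>_def)
      have "snd (st (observations E \<sigma> v t)) = closed_nbhd V E (R t)"
        unfolding R_def t' by (simp add: st2)
      then have "R (Suc t) \<subseteq> closed_nbhd V E (R t)" using Suc by auto
      moreover have "\<forall>x\<in>R (Suc t). \<forall>y\<in>R (Suc t). dist_vec E (ch (R t)) x = dist_vec E (ch (R t)) y"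
        unfolding Suc by simp
      ultimately show ?thesis using ch[of "R t"] that(2) RV(1)[of t] unfolding good_def by blast
    qed
    have "\<exists>t\<ge>1. card (R t) \<le> 1"
    proof (rule ccontr)
      assume "\<not> ?thesis"
      then have big: "2 \<le> card (R t)" if "1 \<le> t" for t using that by (metis Suc_1 not_less_eq_eq One_nat_def)
      have "card (R (Suc t)) + t \<le> card V" for t
      proof (induction t)
        case 0
        then show ?case using RV fin(1) by (simp add: card_mono)
      next
        case (Suc t)
        then show ?case using step[OF _ big, of "Suc t"] by simp
      qed
      from this[of "card V"] show False using big[of "Suc (card V)"] by simp
    qed
    then obtain t where t: "1 \<le> t" "card (R t) \<le> 1" by blast
    have "x = y" if "x \<in> R t" "y \<in> R t" for x y
      using t(2) that RV(2) by (metis One_nat_def card_le_Suc0_iff_eq)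
    then have "cops_win_in_round V E \<sigma> v t"
      using mem[OF t(1)] unfolding cops_win_in_round_def by blast
    then show ?thesis using t(1) by blast
  qed
  then show ?thesis using valid unfolding cops_can_win_def by blast
qed

section \<open>Exposing balls in the random graph\<close>

abbreviation edge_bits :: "nat \<Rightarrow> real \<Rightarrow> (nat set \<Rightarrow> bool) pmf" where
  "edge_bits n q \<equiv> Pi_pmf (vertex_pairs n) False (\<lambda>_. bernoulli_pmf q)"

definition edges_of :: "nat \<Rightarrow> (nat set \<Rightarrow> bool) \<Rightarrow> nat set set" where
  "edges_of n f = {e \<in> vertex_pairs n. f e}"

lemma prob_gnp: "measure_pmf.prob (gnp n q) {E. R E} = measure_pmf.prob (edge_bits n q) {f. R (edges_of n f)}"
  unfolding gnp_def edges_of_def by (simp add: vimage_def)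

lemma finite_vertex_pairs: "finite (vertex_pairs n)"
  unfolding vertex_pairs_def by (rule finite_subset[of _ "Pow {1..n}"]) auto

lemma edges_of_subset: "edges_of n f \<subseteq> vertex_pairs n"
  unfolding edges_of_def by blast

lemma pair_in_vertex_pairs: "{u, w} \<in> vertex_pairs n \<longleftrightarrow> u \<noteq> w \<and> u \<in> {1..n} \<and> w \<in> {1..n}"
  unfolding vertex_pairs_def by (auto simp: card_insert_if)

lemma nball_delete_subset:
  assumes "E \<subseteq> vertex_pairs n" "S \<subseteq> {1..n} - D"
  shows "nball (delete_vertices E D) S j \<subseteq> {1..n} - D"
proof (induction j)
  case (Suc j)
  have "w \<in> {1..n} - D" if "{u, w} \<in> delete_vertices E D" for u w
    using that assms(1) pair_in_vertex_pairs[of u w n] unfolding delete_vertices_def by auto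
  then show ?case using Suc by auto
qed (use assms in auto)

definition core :: "nat \<Rightarrow> nat set \<Rightarrow> nat set \<Rightarrow> nat \<Rightarrow> (nat set \<Rightarrow> bool) \<Rightarrow> nat set" where
  "core n S D r f = nball (delete_vertices (edges_of n f) D) S r"

definition cells :: "nat \<Rightarrow> nat set \<Rightarrow> nat set \<Rightarrow> nat \<Rightarrow> (nat set \<Rightarrow> bool) \<Rightarrow> nat \<Rightarrow> nat set" where
  "cells n S D r f = (\<lambda>s. if s \<in> S then nball (delete_vertices (edges_of n f) D) {s} (Suc r) else {})"

definition fresh_vertices :: "nat \<Rightarrow> nat set \<Rightarrow> nat set \<Rightarrow> nat set" where
  "fresh_vertices n D B = {1..n} - D - B"

text \<open>Pairs meeting the core are inspected by the exploration and pairs meeting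
  \<open>D\<close> are not, so the core is removed and \<open>D\<close> is added. In the
  applications \<open>D\<close> is empty or a single vertex.\<close>

definition exposed :: "nat set \<Rightarrow> nat set \<Rightarrow> nat set \<Rightarrow> nat set" where
  "exposed D P B = (B - P) \<union> D"

definition fresh_nbhds :: "nat \<Rightarrow> nat set \<Rightarrow> nat set \<Rightarrow> nat \<Rightarrow> (nat set \<Rightarrow> bool) \<Rightarrow> nat \<Rightarrow> nat set" where
  "fresh_nbhds n S D r f = (\<lambda>w. if w \<in> fresh_vertices n D (\<Union>(cells n S D r f ` S))
     then {y \<in> exposed D (core n S D r f) (\<Union>(cells n S D r f ` S)). f {w, y}} else {})"

text \<open>The inspected pairs are those avoiding \<open>D\<close> that meet the core. By
  \<open>nball_agree\<close> they determine the core and the cells, which is the stopping property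
  needed for resampling; hence, given core and cells, the fresh neighbourhoods may be treated as
  independent random subsets.\<close>

lemma prob_explored_le:
  fixes Good :: "nat set \<Rightarrow> (nat \<Rightarrow> nat set) \<Rightarrow> bool"
    and Bad :: "nat set \<Rightarrow> (nat \<Rightarrow> nat set) \<Rightarrow> (nat \<Rightarrow> nat set) \<Rightarrow> bool"
    and S D :: "nat set" and n r :: nat and q \<beta> :: real
  assumes S: "S \<subseteq> {1..n} - D" and D: "D \<subseteq> {1..n}" and "0 \<le> \<beta>"
    and fresh_le: "\<And>P T. Good P T \<Longrightarrow> P \<subseteq> \<Union>(T ` S) \<Longrightarrow> \<Union>(T ` S) \<subseteq> {1..n} - D \<Longrightarrow>
      measure_pmf.prob (Pi_pmf (fresh_vertices n D (\<Union>(T ` S))) {} (\<lambda>_. random_subset (exposed D P (\<Union>(T ` S))) q))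
        {\<nu>. Bad P T \<nu>} \<le> \<beta>"
  shows "measure_pmf.prob (edge_bits n q)
    {f. Good (core n S D r f) (cells n S D r f) \<and> Bad (core n S D r f) (cells n S D r f) (fresh_nbhds n S D r f)} \<le> \<beta>"
proof -
  define P where "P = (\<lambda>f. nball (delete_vertices (edges_of n f) D) S r)"
  define T where "T = (\<lambda>f s. if s \<in> S then nball (delete_vertices (edges_of n f) D) {s} (Suc r) else {})"
  define W where "W = (\<lambda>B. {1..n} - D - B)"
  define Y where "Y = (\<lambda>P B. (B - P) \<union> D)"
  have eqs: "core n S D r = P" "cells n S D r = T" "fresh_vertices n D = W" "exposed D = Y"
    unfolding core_def cells_def fresh_vertices_def exposed_def P_def T_def W_def Y_def
    by (simp_all add: fun_eq_iff del: nball.simps)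
  note fresh = fresh_le[unfolded eqs]
  define Q where "Q = (\<lambda>f. {e\<in>vertex_pairs n. e \<inter> D = {} \<and> e \<inter> P f \<noteq> {}})"
  have agree: "P f' = P f \<and> T f' = T f" if "\<And>e. e \<in> Q f \<Longrightarrow> f' e = f e" for f f'
  proof -
    have e: "e \<in> delete_vertices (edges_of n f') D \<longleftrightarrow> e \<in> delete_vertices (edges_of n f) D"
      if "e \<inter> nball (delete_vertices (edges_of n f) D) S r \<noteq> {}" for e
      using \<open>\<And>e. e \<in> Q f \<Longrightarrow> f' e = f e\<close>[of e] that
      unfolding Q_def P_def delete_vertices_def edges_of_def by auto
    have nb: "nball (delete_vertices (edges_of n f') D) A j = nball (delete_vertices (edges_of n f) D) A j"
      if "A \<subseteq> S" "j \<le> Suc r" for A j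
      by (rule nball_agree[OF e that])
    have "nball (delete_vertices (edges_of n f') D) {s} (Suc r) = nball (delete_vertices (edges_of n f) D) {s} (Suc r)"
      if "s \<in> S" for s
      by (rule nb) (use that in simp_all)
    moreover have "nball (delete_vertices (edges_of n f') D) S r = nball (delete_vertices (edges_of n f) D) S r"
      by (rule nb) simp_all
    ultimately show ?thesis unfolding P_def T_def by (simp del: nball.simps cong: if_cong)
  qed
  have B: "\<Union>(T f ` S) = nball (delete_vertices (edges_of n f) D) S (Suc r)" for f
    unfolding T_def by (subst nball_UN) (simp del: nball.simps)
  have BV: "\<Union>(T f ` S) \<subseteq> {1..n} - D" for f
    unfolding B by (rule nball_delete_subset[OF edges_of_subset S])
  have PB: "P f \<subseteq> \<Union>(T f ` S)" for f
    unfolding B P_def by (rule nball_le) simp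
  show ?thesis
    unfolding fresh_nbhds_def eqs
  proof (rule prob_resample_le[where Q = Q, OF finite_vertex_pairs])
    show "Q f' = Q f" if "\<And>e. e \<in> Q f \<Longrightarrow> f' e = f e" for f f'
      using agree[of f f', OF that] unfolding Q_def by simp
    show "Q f \<subseteq> vertex_pairs n" for f unfolding Q_def by blast
    have ov: "P (override_off f (Q f) f') = P f" "T (override_off f (Q f) f') = T f" for f f'
      using agree[of f "override_off f (Q f) f'"] unfolding override_off_def by simp_all
    show "Good (P f) (T f)" if "Good (P (override_off f (Q f) f')) (T (override_off f (Q f) f'))" for f f'
      using that unfolding ov .
    fix f assume good: "Good (P f) (T f)"
    let ?B = "\<Union>(T f ` S)"
    let ?W = "W ?B" and ?Y = "Y (P f) ?B"
    have "{w, y} \<notin> Q f" if "w \<in> ?W" "y \<in> ?Y" for w y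
      using that PB[of f] unfolding W_def Y_def Q_def by blast
    then have eq: "(\<lambda>w. if w \<in> ?W then {y\<in>?Y. override_off f (Q f) f' {w, y}} else {})
        = (\<lambda>w. if w \<in> ?W then {y\<in>?Y. f' {w, y}} else {})" for f'
      unfolding override_off_def by (intro ext) (metis (no_types, lifting))
    have disj: "?W \<inter> ?Y = {}" "?W \<subseteq> {1..n}" "?Y \<subseteq> {1..n}"
      using BV[of f] D unfolding W_def Y_def by blast+
    have fin: "finite ?W" "finite ?Y"
      using disj(2,3) by (simp_all add: finite_subset)
    have map: "map_pmf (\<lambda>f' w. if w \<in> ?W then {y\<in>?Y. f' {w, y}} else {}) (edge_bits n q)
        = Pi_pmf ?W {} (\<lambda>_. random_subset ?Y q)"
    proof (rule map_Pi_pmf_blocks[where c = "\<lambda>w y. {w, y}", OF finite_vertex_pairs fin(1) fin(2)])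
      show "inj_on (\<lambda>(w, y). {w, y}) (Sigma ?W (\<lambda>_. ?Y))"
      proof (rule inj_onI, clarify)
        fix a b c d assume "a \<in> ?W" "b \<in> ?Y" "c \<in> ?W" "d \<in> ?Y" "{a, b} = {c, d}"
        moreover from this disj(1) have "a \<noteq> d" "b \<noteq> c" by blast+
        ultimately show "a = c \<and> b = d" by (simp add: doubleton_eq_iff)
      qed
      show "{w, y} \<in> vertex_pairs n" if "w \<in> ?W" "y \<in> ?Y" for w y
        unfolding pair_in_vertex_pairs using that disj by blast
    qed
    have "measure_pmf.prob (edge_bits n q) {f'. Bad (P (override_off f (Q f) f')) (T (override_off f (Q f) f'))
          (\<lambda>w. if w \<in> W (\<Union>(T (override_off f (Q f) f') ` S))
            then {y\<in>Y (P (override_off f (Q f) f')) (\<Union>(T (override_off f (Q f) f') ` S)). override_off f (Q f) f' {w, y}} else {})}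
        = measure_pmf.prob (Pi_pmf ?W {} (\<lambda>_. random_subset ?Y q)) {\<nu>. Bad (P f) (T f) \<nu>}"
      unfolding ov eq map[symmetric] measure_map_pmf by (simp add: vimage_def)
    also have "\<dots> \<le> \<beta>" by (rule fresh[OF good PB BV])
    finally show "measure_pmf.prob (edge_bits n q) {f'. Bad (P (override_off f (Q f) f')) (T (override_off f (Q f) f'))
          (\<lambda>w. if w \<in> W (\<Union>(T (override_off f (Q f) f') ` S))
            then {y\<in>Y (P (override_off f (Q f) f')) (\<Union>(T (override_off f (Q f) f') ` S)). override_off f (Q f) f' {w, y}} else {})}
        \<le> \<beta>" .
  qed fact
qed

text \<open>If \<open>w\<close> had a neighbour in the core, it would already be in the ball of
  radius \<open>r + 1\<close>. So whether \<open>w\<close> is within distance \<open>r + 2\<close>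
  of \<open>s\<close> depends on uninspected pairs only.\<close>

lemma fresh_nbhd_meets_iff:
  assumes E: "E \<subseteq> vertex_pairs n" and S: "S \<subseteq> {1..n} - D" "s \<in> S"
    and w: "w \<in> {1..n} - D - nball (delete_vertices E D) S (Suc r)"
  shows "w \<in> nball (delete_vertices E D) {s} (Suc (Suc r)) \<longleftrightarrow>
    (\<exists>y\<in>nball (delete_vertices E D) {s} (Suc r) - nball (delete_vertices E D) S r. {w, y} \<in> E)"
proof -
  let ?E = "delete_vertices E D"
  have sub: "nball ?E {s} (Suc r) \<subseteq> nball ?E S (Suc r)" by (rule nball_mono) (use S in blast)
  have "w \<in> nball ?E {s} (Suc (Suc r)) \<longleftrightarrow> (\<exists>y\<in>nball ?E {s} (Suc r). {y, w} \<in> ?E)"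
    using w sub unfolding nball.simps(2)[of _ _ "Suc r"] by blast
  also have "\<dots> \<longleftrightarrow> (\<exists>y\<in>nball ?E {s} (Suc r) - nball ?E S r. {w, y} \<in> E)"
  proof
    assume "\<exists>y\<in>nball ?E {s} (Suc r). {y, w} \<in> ?E"
    then obtain y where y: "y \<in> nball ?E {s} (Suc r)" "{y, w} \<in> ?E" by blast
    moreover have "y \<notin> nball ?E S r" using w y(2) unfolding nball.simps(2) by blast
    ultimately show "\<exists>y\<in>nball ?E {s} (Suc r) - nball ?E S r. {w, y} \<in> E"
      unfolding delete_vertices_def by (auto simp: insert_commute simp del: nball.simps)
  next
    assume "\<exists>y\<in>nball ?E {s} (Suc r) - nball ?E S r. {w, y} \<in> E"
    then obtain y where y: "y \<in> nball ?E {s} (Suc r)" "{w, y} \<in> E" by blast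
    moreover have "y \<in> {1..n} - D" using nball_delete_subset[OF E, of "{s}" D "Suc r"] S y(1) by blast
    ultimately have "{y, w} \<in> ?E" using w unfolding delete_vertices_def by (auto simp: insert_commute)
    then show "\<exists>y\<in>nball ?E {s} (Suc r). {y, w} \<in> ?E" using y by blast
  qed
  finally show ?thesis .
qed

section \<open>Growth of balls under expansion\<close>

definition outer_nbhd :: "'a set set \<Rightarrow> 'a set \<Rightarrow> 'a set" where
  "outer_nbhd E X = {w. w \<notin> X \<and> (\<exists>x\<in>X. {x, w} \<in> E)}"

text \<open>Upper bounds on balls follow by summing degrees. Lower bounds have to be known for sets,
  because neighbourhoods overlap; the limit \<open>m\<close> keeps that overlap small.\<close>

definition expanding :: "nat \<Rightarrow> real \<Rightarrow> real \<Rightarrow> real \<Rightarrow> nat set set \<Rightarrow> bool" where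
  "expanding n \<epsilon> d m E \<longleftrightarrow>
    (\<forall>v\<in>{1..n}. real (card (outer_nbhd E {v})) \<le> (1 + \<epsilon>) * d) \<and>
    (\<forall>X\<subseteq>{1..n}. real (card X) \<le> m \<longrightarrow> (1 - \<epsilon>) * d * real (card X) \<le> real (card (outer_nbhd E X)))"

lemma finite_outer_nbhd: "E \<subseteq> vertex_pairs n \<Longrightarrow> outer_nbhd E X \<subseteq> {1..n}"
  using pair_in_vertex_pairs unfolding outer_nbhd_def by blast

lemma card_nball_le:
  fixes \<epsilon> d m :: real
  assumes E: "E \<subseteq> vertex_pairs n" and S: "S \<subseteq> {1..n} - D" and ex: "expanding n \<epsilon> d m E"
  shows "real (card (nball (delete_vertices E D) S j)) \<le> (1 + (1 + \<epsilon>) * d) ^ j * real (card S)"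
proof (induction j)
  case (Suc j)
  let ?B = "nball (delete_vertices E D) S j"
  have BV: "?B \<subseteq> {1..n} - D" by (rule nball_delete_subset[OF E S])
  then have fin: "finite ?B" by (rule finite_subset) simp
  have fino: "finite (outer_nbhd E X)" for X using finite_outer_nbhd[OF E] finite_subset by blast
  have deg: "card (outer_nbhd E {v}) \<le> (1 + \<epsilon>) * d" if "v \<in> {1..n}" for v
    using ex that unfolding expanding_def by blast
  have "nball (delete_vertices E D) S (Suc j) \<subseteq> (\<Union>u\<in>?B. {u} \<union> outer_nbhd E {u})"
    unfolding delete_vertices_def outer_nbhd_def by auto
  then have "card (nball (delete_vertices E D) S (Suc j)) \<le> card (\<Union>u\<in>?B. {u} \<union> outer_nbhd E {u})"
    by (rule card_mono[rotated]) (use fin fino in auto)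
  also have "\<dots> \<le> (\<Sum>u\<in>?B. card ({u} \<union> outer_nbhd E {u}))" by (rule card_UN_le[OF fin])
  finally have "real (card (nball (delete_vertices E D) S (Suc j))) \<le> (\<Sum>u\<in>?B. real (card ({u} \<union> outer_nbhd E {u})))"
    by (simp del: nball.simps flip: of_nat_sum)
  also have "\<dots> \<le> (\<Sum>u\<in>?B. 1 + (1 + \<epsilon>) * d)"
  proof (rule sum_mono)
    fix u assume "u \<in> ?B"
    then have "card (outer_nbhd E {u}) \<le> (1 + \<epsilon>) * d" using deg BV by blast
    moreover have "card ({u} \<union> outer_nbhd E {u}) \<le> 1 + card (outer_nbhd E {u})"
      using card_Un_le[of "{u}" "outer_nbhd E {u}"] by simp
    ultimately show "card ({u} \<union> outer_nbhd E {u}) \<le> 1 + (1 + \<epsilon>) * d" by linarith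
  qed
  also have "\<dots> = (1 + (1 + \<epsilon>) * d) * card ?B" by simp
  also have "\<dots> \<le> (1 + (1 + \<epsilon>) * d) * ((1 + (1 + \<epsilon>) * d) ^ j * card S)"
  proof (cases "card ?B = 0")
    case B0: True
    show ?thesis
    proof (cases "S = {}")
      case False
      then obtain s where "s \<in> S" by blast
      then have "0 \<le> (1 + \<epsilon>) * d" using deg[of s] S of_nat_0_le_iff order_trans by blast
      then show ?thesis using B0 by simp
    qed (use B0 in simp)
  next
    case False
    then obtain u where "u \<in> ?B" by fastforce
    then have "0 \<le> (1 + \<epsilon>) * d" using deg[of u] BV of_nat_0_le_iff order_trans by blast
    then show ?thesis using Suc.IH by (intro mult_left_mono) auto
  qed
  finally show ?case by (simp only: power_Suc mult.assoc)
qed simp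

text \<open>Each step loses at most one vertex to \<open>D\<close>. For a nonempty ball with
  \<open>b\<close> elements, \<open>(1 - \<epsilon>) * d * b - 1 \<ge> ((1 - \<epsilon>) * d - 1) *
  b\<close>, so the loss can be moved into the growth factor.\<close>

lemma card_nball_ge:
  fixes \<epsilon> d m :: real
  assumes E: "E \<subseteq> vertex_pairs n" and S: "S \<subseteq> {1..n} - D" and ex: "expanding n \<epsilon> d m E"
    and D: "card D \<le> 1" "finite D" and lo: "0 \<le> (1 - \<epsilon>) * d - 1"
    and small: "\<And>l. l < j \<Longrightarrow> card (nball (delete_vertices E D) S l) \<le> m"
  shows "((1 - \<epsilon>) * d - 1) ^ j * card S \<le> card (nball (delete_vertices E D) S j)"
  using small
proof (induction j)
  case (Suc j)
  let ?B = "nball (delete_vertices E D) S j"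
  have BV: "?B \<subseteq> {1..n} - D" by (rule nball_delete_subset[OF E S])
  have "((1 - \<epsilon>) * d - 1) * card ?B \<le> card (nball (delete_vertices E D) S (Suc j))"
  proof (cases "card ?B = 0")
    case False
    have "(1 - \<epsilon>) * d * card ?B \<le> card (outer_nbhd E ?B)"
      using ex BV Suc.prems[of j] unfolding expanding_def by blast
    moreover have "card (outer_nbhd E ?B) \<le> card (outer_nbhd E ?B - D) + 1"
      using D diff_card_le_card_Diff[of D "outer_nbhd E ?B"] by linarith
    moreover have "card (outer_nbhd E ?B - D) \<le> card (nball (delete_vertices E D) S (Suc j))"
    proof (rule card_mono)
      show "finite (nball (delete_vertices E D) S (Suc j))"
        by (rule finite_subset[OF nball_delete_subset[OF E S]]) simp
      show "outer_nbhd E ?B - D \<subseteq> nball (delete_vertices E D) S (Suc j)"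
        using BV unfolding outer_nbhd_def delete_vertices_def by auto
    qed
    moreover have "1 \<le> card ?B" using False by linarith
    ultimately show ?thesis by (simp add: algebra_simps del: nball.simps)
  qed (simp del: nball.simps)
  moreover have "((1 - \<epsilon>) * d - 1) * (((1 - \<epsilon>) * d - 1) ^ j * card S) \<le> ((1 - \<epsilon>) * d - 1) * card ?B"
    using lo Suc by (intro mult_left_mono) auto
  ultimately show ?case unfolding power_Suc mult.assoc by linarith
qed simp

section \<open>Expansion of the random graph\<close>

lemma exp_le_quadratic:
  fixes t :: real
  assumes "\<bar>t\<bar> \<le> 1"
  shows "exp t \<le> 1 + t + t\<^sup>2"
proof (cases "0 \<le> t")
  case False
  define \<tau> where "\<tau> = - t"
  have \<tau>: "0 < \<tau>" "\<tau> \<le> 1" using False assms unfolding \<tau>_def by auto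
  have "1 \<le> (1 - \<tau> + \<tau>\<^sup>2) * (1 + \<tau>)"
  proof -
    have "(1 - \<tau> + \<tau>\<^sup>2) * (1 + \<tau>) = 1 + \<tau> ^ 3" by (simp add: algebra_simps power2_eq_square power3_eq_cube)
    then show ?thesis using \<tau> by simp
  qed
  also have "\<dots> \<le> (1 - \<tau> + \<tau>\<^sup>2) * exp \<tau>"
  proof (rule mult_left_mono)
    show "0 \<le> 1 - \<tau> + \<tau>\<^sup>2" using \<tau> by (simp add: add_nonneg_nonneg)
  qed (rule exp_ge_add_one_self)
  finally have "exp (- \<tau>) \<le> 1 - \<tau> + \<tau>\<^sup>2" by (simp add: exp_minus field_simps)
  then show ?thesis unfolding \<tau>_def by simp
qed (use assms exp_bound in auto)

text \<open>Markov's inequality for the exponential moment. The factor \<open>t\<close> on both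
  sides of the event makes this the upper tail for \<open>t > 0\<close> and the lower tail for
  \<open>t < 0\<close>.\<close>

lemma prob_count_chernoff:
  fixes t a :: real and M :: "'b pmf" and \<phi> :: "'b \<Rightarrow> bool"
  assumes "finite W"
  defines "c \<equiv> measure_pmf.prob M {x. \<phi> x}"
  shows "measure_pmf.prob (Pi_pmf W d (\<lambda>_. M)) {g. t * a \<le> t * real (card {w\<in>W. \<phi> (g w)})}
    \<le> exp (real (card W) * c * (exp t - 1) - t * a)"
proof -
  let ?M = "Pi_pmf W d (\<lambda>_. M)"
  define h where "h = (\<lambda>x. 1 + (exp t - 1) * indicator {x. \<phi> x} x :: real)"
  have h: "h x = (if \<phi> x then exp t else 1)" for x unfolding h_def by simp
  have bnd: "\<bar>h x\<bar> \<le> exp t + 1" for x unfolding h by simp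
  have int: "integrable (measure_pmf M) h"
    by (rule measure_pmf.integrable_const_bound[where B = "exp t + 1"]) (use bnd in auto)
  have prod: "(\<Prod>w\<in>W. h (g w)) = exp (t * real (card {w\<in>W. \<phi> (g w)}))" for g
    unfolding h using assms(1) by (simp add: prod.If_cases Int_def exp_of_nat_mult[symmetric] mult.commute)
  have "integrable (measure_pmf M) (indicator {x. \<phi> x} :: 'b \<Rightarrow> real)"
    by (rule measure_pmf.integrable_const_bound[where B = 1]) auto
  then have "(\<integral>x. h x \<partial>M) = 1 + (exp t - 1) * c"
    unfolding h_def c_def by (subst Bochner_Integration.integral_add) auto
  then have E: "(\<integral>g. (\<Prod>w\<in>W. h (g w)) \<partial>?M) = (1 + (exp t - 1) * c) ^ card W"
    using expectation_prod_Pi_pmf[of W "\<lambda>_. M" "\<lambda>_. h" d] assms(1) int by (simp add: h)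
  have "measure_pmf.prob ?M {g. t * a \<le> t * real (card {w\<in>W. \<phi> (g w)})}
      = (\<integral>g. indicator {g. t * a \<le> t * real (card {w\<in>W. \<phi> (g w)})} g \<partial>?M)" by simp
  also have "\<dots> \<le> (\<integral>g. exp (- t * a) * (\<Prod>w\<in>W. h (g w)) \<partial>?M)"
  proof (rule integral_mono_AE)
    show "integrable ?M (\<lambda>g. exp (- t * a) * (\<Prod>w\<in>W. h (g w)))"
    proof (rule measure_pmf.integrable_const_bound[where B = "exp (- t * a) * (exp t + 1) ^ card W"], rule AE_I2)
      fix g
      have "\<bar>\<Prod>w\<in>W. h (g w)\<bar> \<le> (\<Prod>w\<in>W. exp t + 1)" unfolding abs_prod by (intro prod_mono) (use bnd in auto)
      then show "norm (exp (- t * a) * (\<Prod>w\<in>W. h (g w))) \<le> exp (- t * a) * (exp t + 1) ^ card W"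
        by (simp add: abs_mult)
    qed simp
    show "AE g in ?M. indicator {g. t * a \<le> t * real (card {w\<in>W. \<phi> (g w)})} g \<le> exp (- t * a) * (\<Prod>w\<in>W. h (g w))"
      unfolding prod by (auto simp: indicator_def mult_exp_exp)
  qed (auto intro: measure_pmf.integrable_const_bound[where B = 1])
  also have "\<dots> = exp (- t * a) * (1 + (exp t - 1) * c) ^ card W" using E by simp
  also have "\<dots> \<le> exp (- t * a) * exp ((exp t - 1) * c) ^ card W"
  proof (intro mult_left_mono power_mono)
    have "c \<le> 1" "0 \<le> c" unfolding c_def by auto
    then have "0 \<le> 1 - c + exp t * c" by (intro add_nonneg_nonneg) auto
    then show "0 \<le> 1 + (exp t - 1) * c" by (simp add: algebra_simps)
  qed (auto intro: exp_ge_add_one_self)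
  also have "\<dots> = exp (real (card W) * c * (exp t - 1) - t * a)"
    by (simp add: exp_of_nat_mult[symmetric] mult_exp_exp algebra_simps)
  finally show ?thesis .
qed

lemma prob_ex_le:
  assumes "finite I"
  shows "measure_pmf.prob M {x. \<exists>i\<in>I. R i x} \<le> (\<Sum>i\<in>I. measure_pmf.prob M {x. R i x})"
proof -
  have "{x. \<exists>i\<in>I. R i x} = (\<Union>i\<in>I. {x. R i x})" by auto
  then show ?thesis using measure_pmf.finite_measure_subadditive_finite[OF assms, of "\<lambda>i. {x. R i x}" M] by simp
qed

text \<open>For different \<open>w\<close> outside \<open>X\<close> the events of having a neighbour
  in \<open>X\<close> read disjoint sets of pairs, so they are independent, each with probability
  \<open>1 - (1 - q) ^ card X\<close>.\<close>

lemma prob_outer_nbhd_chernoff: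
  fixes t a q :: real
  assumes X: "X \<subseteq> {1..n}" and q: "0 \<le> q" "q \<le> 1"
  shows "measure_pmf.prob (edge_bits n q) {f. t * a \<le> t * real (card (outer_nbhd (edges_of n f) X))}
    \<le> exp (real (n - card X) * (1 - (1 - q) ^ card X) * (exp t - 1) - t * a)"
proof -
  let ?W = "{1..n} - X"
  have fX: "finite X" using X finite_subset by blast
  have map: "map_pmf (\<lambda>f w. if w \<in> ?W then {y\<in>X. f {w, y}} else {}) (edge_bits n q)
      = Pi_pmf ?W {} (\<lambda>_. random_subset X q)"
  proof (rule map_Pi_pmf_blocks[where c = "\<lambda>w y. {w, y}", OF finite_vertex_pairs])
    show "inj_on (\<lambda>(w, y). {w, y}) (Sigma ?W (\<lambda>_. X))"
    proof (rule inj_onI, clarify)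
      fix a b c d assume "a \<in> {1..n}" "a \<notin> X" "b \<in> X" "c \<in> {1..n}" "c \<notin> X" "d \<in> X" "{a, b} = {c, d}"
      moreover from this have "a \<noteq> d" "b \<noteq> c" by blast+
      ultimately show "a = c \<and> b = d" by (simp add: doubleton_eq_iff)
    qed
    show "{w, y} \<in> vertex_pairs n" if "w \<in> ?W" "y \<in> X" for w y
      unfolding pair_in_vertex_pairs using that X by blast
  qed (use fX in auto)
  have nb: "outer_nbhd (edges_of n f) X = {w\<in>?W. (if w \<in> ?W then {y\<in>X. f {w, y}} else {}) \<noteq> {}}" for f
  proof (rule set_eqI)
    fix w
    have "{x, w} \<in> edges_of n f \<longleftrightarrow> w \<in> {1..n} \<and> f {w, x}" if "x \<in> X" "w \<notin> X" for x
      unfolding edges_of_def mem_Collect_eq pair_in_vertex_pairs insert_commute[of x w]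
      using that X by blast
    then show "w \<in> outer_nbhd (edges_of n f) X \<longleftrightarrow> w \<in> {w\<in>?W. (if w \<in> ?W then {y\<in>X. f {w, y}} else {}) \<noteq> {}}"
      unfolding outer_nbhd_def by auto
  qed
  have "measure_pmf.prob (edge_bits n q) {f. t * a \<le> t * real (card (outer_nbhd (edges_of n f) X))}
      = measure_pmf.prob (Pi_pmf ?W {} (\<lambda>_. random_subset X q)) {g. t * a \<le> t * real (card {w\<in>?W. g w \<noteq> {}})}"
    unfolding nb map[symmetric] measure_map_pmf by (simp add: vimage_def)
  also have "\<dots> \<le> exp (real (card ?W) * measure_pmf.prob (random_subset X q) {A. A \<noteq> {}} * (exp t - 1) - t * a)"
    by (rule prob_count_chernoff) simp
  also have "measure_pmf.prob (random_subset X q) {A. A \<noteq> {}} = 1 - (1 - q) ^ card X"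
    by (rule prob_random_subset_hit[OF fX q])
  also have "card ?W = n - card X" using X fX by (simp add: card_Diff_subset)
  finally show ?thesis .
qed

lemma sum_Pow_power_card:
  fixes a :: real
  assumes "finite V"
  shows "(\<Sum>X\<in>Pow V. a ^ card X) = (1 + a) ^ card V"
  using prod_add[OF assms, of "\<lambda>_. a" "\<lambda>_. 1"] by (simp add: add.commute)

text \<open>A set \<open>X\<close> fails with probability at most \<open>\<eta> ^ card X\<close>,
  and these bounds sum over all nonempty \<open>X\<close> to
  \<open>(1 + \<eta>) ^ n - 1 \<le> 2 * n * \<eta>\<close>. Up to a constant the union bound over
  sets of all sizes thus costs no more than the one over single vertices.\<close>

lemma prob_not_expanding_le:
  fixes q \<epsilon> d \<eta> :: real and n :: nat
  assumes q: "0 \<le> q" "q \<le> 1" and \<epsilon>: "0 < \<epsilon>" "\<epsilon> \<le> 1" and n: "1 \<le> n"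
  defines "d \<equiv> q * real n"
  defines "\<eta> \<equiv> exp (- (\<epsilon>\<^sup>2 * d / 16))"
  assumes small: "real n * \<eta> \<le> 1"
  shows "measure_pmf.prob (edge_bits n q) {f. \<not> expanding n \<epsilon> d (\<epsilon> * n / (2 * (1 + d))) (edges_of n f)}
    \<le> 3 * real n * \<eta>"
proof -
  let ?P = "measure_pmf.prob (edge_bits n q)"
  define m where "m = \<epsilon> * n / (2 * (1 + d))"
  have d0: "0 \<le> d" unfolding d_def using q by simp
  have deg: "?P {f. \<not> real (card (outer_nbhd (edges_of n f) {v})) \<le> (1 + \<epsilon>) * d} \<le> \<eta>"
    if v: "v \<in> {1..n}" for v
  proof -
    let ?t = "\<epsilon> / 2"
    have "?P {f. \<not> real (card (outer_nbhd (edges_of n f) {v})) \<le> (1 + \<epsilon>) * d}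
        \<le> ?P {f. ?t * ((1 + \<epsilon>) * d) \<le> ?t * real (card (outer_nbhd (edges_of n f) {v}))}"
      using \<epsilon> by (intro measure_pmf.finite_measure_mono) (auto simp: mult_le_cancel_left)
    also have "\<dots> \<le> exp (real (n - card {v}) * (1 - (1 - q) ^ card {v}) * (exp ?t - 1) - ?t * ((1 + \<epsilon>) * d))"
      using v q by (intro prob_outer_nbhd_chernoff) auto
    also have "\<dots> \<le> \<eta>"
    proof -
      have "real (n - card {v}) * (1 - (1 - q) ^ card {v}) * (exp ?t - 1) \<le> d * (?t + ?t\<^sup>2)"
      proof (intro mult_mono)
        show "real (n - card {v}) * (1 - (1 - q) ^ card {v}) \<le> d"
          unfolding d_def using q by (simp add: mult.commute mult_left_mono)
        show "exp ?t - 1 \<le> ?t + ?t\<^sup>2" using exp_le_quadratic[of ?t] \<epsilon> by simp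
      qed (use d0 \<epsilon> in auto)
      then have "real (n - card {v}) * (1 - (1 - q) ^ card {v}) * (exp ?t - 1) - ?t * ((1 + \<epsilon>) * d) \<le> - (\<epsilon>\<^sup>2 * d / 4)"
        by (simp add: field_simps power2_eq_square)
      also have "\<dots> \<le> - (\<epsilon>\<^sup>2 * d / 16)" using d0 by (simp add: field_simps)
      finally show ?thesis unfolding \<eta>_def by simp
    qed
    finally show ?thesis .
  qed
  have grow: "?P {f. \<not> (1 - \<epsilon>) * d * real (card X) \<le> real (card (outer_nbhd (edges_of n f) X))} \<le> \<eta> ^ card X"
    if X: "X \<subseteq> {1..n}" "real (card X) \<le> m" for X
  proof -
    let ?t = "- (\<epsilon> / 4)"
    define x where "x = real (card X)"
    have cX: "card X \<le> n" using card_mono[OF _ X(1)] by simp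
    have x0: "0 \<le> x" unfolding x_def by simp
    \<comment> \<open>The limit on \<open>card X\<close> is chosen for this: \<open>x / n\<close> is
      the loss from vertices inside \<open>X\<close>, \<open>q * x\<close> the loss from vertices
      with several neighbours in \<open>X\<close>, and together they are at most
      \<open>\<epsilon> / 2\<close>.\<close>
    have xm: "x * (1 + d) \<le> \<epsilon> * n / 2" using X(2) d0 unfolding m_def x_def by (simp add: field_simps)
    have "x * (1 + d) / n \<le> \<epsilon> / 2" using xm n by (simp add: field_simps)
    then have xe: "x / n + q * x \<le> \<epsilon> / 2" using n unfolding d_def by (simp add: field_simps)
    have qx0: "0 \<le> q * x" "0 \<le> x / n" using x0 q by auto
    with xe have qx: "q * x \<le> 1" "0 \<le> q * x" "0 \<le> x / n" using \<epsilon> by linarith+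
    have "(1 - q) ^ card X \<le> exp (- q) ^ card X"
      using q exp_ge_add_one_self[of "- q"] by (intro power_mono) auto
    also have "\<dots> = exp (- (q * x))" unfolding x_def by (simp add: exp_of_nat_mult[symmetric] mult.commute)
    also have "\<dots> \<le> 1 - q * x + (q * x)\<^sup>2" using exp_le_quadratic[of "- (q * x)"] qx by simp
    finally have c: "q * x * (1 - q * x) \<le> 1 - (1 - q) ^ card X" by (simp add: algebra_simps power2_eq_square)
    have "(1 - \<epsilon> / 2) * (d * x) \<le> (1 - x / n - q * x) * (d * x)"
      using xe d0 x0 by (intro mult_right_mono) auto
    also have "\<dots> \<le> (1 - x / n) * (1 - q * x) * (d * x)"
    proof (rule mult_right_mono)
      have "0 \<le> x / n * (q * x)" using qx(3,2) by (rule mult_nonneg_nonneg)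
      then show "1 - x / n - q * x \<le> (1 - x / n) * (1 - q * x)" by (simp add: algebra_simps)
    qed (use d0 x0 in simp)
    also have "\<dots> = (n - x) * (q * x * (1 - q * x))"
      unfolding d_def using n by (simp add: field_simps)
    also have "\<dots> \<le> (n - x) * (1 - (1 - q) ^ card X)"
      using c cX unfolding x_def by (intro mult_left_mono) auto
    also have "n - x = real (n - card X)" unfolding x_def using cX by simp
    finally have mu: "(1 - \<epsilon> / 2) * (d * x) \<le> real (n - card X) * (1 - (1 - q) ^ card X)" .
    have "?P {f. \<not> (1 - \<epsilon>) * d * real (card X) \<le> real (card (outer_nbhd (edges_of n f) X))}
        \<le> ?P {f. ?t * ((1 - \<epsilon>) * d * x) \<le> ?t * real (card (outer_nbhd (edges_of n f) X))}"
      using \<epsilon> unfolding x_def by (intro measure_pmf.finite_measure_mono) (auto simp: mult_le_cancel_left)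
    also have "\<dots> \<le> exp (real (n - card X) * (1 - (1 - q) ^ card X) * (exp ?t - 1) - ?t * ((1 - \<epsilon>) * d * x))"
      using X q by (intro prob_outer_nbhd_chernoff) auto
    \<comment> \<open>The mean is at least \<open>(1 - \<epsilon> / 2) * (d * x)\<close>, so a
      relative deficit of \<open>\<epsilon> / 2\<close> is left; the parameter
      \<open>- (\<epsilon> / 4)\<close> turns it into the exponent
      \<open>\<epsilon>\<^sup>2 / 16\<close>.\<close>
    also have "\<dots> \<le> exp (- (\<epsilon>\<^sup>2 * d / 16) * x)"
    proof -
      have neg: "exp ?t - 1 \<le> ?t + ?t\<^sup>2" "exp ?t - 1 \<le> 0" using exp_le_quadratic[of ?t] \<epsilon> by auto
      have "real (n - card X) * (1 - (1 - q) ^ card X) * (exp ?t - 1) \<le> (1 - \<epsilon> / 2) * (d * x) * (exp ?t - 1)"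
        using mu neg(2) by (rule mult_right_mono_neg)
      also have "\<dots> \<le> (1 - \<epsilon> / 2) * (d * x) * (?t + ?t\<^sup>2)"
        using neg(1) \<epsilon> d0 x0 by (intro mult_left_mono) auto
      also have "\<dots> = (d * x) * ((1 - \<epsilon> / 2) * (?t + ?t\<^sup>2))" by simp
      also have "\<dots> \<le> (d * x) * (?t * (1 - \<epsilon>) - \<epsilon>\<^sup>2 / 16)"
      proof (rule mult_left_mono)
        have "0 \<le> \<epsilon> * \<epsilon>\<^sup>2" using \<epsilon> by simp
        then show "(1 - \<epsilon> / 2) * (?t + ?t\<^sup>2) \<le> ?t * (1 - \<epsilon>) - \<epsilon>\<^sup>2 / 16"
          by (simp add: field_simps power2_eq_square)
      qed (use d0 x0 in auto)
      also have "\<dots> = ?t * ((1 - \<epsilon>) * d * x) - \<epsilon>\<^sup>2 * d / 16 * x" by (simp add: field_simps)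
      finally show ?thesis unfolding exp_le_cancel_iff by linarith
    qed
    also have "\<dots> = \<eta> ^ card X"
      unfolding \<eta>_def x_def by (simp add: exp_of_nat_mult[symmetric] mult.commute)
    finally show ?thesis .
  qed
  define \<X> where "\<X> = {X\<in>Pow {1..n}. real (card X) \<le> m}"
  have "{f. \<not> expanding n \<epsilon> d m (edges_of n f)} \<subseteq>
      {f. \<exists>v\<in>{1..n}. \<not> real (card (outer_nbhd (edges_of n f) {v})) \<le> (1 + \<epsilon>) * d}
    \<union> {f. \<exists>X\<in>\<X> - {{}}. \<not> (1 - \<epsilon>) * d * real (card X) \<le> real (card (outer_nbhd (edges_of n f) X))}"
    unfolding expanding_def \<X>_def by auto
  then have "?P {f. \<not> expanding n \<epsilon> d m (edges_of n f)} \<le>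
      ?P {f. \<exists>v\<in>{1..n}. \<not> real (card (outer_nbhd (edges_of n f) {v})) \<le> (1 + \<epsilon>) * d}
    + ?P {f. \<exists>X\<in>\<X> - {{}}. \<not> (1 - \<epsilon>) * d * real (card X) \<le> real (card (outer_nbhd (edges_of n f) X))}"
    by (rule order_trans[OF measure_pmf.finite_measure_mono measure_Un_le]) auto
  also have "\<dots> \<le> (\<Sum>v\<in>{1..n}. \<eta>) + (\<Sum>X\<in>\<X> - {{}}. \<eta> ^ card X)"
  proof (intro add_mono order_trans[OF prob_ex_le] sum_mono deg grow)
    show "finite (\<X> - {{}})" unfolding \<X>_def by simp
  qed (auto simp: \<X>_def)
  finally have total: "?P {f. \<not> expanding n \<epsilon> d m (edges_of n f)} \<le> n * \<eta> + (\<Sum>X\<in>\<X> - {{}}. \<eta> ^ card X)"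
    by simp
  have "(\<Sum>X\<in>\<X> - {{}}. \<eta> ^ card X) \<le> (\<Sum>X\<in>Pow {1..n} - {{}}. \<eta> ^ card X)"
    by (rule sum_mono2) (auto simp: \<X>_def \<eta>_def)
  also have "\<dots> = (1 + \<eta>) ^ n - 1"
    using sum_Pow_power_card[of "{1..n}" \<eta>] by (simp add: sum_diff1)
  also have "\<dots> \<le> exp \<eta> ^ n - 1"
    using exp_ge_add_one_self[of \<eta>] unfolding \<eta>_def by (intro diff_right_mono power_mono) auto
  also have "\<dots> = exp (n * \<eta>) - 1" by (simp add: exp_of_nat_mult)
  also have "\<dots> \<le> n * \<eta> + (n * \<eta>)\<^sup>2"
    using exp_le_quadratic[of "n * \<eta>"] small unfolding \<eta>_def by simp
  also have "\<dots> \<le> n * \<eta> + n * \<eta>"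
    using small unfolding power2_eq_square \<eta>_def by (intro add_left_mono mult_left_le) auto
  finally show ?thesis using total unfolding m_def by linarith
qed

section \<open>Separation, diameter and collisions\<close>

lemma mem_nball_sym: "w \<in> nball E {s} j \<longleftrightarrow> s \<in> nball E {w} j"
proof -
  have "(w, s) \<in> adj E ^^ l \<Longrightarrow> (s, w) \<in> adj E ^^ l" for w s l
  proof (induction l arbitrary: w s)
    case (Suc l)
    then obtain u where "(w, u) \<in> adj E" "(u, s) \<in> adj E ^^ l" by (meson relpow_Suc_D2)
    then have "(s, u) \<in> adj E ^^ l" "(u, w) \<in> adj E" using Suc.IH by (auto simp: adj_def insert_commute)
    then show ?case by auto
  qed simp
  then show ?thesis unfolding mem_nball_iff by blast
qed

lemma sum_Pow_prod_if:
  fixes u t :: "'a \<Rightarrow> real"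
  assumes "finite S"
  shows "(\<Sum>x\<in>Pow S. \<Prod>s\<in>S. if s \<in> x then u s else t s) = (\<Prod>s\<in>S. u s + t s)"
  unfolding prod_add[OF assms]
proof (rule sum.cong[OF refl])
  fix x assume "x \<in> Pow S"
  then have "S \<inter> {s. s \<in> x} = x" "S \<inter> - {s. s \<in> x} = S - x" by auto
  then show "(\<Prod>s\<in>S. if s \<in> x then u s else t s) = prod u x * prod t (S - x)"
    using assms by (simp add: prod.If_cases)
qed

text \<open>Double counting of pairs of a centre and a vertex of its set: a vertex of the union
  occurs at least once, a vertex of \<open>Ov\<close> at least twice.\<close>

lemma card_overlap_le:
  assumes S: "finite S" and T: "\<And>s. s \<in> S \<Longrightarrow> finite (T s)"
    and O: "Ov \<subseteq> {y. \<exists>s\<in>S. \<exists>s'\<in>S. s \<noteq> s' \<and> y \<in> T s \<and> y \<in> T s'}"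
  shows "card (\<Union>(T ` S)) + card Ov \<le> (\<Sum>s\<in>S. card (T s))"
proof -
  let ?B = "\<Union>(T ` S)"
  have fB: "finite ?B" using S T by simp
  have OB: "Ov \<subseteq> ?B" using O by blast
  have "card ?B + card Ov = (\<Sum>y\<in>?B. 1) + (\<Sum>y\<in>?B. if y \<in> Ov then 1 else 0)"
    using fB OB by (simp add: sum.If_cases Int_absorb1)
  also have "\<dots> = (\<Sum>y\<in>?B. 1 + (if y \<in> Ov then 1 else 0))" by (rule sum.distrib[symmetric])
  also have "\<dots> \<le> (\<Sum>y\<in>?B. card {s\<in>S. y \<in> T s})"
  proof (rule sum_mono)
    fix y assume y: "y \<in> ?B"
    show "1 + (if y \<in> Ov then 1 else 0) \<le> card {s\<in>S. y \<in> T s}"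
    proof (cases "y \<in> Ov")
      case True
      then obtain s s' where "s \<in> S" "s' \<in> S" "s \<noteq> s'" "y \<in> T s" "y \<in> T s'" using O by blast
      then have "card {s, s'} \<le> card {s\<in>S. y \<in> T s}" using S by (intro card_mono) auto
      then show ?thesis using True \<open>s \<noteq> s'\<close> by simp
    next
      case False
      obtain s where "s \<in> S" "y \<in> T s" using y by blast
      then have "card {s} \<le> card {s\<in>S. y \<in> T s}" using S by (intro card_mono) auto
      then show ?thesis using False by simp
    qed
  qed
  also have "\<dots> = (\<Sum>y\<in>?B. \<Sum>s\<in>S. if y \<in> T s then 1 else 0)"
    using S by (simp add: sum.If_cases Int_def)
  also have "\<dots> = (\<Sum>s\<in>S. \<Sum>y\<in>?B. if y \<in> T s then 1 else 0)" by (rule sum.swap)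
  also have "\<dots> = (\<Sum>s\<in>S. card (T s))"
  proof (rule sum.cong[OF refl])
    fix s assume "s \<in> S"
    then have "{y\<in>?B. y \<in> T s} = T s" by blast
    then show "(\<Sum>y\<in>?B. if y \<in> T s then 1 else 0) = card (T s)"
      using fB by (simp add: sum.If_cases Int_def)
  qed
  finally show ?thesis .
qed

lemma power_one_minus_ge:
  fixes q :: real
  assumes "0 \<le> q" "q \<le> 1 / 2"
  shows "exp (- (q + 2 * q\<^sup>2) * real k) \<le> (1 - q) ^ k"
proof -
  have "exp (- (q + 2 * q\<^sup>2)) \<le> exp (ln (1 - q))"
    using ln_one_minus_pos_lower_bound[OF assms] by simp
  also have "\<dots> = 1 - q" using assms by simp
  finally have "exp (- (q + 2 * q\<^sup>2)) ^ k \<le> (1 - q) ^ k" by (intro power_mono) auto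
  then show ?thesis by (simp add: exp_of_nat_mult[symmetric] mult.commute)
qed

text \<open>The Poissonised birthday bound: the factor before the product nearly cancels \<^term>\<open>exp (\<Sum>x\<in>X. y x)\<close>.\<close>

lemma distinct_labels_bound:
  fixes q Y :: real
  assumes X: "finite X" and \<rho>: "\<And>x. x \<in> X \<Longrightarrow> 0 \<le> \<rho> x" and q0: "q0 = 1 - (\<Sum>x\<in>X. \<rho> x)"
    and q: "(\<Sum>x\<in>X. \<rho> x) \<le> q" "q \<le> 1 / 2" and Y: "1 \<le> Y" "Y\<^sup>2 \<le> N\<^sup>2 * (\<Sum>x\<in>X. (\<rho> x)\<^sup>2)" and N: "N = real k"
  shows "q0 ^ k * (\<Prod>x\<in>X. 1 + N * \<rho> x / q0) \<le> exp (2 * N * q\<^sup>2 - Y / 8)"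
proof -
  define \<sigma> where "\<sigma> = (\<Sum>x\<in>X. \<rho> x)"
  have \<sigma>: "0 \<le> \<sigma>" "\<sigma> \<le> q" "q0 = 1 - \<sigma>" "1 / 2 \<le> q0" "q0 \<le> 1"
    using assms sum_nonneg[of X \<rho>] unfolding \<sigma>_def by auto
  have N0: "0 \<le> N" using N by simp
  define y where "y = (\<lambda>x. N * \<rho> x / q0)"
  have y0: "0 \<le> y x" if "x \<in> X" for x using \<rho>[OF that] \<sigma> N0 unfolding y_def by simp
  \<comment> \<open>\<open>Z\<close> is the Euclidean norm of \<open>y\<close>. Each
    \<open>y x\<close> is at most \<open>Z\<close>, so all denominators \<open>4 * (1 + y x)\<close>
    may be replaced by \<open>4 * (1 + Z)\<close>, and \<open>Z \<ge> 1\<close> then leaves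
    \<open>Z / 8\<close>.\<close>
  define Z where "Z = sqrt (\<Sum>x\<in>X. (y x)\<^sup>2)"
  have Z2: "Z\<^sup>2 = (\<Sum>x\<in>X. (y x)\<^sup>2)" "0 \<le> Z" unfolding Z_def by (simp_all add: sum_nonneg)
  have yZ: "y x \<le> Z" if "x \<in> X" for x
    unfolding Z_def using that X by (intro real_le_rsqrt member_le_sum) auto
  have YZ: "Y \<le> Z"
  proof (rule power2_le_imp_le[OF _ Z2(2)])
    have "N\<^sup>2 * (\<Sum>x\<in>X. (\<rho> x)\<^sup>2) = (\<Sum>x\<in>X. (N * \<rho> x)\<^sup>2)" by (simp add: sum_distrib_left power_mult_distrib)
    also have "\<dots> \<le> (\<Sum>x\<in>X. (y x)\<^sup>2)"
    proof (intro sum_mono power_mono)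
      fix x assume "x \<in> X"
      then have "0 \<le> N * \<rho> x" using \<rho> N0 by simp
      then show "N * \<rho> x \<le> y x" "0 \<le> N * \<rho> x" unfolding y_def using \<sigma> by (auto simp: le_divide_eq mult_left_le)
    qed
    finally show "Y\<^sup>2 \<le> Z\<^sup>2" using Y(2) Z2(1) by simp
  qed
  have sq: "Z / 8 \<le> (\<Sum>x\<in>X. (y x)\<^sup>2 / (4 * (1 + y x)))"
  proof -
    have "Z / 8 \<le> Z\<^sup>2 / (4 * (1 + Z))"
      using YZ Y(1) by (simp add: field_simps power2_eq_square)
    also have "\<dots> = (\<Sum>x\<in>X. (y x)\<^sup>2 / (4 * (1 + Z)))" unfolding Z2(1) by (simp add: sum_divide_distrib)
    also have "\<dots> \<le> (\<Sum>x\<in>X. (y x)\<^sup>2 / (4 * (1 + y x)))"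
      using yZ y0 by (intro sum_mono divide_left_mono mult_left_mono) (auto intro!: mult_pos_pos add_pos_nonneg Z2)
    finally show ?thesis .
  qed
  have "q0 ^ k \<le> exp (- \<sigma>) ^ k" using \<sigma> exp_ge_add_one_self[of "- \<sigma>"] by (intro power_mono) auto
  also have "\<dots> = exp (- (N * \<sigma>))" by (simp add: exp_of_nat_mult[symmetric] N)
  finally have power: "q0 ^ k \<le> exp (- (N * \<sigma>))" .
  have prod: "(\<Prod>x\<in>X. 1 + y x) = exp (\<Sum>x\<in>X. ln (1 + y x))"
    unfolding exp_sum[OF X] using y0 by (intro prod.cong) (auto simp: add_pos_nonneg)
  have "q0 ^ k * (\<Prod>x\<in>X. 1 + y x) \<le> exp (- (N * \<sigma>)) * exp (\<Sum>x\<in>X. ln (1 + y x))"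
    unfolding prod using power by (intro mult_right_mono) auto
  also have "\<dots> \<le> exp (- (N * \<sigma>)) * exp ((\<Sum>x\<in>X. y x) - Z / 8)"
  proof (intro mult_left_mono)
    have "(\<Sum>x\<in>X. ln (1 + y x)) \<le> (\<Sum>x\<in>X. y x - (y x)\<^sup>2 / (4 * (1 + y x)))"
      using y0 by (intro sum_mono ln_add_one_le_quadratic)
    then show "exp (\<Sum>x\<in>X. ln (1 + y x)) \<le> exp ((\<Sum>x\<in>X. y x) - Z / 8)"
      using sq by (simp add: sum_subtractf)
  qed simp
  also have "\<dots> = exp ((\<Sum>x\<in>X. y x) - N * \<sigma> - Z / 8)" by (simp add: mult_exp_exp)
  \<comment> \<open>The exponentials do not cancel exactly because of the division by
    \<open>q0\<close>. The remainder is of order \<open>N * q\<^sup>2\<close>, which stays bounded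
    in the application since there \<open>d\<^sup>2 = O(n)\<close>.\<close>
  also have "(\<Sum>x\<in>X. y x) - N * \<sigma> = N * \<sigma>\<^sup>2 / q0"
  proof -
    have "(\<Sum>x\<in>X. y x) = N * \<sigma> / q0" unfolding y_def \<sigma>_def by (simp add: sum_distrib_left sum_divide_distrib)
    moreover have "N * \<sigma> / q0 - N * \<sigma> = N * \<sigma> * (1 - q0) / q0"
      using \<sigma>(4) by (simp add: field_simps)
    moreover have "1 - q0 = \<sigma>" using \<sigma> by simp
    ultimately show ?thesis by (simp add: power2_eq_square)
  qed
  also have "exp (N * \<sigma>\<^sup>2 / q0 - Z / 8) \<le> exp (2 * N * q\<^sup>2 - Y / 8)"
  proof -
    have "N * \<sigma>\<^sup>2 / q0 \<le> N * q\<^sup>2 / (1 / 2)"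
      using \<sigma> N0 by (intro frac_le mult_left_mono power_mono) auto
    then show ?thesis using YZ by simp
  qed
  finally show ?thesis unfolding y_def .
qed

lemma prob_le_of_subset:
  "measure_pmf.prob M B \<le> \<beta> \<Longrightarrow> A \<subseteq> B \<Longrightarrow> measure_pmf.prob M A \<le> \<beta>"
  by (rule order_trans[OF measure_pmf.finite_measure_mono]) auto

text \<open>The edges of \<open>G - D\<close> that meet \<open>core\<close>, the ball of radius \<open>r\<close> around \<open>S\<close>, are exposed. They determine
  \<open>cells\<close>, the balls of radius \<open>r + 1\<close> around the single centres, and leave the edges between
  \<open>fresh_vertices\<close> and \<open>exposed\<close> independent.\<close>

lemma Union_cells:
  "\<Union>(cells n S D r f ` S) = nball (delete_vertices (edges_of n f) D) S (Suc r)"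
  unfolding cells_def by (subst nball_UN) (simp del: nball.simps)

lemma fresh_nbhds_eq:
  assumes S: "S \<subseteq> {1..n} - D" and D: "D \<subseteq> {1..n}" and w: "w \<in> fresh_vertices n D (\<Union>(cells n S D r f ` S))"
  shows "fresh_nbhds n S D r f w
    = {y \<in> exposed D (core n S D r f) (\<Union>(cells n S D r f ` S)). {w, y} \<in> edges_of n f}"
proof -
  let ?B = "\<Union>(cells n S D r f ` S)"
  have "?B \<subseteq> {1..n} - D" unfolding Union_cells by (rule nball_delete_subset[OF edges_of_subset S])
  then have "{w, y} \<in> vertex_pairs n" if "y \<in> exposed D (core n S D r f) ?B" for y
    using that w D unfolding pair_in_vertex_pairs exposed_def fresh_vertices_def by blast
  then show ?thesis using w unfolding fresh_nbhds_def edges_of_def by auto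
qed

lemma fresh_nbhds_ball_iff:
  assumes S: "S \<subseteq> {1..n} - D" and D: "D \<subseteq> {1..n}" and w: "w \<in> fresh_vertices n D (\<Union>(cells n S D r f ` S))"
    and s: "s \<in> S"
  shows "w \<in> nball (delete_vertices (edges_of n f) D) {s} (Suc (Suc r)) \<longleftrightarrow>
    fresh_nbhds n S D r f w \<inter> (cells n S D r f s - core n S D r f) \<noteq> {}"
proof -
  have "w \<in> {1..n} - D - nball (delete_vertices (edges_of n f) D) S (Suc r)"
    using w unfolding fresh_vertices_def Union_cells .
  from fresh_nbhd_meets_iff[OF edges_of_subset S s this]
  have "w \<in> nball (delete_vertices (edges_of n f) D) {s} (Suc (Suc r)) \<longleftrightarrow>
      (\<exists>y\<in>cells n S D r f s - core n S D r f. {w, y} \<in> edges_of n f)"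
    using s unfolding cells_def core_def by (simp del: nball.simps)
  moreover have "cells n S D r f s - core n S D r f \<subseteq> exposed D (core n S D r f) (\<Union>(cells n S D r f ` S))"
    using s unfolding exposed_def by blast
  ultimately show ?thesis unfolding fresh_nbhds_eq[OF S D w] by blast
qed

lemma fresh_notin_ball:
  assumes "w \<in> fresh_vertices n D (\<Union>(cells n S D r f ` S))" "s \<in> S"
  shows "w \<notin> nball (delete_vertices (edges_of n f) D) {s} (Suc r)"
  using assms nball_mono[of "{s}" S "delete_vertices (edges_of n f) D" "Suc r"]
  unfolding fresh_vertices_def Union_cells by blast

text \<open>\<open>K\<close> bounds the number of centres, \<open>m\<close> the size of the sets that are known to expand, and \<open>\<tau>\<close> the
  proportion of vertices that get exposed.\<close>

locale exploration =
  fixes n r K :: nat and q \<epsilon> m \<tau> :: real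
  assumes q: "0 \<le> q" "q \<le> 1 / 2"
    and base: "0 \<le> (1 - \<epsilon>) * (q * n) - 1" "0 \<le> (1 + \<epsilon>) * (q * n)"
    and small: "real K * (1 + (1 + \<epsilon>) * (q * n)) ^ r \<le> m"
    and room: "1 + real K * (1 + (1 + \<epsilon>) * (q * n)) ^ Suc r \<le> \<tau> * n" 
    and \<tau>: "0 < \<tau>" "\<tau> \<le> 1 / 2" and K: "2 \<le> K" and n: "1 \<le> n"
begin

definition "d = q * real n"
text \<open>Per centre, \<open>H1\<close> bounds the core and \<open>H2\<close> the cell from above,
  while \<open>L\<close> bounds the union of the cells from below. In the application
  \<open>H2\<close> and \<open>L\<close> are asymptotically equal, so the cells are nearly
  disjoint.\<close>

definition "H1 = (1 + (1 + \<epsilon>) * d) ^ r"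
definition "H2 = (1 + (1 + \<epsilon>) * d) ^ Suc r"
definition "L = ((1 - \<epsilon>) * d - 1) ^ Suc r"

lemma H_ge_1: "1 \<le> H1" "1 \<le> H2"
  unfolding H1_def H2_def d_def using base(2) by (intro one_le_power; simp)+

lemma q1: "q \<le> 1" using q by simp

text \<open>Only \<open>P\<close> and \<open>T\<close> occur, so the exposed edges decide this
  property. The lower bound concerns the union: together with the upper bound on single cells it
  limits the total overlap to \<open>(H2 - L) * card S\<close>.\<close>

definition sized :: "nat set \<Rightarrow> nat set \<Rightarrow> (nat \<Rightarrow> nat set) \<Rightarrow> bool" where
  "sized S P T \<longleftrightarrow> real (card P) \<le> H1 * card S \<and> (\<forall>s\<in>S. real (card (T s)) \<le> H2)
     \<and> L * card S \<le> card (\<Union>(T ` S))"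

lemma sized_of_expanding:
  assumes S: "S \<subseteq> {1..n} - D" "card S \<le> K" and D: "finite D" "card D \<le> 1"
    and ex: "expanding n \<epsilon> d m (edges_of n f)"
  shows "sized S (core n S D r f) (cells n S D r f)"
  unfolding sized_def
proof (intro conjI ballI)
  note le = card_nball_le[OF edges_of_subset _ ex]
  show "real (card (core n S D r f)) \<le> H1 * card S"
    unfolding core_def H1_def by (rule le[OF S(1)])
  show "real (card (cells n S D r f s)) \<le> H2" if "s \<in> S" for s
  proof -
    have "{s} \<subseteq> {1..n} - D" using that S(1) by blast
    from le[OF this, of "Suc r"] show ?thesis
      using that unfolding cells_def H2_def by (simp del: nball.simps)
  qed
  show "L * card S \<le> card (\<Union>(cells n S D r f ` S))"
    unfolding Union_cells L_def
  proof (rule card_nball_ge[OF edges_of_subset S(1) ex D(2,1)])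
    show "0 \<le> (1 - \<epsilon>) * d - 1" using base(1) unfolding d_def .
    fix l assume "l < Suc r"
    have "real (card (nball (delete_vertices (edges_of n f) D) S l)) \<le> (1 + (1 + \<epsilon>) * d) ^ l * card S"
      by (rule le[OF S(1)])
    also have "\<dots> \<le> (1 + (1 + \<epsilon>) * d) ^ r * K"
      using base(2) S(2) \<open>l < Suc r\<close> unfolding d_def by (intro mult_mono power_increasing) auto
    also have "\<dots> \<le> m" using small unfolding d_def by (simp add: mult.commute)
    finally show "real (card (nball (delete_vertices (edges_of n f) D) S l)) \<le> m" .
  qed
qed

lemma card_fresh_ge:
  assumes "sized S P T" "card S \<le> K" "finite S" "card D \<le> 1" "\<Union>(T ` S) \<subseteq> {1..n} - D" "D \<subseteq> {1..n}"
  shows "(1 - \<tau>) * n \<le> card (fresh_vertices n D (\<Union>(T ` S)))"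
proof -
  have fin: "finite (\<Union>(T ` S))" "finite D"
    using finite_subset[OF assms(5)] finite_subset[OF assms(6)] by simp_all
  have "real (card (\<Union>(T ` S))) \<le> (\<Sum>s\<in>S. real (card (T s)))"
    using card_UN_le[OF assms(3), of T] by (simp flip: of_nat_sum)
  also have "\<dots> \<le> (\<Sum>s\<in>S. H2)" using assms(1) unfolding sized_def by (intro sum_mono) auto
  also have "\<dots> \<le> K * H2" using assms(2) H_ge_1 by (simp add: mult_right_mono)
  finally have B: "real (card (\<Union>(T ` S))) \<le> K * H2" .
  have "n = card {1..n}" by simp
  also have "\<dots> \<le> card (fresh_vertices n D (\<Union>(T ` S)) \<union> (D \<union> \<Union>(T ` S)))"
    using fin by (intro card_mono) (auto simp: fresh_vertices_def)
  also have "\<dots> \<le> card (fresh_vertices n D (\<Union>(T ` S))) + (card D + card (\<Union>(T ` S)))"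
    using card_Un_le[of "fresh_vertices n D (\<Union>(T ` S))" "D \<union> \<Union>(T ` S)"] card_Un_le[of D "\<Union>(T ` S)"] by linarith
  finally have "real n \<le> card (fresh_vertices n D (\<Union>(T ` S))) + (1 + card (\<Union>(T ` S)))"
    using assms(4) by linarith
  then show ?thesis using B room unfolding H2_def d_def by (simp add: algebra_simps)
qed

lemma prob_expanding_le:
  assumes S: "S \<subseteq> {1..n} - D" "card S \<le> K" and D: "D \<subseteq> {1..n}" "card D \<le> 1" and "0 \<le> \<beta>"
    and fresh: "\<And>P T. sized S P T \<Longrightarrow> P \<subseteq> \<Union>(T ` S) \<Longrightarrow> \<Union>(T ` S) \<subseteq> {1..n} - D \<Longrightarrow>
      measure_pmf.prob (Pi_pmf (fresh_vertices n D (\<Union>(T ` S))) {} (\<lambda>_. random_subset (exposed D P (\<Union>(T ` S))) q))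
        {\<nu>. Bad P T \<nu>} \<le> \<beta>"
    and bad: "\<And>f. R f \<Longrightarrow> Bad (core n S D r f) (cells n S D r f) (fresh_nbhds n S D r f)"
  shows "measure_pmf.prob (edge_bits n q) {f. expanding n \<epsilon> d m (edges_of n f) \<and> R f} \<le> \<beta>"
proof (rule prob_le_of_subset)
  show "measure_pmf.prob (edge_bits n q) {f. sized S (core n S D r f) (cells n S D r f) \<and>
      Bad (core n S D r f) (cells n S D r f) (fresh_nbhds n S D r f)} \<le> \<beta>"
    by (rule prob_explored_le[OF S(1) D(1) \<open>0 \<le> \<beta>\<close>]) (rule fresh)
  show "{f. expanding n \<epsilon> d m (edges_of n f) \<and> R f} \<subseteq> {f. sized S (core n S D r f) (cells n S D r f) \<and>
      Bad (core n S D r f) (cells n S D r f) (fresh_nbhds n S D r f)}"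
    using sized_of_expanding[OF S finite_subset[OF D(1)] D(2)] bad by auto
qed

text \<open>With \<open>u\<close> deleted and the balls around \<open>s\<close> exposed, a fresh
  vertex adjacent both to \<open>u\<close> and to the cell outside the core lies on a path of length
  at most \<open>r + 3\<close>. Each fresh vertex does so independently with probability at least
  \<open>q * (1 - b)\<close>.\<close>

lemma prob_far_le:
  assumes us: "u \<in> {1..n}" "s \<in> {1..n}" "u \<noteq> s"
    and b: "\<And>k. L - H1 \<le> real k \<Longrightarrow> (1 - q) ^ k \<le> b" "b \<le> 1"
  shows "measure_pmf.prob (edge_bits n q)
      {f. expanding n \<epsilon> d m (edges_of n f) \<and> u \<notin> nball (edges_of n f) {s} (Suc (Suc (Suc r)))}
    \<le> exp (- (q * (1 - b) * ((1 - \<tau>) * n)))" (is "_ \<le> ?\<beta>")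
proof -
  let ?S = "{s}" and ?D = "{u}"
  have S: "?S \<subseteq> {1..n} - ?D" and D: "?D \<subseteq> {1..n}" using us by auto
  define Bad where "Bad = (\<lambda>(P :: nat set) (T :: nat \<Rightarrow> nat set) (\<nu> :: nat \<Rightarrow> nat set).
    \<forall>w\<in>fresh_vertices n ?D (\<Union>(T ` ?S)). \<not> (u \<in> \<nu> w \<and> \<nu> w \<inter> (T s - P) \<noteq> {}))"
  show ?thesis
  proof (rule prob_expanding_le[where Bad = Bad, OF S _ D])
    fix P T assume sz: "sized ?S P T" and sub: "P \<subseteq> \<Union>(T ` ?S)" "\<Union>(T ` ?S) \<subseteq> {1..n} - ?D"
    let ?W = "fresh_vertices n ?D (\<Union>(T ` ?S))" and ?Y = "exposed ?D P (\<Union>(T ` ?S))"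
    let ?R = "random_subset ?Y q"
    have "finite (\<Union>(T ` ?S))" using finite_subset[OF sub(2)] by simp
    then have fin: "finite (T s)" "finite P" using finite_subset[OF sub(1)] by simp_all
    have finY: "finite ?Y" unfolding exposed_def using fin by simp
    have finW: "finite ?W" unfolding fresh_vertices_def by simp
    define c where "c = measure_pmf.prob ?R {A. u \<in> A \<and> A \<inter> (T s - P) \<noteq> {}}"
    \<comment> \<open>The two values of \<open>j\<close> stand for the disjoint sets
      \<open>{u}\<close> and \<open>T s - P\<close>, both of which have to be hit.\<close>
    have "c = measure_pmf.prob ?R {A. \<forall>j\<in>UNIV. A \<inter> (if j then {u} else T s - P) \<in> {A. A \<noteq> {}}}"
      unfolding c_def by (intro arg_cong[where f = "measure _"]) (auto simp: UNIV_bool)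
    also have "\<dots> = (\<Prod>j\<in>UNIV. measure_pmf.prob (random_subset (if j then {u} else T s - P) q) {A. A \<noteq> {}})"
      by (rule prob_random_subset_disjoint_family[OF finY])
        (use sub in \<open>auto simp: exposed_def disjoint_family_on_def split: if_splits\<close>)
    also have "\<dots> = q * (1 - (1 - q) ^ card (T s - P))"
      using fin q q1 by (simp add: UNIV_bool prob_random_subset_hit)
    finally have c: "c = q * (1 - (1 - q) ^ card (T s - P))" .
    have "card (T s) \<le> card (T s - P) + card P"
      using diff_card_le_card_Diff[OF fin(2), of "T s"] by linarith
    then have "real (card (T s)) \<le> real (card (T s - P)) + real (card P)" by linarith
    then have "L - H1 \<le> card (T s - P)" using sz unfolding sized_def by simp
    then have cb: "q * (1 - b) \<le> c" unfolding c using b(1) q by (intro mult_left_mono) auto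
    have "measure_pmf.prob (Pi_pmf ?W {} (\<lambda>_. ?R)) {\<nu>. Bad P T \<nu>}
        = measure_pmf.prob (Pi_pmf ?W {} (\<lambda>_. ?R)) (Pi ?W (\<lambda>_. {A. \<not> (u \<in> A \<and> A \<inter> (T s - P) \<noteq> {})}))"
      unfolding Bad_def by (intro arg_cong[where f = "measure _"]) auto
    also have "\<dots> = (1 - c) ^ card ?W"
    proof -
      have "{A. \<not> (u \<in> A \<and> A \<inter> (T s - P) \<noteq> {})} = space ?R - {A. u \<in> A \<and> A \<inter> (T s - P) \<noteq> {}}" by auto
      then have "measure_pmf.prob ?R {A. \<not> (u \<in> A \<and> A \<inter> (T s - P) \<noteq> {})} = 1 - c"
        using measure_pmf.prob_compl[of _ ?R] unfolding c_def by (simp del: space_measure_pmf)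
      then show ?thesis using finW by (simp add: measure_Pi_pmf_Pi)
    qed
    also have "\<dots> \<le> exp (- c) ^ card ?W"
      using exp_ge_add_one_self[of "- c"] unfolding c_def by (intro power_mono) auto
    also have "\<dots> = exp (- (c * card ?W))" by (simp add: exp_of_nat_mult[symmetric] mult.commute)
    also have "\<dots> \<le> ?\<beta>"
    proof -
      have "(1 - \<tau>) * n \<le> card ?W" using sz K sub D by (intro card_fresh_ge) auto
      then have "q * (1 - b) * ((1 - \<tau>) * n) \<le> c * card ?W"
        using cb \<tau> q b(2) by (intro mult_mono) (auto simp: c_def)
      then show ?thesis by simp
    qed
    finally show "measure_pmf.prob (Pi_pmf ?W {} (\<lambda>_. ?R)) {\<nu>. Bad P T \<nu>} \<le> ?\<beta>" .
  next
    fix f assume far: "u \<notin> nball (edges_of n f) {s} (Suc (Suc (Suc r)))"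
    show "Bad (core n ?S ?D r f) (cells n ?S ?D r f) (fresh_nbhds n ?S ?D r f)"
      unfolding Bad_def
    proof
      fix w assume w: "w \<in> fresh_vertices n ?D (\<Union>(cells n ?S ?D r f ` ?S))"
      show "\<not> (u \<in> fresh_nbhds n ?S ?D r f w \<and> fresh_nbhds n ?S ?D r f w \<inter> (cells n ?S ?D r f s - core n ?S ?D r f) \<noteq> {})"
    proof
      assume as: "u \<in> fresh_nbhds n ?S ?D r f w \<and> fresh_nbhds n ?S ?D r f w \<inter> (cells n ?S ?D r f s - core n ?S ?D r f) \<noteq> {}"
      then have "w \<in> nball (delete_vertices (edges_of n f) ?D) {s} (Suc (Suc r))"
        using fresh_nbhds_ball_iff[OF S D w, of s] by blast
      then have "w \<in> nball (edges_of n f) {s} (Suc (Suc r))"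
        by (rule rev_subsetD) (rule nball_graph_mono, auto simp: delete_vertices_def)
      moreover have "{w, u} \<in> edges_of n f" using as unfolding fresh_nbhds_eq[OF S D w] by blast
      ultimately have "u \<in> nball (edges_of n f) {s} (Suc (Suc (Suc r)))"
        unfolding nball.simps(2)[of _ _ "Suc (Suc r)"] by blast
      then show False using far by blast
    qed
    qed
  qed (use K in simp_all)
qed

text \<open>The roles are exchanged: the centres are the two vertices to be separated, and the fresh
  vertices are the potential sensors. A sensor counts if exactly one of the two is within distance
  \<open>r + 2\<close>; this has probability at least \<open>2 * a - 2 * b\<close>.\<close>

lemma prob_not_separated_le:
  assumes us: "u \<in> {1..n}" "u' \<in> {1..n}" "u \<noteq> u'"
    and a: "\<And>k. real k \<le> H2 \<Longrightarrow> a \<le> (1 - q) ^ k"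
    and b: "\<And>k. 2 * (L - H1) \<le> real k \<Longrightarrow> (1 - q) ^ k \<le> b"
    and ab: "b \<le> a"
  shows "measure_pmf.prob (edge_bits n q)
      {f. expanding n \<epsilon> d m (edges_of n f) \<and>
        real (card {z\<in>{1..n}. gdist (edges_of n f) u z \<noteq> gdist (edges_of n f) u' z}) < (2 * a - 2 * b - 3 * \<tau>) * n}
    \<le> exp (- (\<tau>\<^sup>2 * n))" (is "_ \<le> ?\<beta>")
proof -
  let ?S = "{u, u'}" and ?D = "{} :: nat set"
  have S: "?S \<subseteq> {1..n} - ?D" and D: "?D \<subseteq> {1..n}" using us by auto
  have cS: "card ?S = 2" using us by simp
  define x where "x = (2 * a - 2 * b - 3 * \<tau>) * n"
  define hit where "hit = (\<lambda>(P :: nat set) (T :: nat \<Rightarrow> nat set) A. (A \<inter> (T u - P) = {}) \<noteq> (A \<inter> (T u' - P) = {}))"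
  define Bad where "Bad = (\<lambda>(P :: nat set) (T :: nat \<Rightarrow> nat set) (\<nu> :: nat \<Rightarrow> nat set).
    real (card {w\<in>fresh_vertices n ?D (\<Union>(T ` ?S)). hit P T (\<nu> w)}) \<le> x)"
  show ?thesis
    unfolding x_def[symmetric]
  proof (rule prob_expanding_le[where Bad = Bad, OF S _ D])
    fix P T assume sz: "sized ?S P T" and sub: "P \<subseteq> \<Union>(T ` ?S)" "\<Union>(T ` ?S) \<subseteq> {1..n} - ?D"
    let ?W = "fresh_vertices n ?D (\<Union>(T ` ?S))" and ?Y = "exposed ?D P (\<Union>(T ` ?S))"
    let ?R = "random_subset ?Y q"
    let ?F = "T u - P" and ?F' = "T u' - P"
    have "finite (\<Union>(T ` ?S))" using finite_subset[OF sub(2)] by simp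
    then have fin: "finite (T u)" "finite (T u')" "finite P" using finite_subset[OF sub(1)] by simp_all
    have finY: "finite ?Y" unfolding exposed_def using fin by simp
    have finW: "finite ?W" unfolding fresh_vertices_def by simp
    have FY: "?F \<subseteq> ?Y" "?F' \<subseteq> ?Y" "?F \<union> ?F' \<subseteq> ?Y" unfolding exposed_def by auto
    define c where "c = measure_pmf.prob ?R {A. hit P T A}"
    note avoid = prob_random_subset_avoid[OF finY _ q(1) q1]
    \<comment> \<open>The event splits into two disjoint differences, each of which avoids one cell
      but not the union. Only the sizes of \<open>?F\<close>, \<open>?F'\<close> and
      \<open>?F \<union> ?F'\<close> enter, so the cells may overlap.\<close>
    have c: "c = ((1 - q) ^ card ?F - (1 - q) ^ card (?F \<union> ?F')) + ((1 - q) ^ card ?F' - (1 - q) ^ card (?F \<union> ?F'))"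
    proof -
      have "c = measure_pmf.prob ?R (({A. A \<inter> ?F = {}} - {A. A \<inter> (?F \<union> ?F') = {}})
          \<union> ({A. A \<inter> ?F' = {}} - {A. A \<inter> (?F \<union> ?F') = {}}))"
        unfolding c_def hit_def by (intro arg_cong[where f = "measure _"]) blast
      also have "\<dots> = measure_pmf.prob ?R ({A. A \<inter> ?F = {}} - {A. A \<inter> (?F \<union> ?F') = {}})
          + measure_pmf.prob ?R ({A. A \<inter> ?F' = {}} - {A. A \<inter> (?F \<union> ?F') = {}})"
        by (rule measure_pmf.finite_measure_Union) auto
      also have "measure_pmf.prob ?R ({A. A \<inter> ?F = {}} - {A. A \<inter> (?F \<union> ?F') = {}})
          = (1 - q) ^ card ?F - (1 - q) ^ card (?F \<union> ?F')"
        unfolding avoid[OF FY(1), symmetric] avoid[OF FY(3), symmetric]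
        by (rule measure_pmf.finite_measure_Diff) auto
      also have "measure_pmf.prob ?R ({A. A \<inter> ?F' = {}} - {A. A \<inter> (?F \<union> ?F') = {}})
          = (1 - q) ^ card ?F' - (1 - q) ^ card (?F \<union> ?F')"
        unfolding avoid[OF FY(2), symmetric] avoid[OF FY(3), symmetric]
        by (rule measure_pmf.finite_measure_Diff) auto
      finally show ?thesis .
    qed
    have "real (card ?F) \<le> H2" "real (card ?F') \<le> H2"
      using sz card_mono[OF fin(1), of ?F] card_mono[OF fin(2), of ?F'] unfolding sized_def by force+
    then have ca: "a \<le> (1 - q) ^ card ?F" "a \<le> (1 - q) ^ card ?F'" using a by blast+
    have "2 * (L - H1) \<le> card (?F \<union> ?F')"
    proof -
      have "?F \<union> ?F' = \<Union>(T ` ?S) - P" by auto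
      then have "card (\<Union>(T ` ?S)) \<le> card (?F \<union> ?F') + card P"
        using diff_card_le_card_Diff[OF fin(3), of "\<Union>(T ` ?S)"] by simp
      then have "real (card (\<Union>(T ` ?S))) \<le> real (card (?F \<union> ?F')) + real (card P)" by linarith
      then have "L * real 2 \<le> real (card (?F \<union> ?F')) + H1 * real 2"
        using sz unfolding sized_def cS by linarith
      then show ?thesis by simp
    qed
    then have cb: "(1 - q) ^ card (?F \<union> ?F') \<le> b" by (rule b)
    define c0 where "c0 = 2 * a - 2 * b"
    have c0: "c0 \<le> c" "0 \<le> c0" using ca cb ab unfolding c c0_def by auto
    have c1: "c \<le> 1" unfolding c_def by simp
    have W: "(1 - \<tau>) * n \<le> card ?W" using sz K sub D cS by (intro card_fresh_ge) auto
    have "measure_pmf.prob (Pi_pmf ?W {} (\<lambda>_. ?R)) {\<nu>. Bad P T \<nu>}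
        \<le> measure_pmf.prob (Pi_pmf ?W {} (\<lambda>_. ?R)) {\<nu>. (- \<tau>) * x \<le> (- \<tau>) * real (card {w\<in>?W. hit P T (\<nu> w)})}"
      unfolding Bad_def using \<tau> by (intro measure_pmf.finite_measure_mono) (auto simp: mult_le_cancel_left)
    also have "\<dots> \<le> exp (real (card ?W) * c * (exp (- \<tau>) - 1) - (- \<tau>) * x)"
      unfolding c_def by (rule prob_count_chernoff[OF finW])
    \<comment> \<open>Of the slack \<open>3 * \<tau>\<close>, at most \<open>2 * \<tau>\<close> pays
      for the vertices that are not fresh and for the quadratic term of the exponential; the
      remaining \<open>\<tau>\<close> produces the exponent
      \<open>- (\<tau>\<^sup>2 * n)\<close>.\<close>
    also have "\<dots> \<le> ?\<beta>"
    proof -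
      have e: "exp (- \<tau>) - 1 \<le> - \<tau> * (1 - \<tau>)"
        using exp_le_quadratic[of "- \<tau>"] \<tau> by (simp add: algebra_simps power2_eq_square)
      have "(1 - \<tau>) * n * c0 \<le> card ?W * c" using W c0 \<tau> by (intro mult_mono) auto
      then have "card ?W * c * (exp (- \<tau>) - 1) \<le> (1 - \<tau>) * n * c0 * (exp (- \<tau>) - 1)"
        by (rule mult_right_mono_neg) (use \<tau> in simp)
      also have "\<dots> \<le> (1 - \<tau>) * n * c0 * (- \<tau> * (1 - \<tau>))"
        using e \<tau> c0 by (intro mult_left_mono) auto
      finally have "card ?W * c * (exp (- \<tau>) - 1) - (- \<tau>) * x
          \<le> (1 - \<tau>) * n * c0 * (- \<tau> * (1 - \<tau>)) + \<tau> * x" by simp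
      also have "\<dots> = \<tau> * n * (c0 * (2 * \<tau> - \<tau>\<^sup>2) - 3 * \<tau>)"
        unfolding x_def c0_def by (simp add: algebra_simps power2_eq_square)
      also have "\<dots> \<le> \<tau> * n * (- \<tau>)"
      proof (rule mult_left_mono)
        have "c0 * (2 * \<tau> - \<tau>\<^sup>2) \<le> 1 * (2 * \<tau>)"
          using c0 c1 \<tau> by (intro mult_mono) (auto simp: power2_eq_square)
        then show "c0 * (2 * \<tau> - \<tau>\<^sup>2) - 3 * \<tau> \<le> - \<tau>" by simp
      qed (use \<tau> in simp)
      finally show ?thesis by (simp add: power2_eq_square mult_ac)
    qed
    finally show "measure_pmf.prob (Pi_pmf ?W {} (\<lambda>_. ?R)) {\<nu>. Bad P T \<nu>} \<le> ?\<beta>" .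
  next
    fix f
    assume few: "real (card {z\<in>{1..n}. gdist (edges_of n f) u z \<noteq> gdist (edges_of n f) u' z}) < x"
    let ?E = "edges_of n f"
    have del: "delete_vertices ?E {} = ?E" unfolding delete_vertices_def by simp
    have "{w\<in>fresh_vertices n ?D (\<Union>(cells n ?S ?D r f ` ?S)).
        hit (core n ?S ?D r f) (cells n ?S ?D r f) (fresh_nbhds n ?S ?D r f w)}
      \<subseteq> {z\<in>{1..n}. gdist ?E u z \<noteq> gdist ?E u' z}"
    proof clarify
      fix w assume w: "w \<in> fresh_vertices n ?D (\<Union>(cells n ?S ?D r f ` ?S))"
        and "hit (core n ?S ?D r f) (cells n ?S ?D r f) (fresh_nbhds n ?S ?D r f w)"
      then have "(w \<in> nball ?E {u} (Suc (Suc r))) \<noteq> (w \<in> nball ?E {u'} (Suc (Suc r)))"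
        using fresh_nbhds_ball_iff[OF S D w, of u] fresh_nbhds_ball_iff[OF S D w, of u']
        unfolding hit_def del by (simp del: nball.simps)
      then have "gdist ?E u w \<noteq> gdist ?E u' w"
        by (metis gdist_le_iff mem_nball_sym)
      then show "w \<in> {1..n} \<and> gdist ?E u w \<noteq> gdist ?E u' w" using w unfolding fresh_vertices_def by blast
    qed
    from card_mono[OF _ this]
    show "Bad (core n ?S ?D r f) (cells n ?S ?D r f) (fresh_nbhds n ?S ?D r f)"
      unfolding Bad_def using few by simp
  qed (use K cS in simp_all)
qed

text \<open>\<open>a\<close> is a lower bound on the probability of missing a cell,
  \<open>\<gamma>\<^sup>2\<close> on the probability that two vertices agree at one sensor, and
  \<open>\<omega>\<close> is the factor paid per sensor for avoiding overlaps. Cells can become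
  small when overlaps are removed, so \<open>\<gamma>\<close> has to serve every \<open>x\<close>
  between \<open>a\<close> and 1. The Euclidean norm of the label distribution is then at least
  \<open>q * (\<omega> * \<gamma>) ^ card S\<close>.\<close>

lemma prob_no_twins_le:
  assumes v: "v \<in> {1..n}" and S: "S \<subseteq> {1..n} - {v}" "card S \<le> K"
    and a: "\<And>k. real k \<le> H2 \<Longrightarrow> a \<le> (1 - q) ^ k"
    and \<gamma>: "\<And>x. a \<le> x \<Longrightarrow> x \<le> 1 \<Longrightarrow> \<gamma>\<^sup>2 \<le> x\<^sup>2 + (1 - x)\<^sup>2" "0 \<le> \<gamma>"
    and \<omega>: "\<And>k j. real k \<le> (H2 - L) * real j \<Longrightarrow> \<omega> ^ j \<le> (1 - q) ^ k" "0 \<le> \<omega>"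
    and Y: "1 \<le> Y" "Y \<le> (1 - \<tau>) * n * q * (\<omega> * \<gamma>) ^ card S"
  shows "measure_pmf.prob (edge_bits n q)
      {f. expanding n \<epsilon> d m (edges_of n f) \<and>
        \<not> twins (edges_of n f) r v S}
    \<le> exp (2 * real n * q\<^sup>2 - Y / 8)" (is "_ \<le> ?\<beta>")
proof -
  let ?D = "{v}"
  have D: "?D \<subseteq> {1..n}" using v by simp
  have finS: "finite S" using finite_subset[OF S(1)] by simp
  define Bad where "Bad = (\<lambda>(P :: nat set) (T :: nat \<Rightarrow> nat set) (\<nu> :: nat \<Rightarrow> nat set).
    \<forall>w\<in>fresh_vertices n ?D (\<Union>(T ` S)). \<forall>w'\<in>fresh_vertices n ?D (\<Union>(T ` S)).
      w \<noteq> w' \<longrightarrow> v \<in> \<nu> w \<longrightarrow> v \<in> \<nu> w' \<longrightarrow>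
      (\<exists>s\<in>S. (\<nu> w \<inter> (T s - P) \<noteq> {}) \<noteq> (\<nu> w' \<inter> (T s - P) \<noteq> {})))"
  show ?thesis
  proof (rule prob_expanding_le[where Bad = Bad, OF S D])
    fix P T assume sz: "sized S P T" and sub: "P \<subseteq> \<Union>(T ` S)" "\<Union>(T ` S) \<subseteq> {1..n} - ?D"
    let ?B = "\<Union>(T ` S)"
    let ?W = "fresh_vertices n ?D ?B" and ?Y = "exposed ?D P ?B"
    let ?R = "random_subset ?Y q"
    have finB: "finite ?B" using finite_subset[OF sub(2)] by simp
    have finT: "finite (T s)" if "s \<in> S" for s using finite_subset[OF _ finB, of "T s"] that by blast
    have finY: "finite ?Y" unfolding exposed_def using finB by simp
    have finW: "finite ?W" unfolding fresh_vertices_def by simp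
    have vB: "v \<notin> ?B" "0 \<notin> ?B" using sub(2) by auto
    define Ov where "Ov = {y. \<exists>s\<in>S. \<exists>s'\<in>S. s \<noteq> s' \<and> y \<in> T s \<and> y \<in> T s'} - P"
    have OvB: "Ov \<subseteq> ?B - P" unfolding Ov_def by blast
    define Z where "Z = (\<lambda>s. T s - P - Ov)"
    have Z: "Z s \<subseteq> ?B - P" if "s \<in> S" for s using that unfolding Z_def by blast
    have OvL: "real (card Ov) \<le> (H2 - L) * card S"
    proof -
      have "card ?B + card Ov \<le> (\<Sum>s\<in>S. card (T s))"
        by (rule card_overlap_le[OF finS finT]) (auto simp: Ov_def)
      then have "real (card ?B) + real (card Ov) \<le> (\<Sum>s\<in>S. real (card (T s)))"
        by (simp flip: of_nat_sum of_nat_add)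
      also have "\<dots> \<le> (\<Sum>s\<in>S. H2)" using sz unfolding sized_def by (intro sum_mono) auto
      finally show ?thesis using sz unfolding sized_def by (simp add: algebra_simps)
    qed
    txt \<open>Vertices that are adjacent to the overlap of the cells receive no label; on the other
      neighbours of \<open>v\<close> the label has a product distribution.\<close>
    define lab where "lab = (\<lambda>A. if v \<in> A \<and> A \<inter> Ov = {} then Some {s\<in>S. A \<inter> Z s \<noteq> {}} else None)"
    define \<alpha> where "\<alpha> = (\<lambda>s. (1 - q) ^ card (Z s))"
    define \<rho> where "\<rho> = (\<lambda>x. q * (1 - q) ^ card Ov * (\<Prod>s\<in>S. if s \<in> x then 1 - \<alpha> s else \<alpha> s))"
    define N where "N = map_pmf lab ?R"
    have \<alpha>01: "0 \<le> \<alpha> s" "\<alpha> s \<le> 1" for s unfolding \<alpha>_def using q by (auto intro: power_le_one)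
    have pos: "0 \<notin> S" "v \<notin> S" "v \<noteq> 0" using S(1) v by auto
    have pmfN: "pmf N (Some x) = \<rho> x" if x: "x \<in> Pow S" for x
    proof -
      \<comment> \<open>\<open>0\<close> is not a vertex and \<open>v\<close> is not in
        \<open>S\<close>, so both can index extra members of the family: the overlap, which must be
        avoided, and \<open>{v}\<close>, which must be hit.\<close>
      define Zf where "Zf = (\<lambda>j. if j = 0 then Ov else if j = v then {v} else Z j)"
      define Xf where "Xf = (\<lambda>j. if j = 0 then {{}} else if j = v then {A. A \<noteq> {}}
        else if j \<in> x then {A. A \<noteq> {}} else {{} :: nat set})"
      let ?J = "insert 0 (insert v S)"
      have "pmf N (Some x) = measure_pmf.prob ?R {A. \<forall>j\<in>?J. A \<inter> Zf j \<in> Xf j}"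
        unfolding N_def pmf_map
      proof (rule arg_cong[where f = "measure _"], rule set_eqI)
        fix A
        have "A \<in> lab -` {Some x} \<longleftrightarrow> v \<in> A \<and> A \<inter> Ov = {} \<and> (\<forall>s\<in>S. A \<inter> Z s \<noteq> {} \<longleftrightarrow> s \<in> x)"
        proof -
          have "{s\<in>S. A \<inter> Z s \<noteq> {}} = x \<longleftrightarrow> (\<forall>s\<in>S. A \<inter> Z s \<noteq> {} \<longleftrightarrow> s \<in> x)"
            using x by blast
          then show ?thesis unfolding lab_def
            by (cases "v \<in> A \<and> A \<inter> Ov = {}") auto
        qed
        also have "\<dots> \<longleftrightarrow> A \<inter> Zf 0 \<in> Xf 0 \<and> A \<inter> Zf v \<in> Xf v \<and> (\<forall>s\<in>S. A \<inter> Zf s \<in> Xf s)"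
        proof -
          have "A \<inter> Zf s \<in> Xf s \<longleftrightarrow> (A \<inter> Z s \<noteq> {} \<longleftrightarrow> s \<in> x)" if "s \<in> S" for s
          proof -
            have "s \<noteq> 0" "s \<noteq> v" using that pos by metis+
            then show ?thesis unfolding Zf_def Xf_def by simp
          qed
          moreover have "A \<inter> Zf 0 \<in> Xf 0 \<longleftrightarrow> A \<inter> Ov = {}" unfolding Zf_def Xf_def by simp
          moreover have "A \<inter> Zf v \<in> Xf v \<longleftrightarrow> v \<in> A" unfolding Zf_def Xf_def using pos by simp
          ultimately show ?thesis by (simp add: conj_commute conj_left_commute cong: ball_cong)
        qed
        finally show "A \<in> lab -` {Some x} \<longleftrightarrow> A \<in> {A. \<forall>j\<in>?J. A \<inter> Zf j \<in> Xf j}" by simp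
      qed
      also have "\<dots> = (\<Prod>j\<in>?J. measure_pmf.prob (random_subset (Zf j) q) (Xf j))"
      proof (rule prob_random_subset_disjoint_family[OF finY])
        show "finite ?J" using finS by simp
        show "Zf j \<subseteq> ?Y" if "j \<in> ?J" for j
          using that OvB Z[of j] unfolding Zf_def exposed_def by auto
        have dis: "Z s \<inter> Z s' = {}" if "s \<in> S" "s' \<in> S" "s \<noteq> s'" for s s'
          using that unfolding Z_def Ov_def by blast
        show "disjoint_family_on Zf ?J"
          unfolding disjoint_family_on_def
        proof (intro ballI impI)
          fix j k assume jk: "j \<in> ?J" "k \<in> ?J" "j \<noteq> k"
          have vZ: "v \<notin> Ov" "\<And>s. s \<in> S \<Longrightarrow> v \<notin> Z s" using OvB Z vB by blast+
          have OZ: "Ov \<inter> Z s = {}" for s unfolding Z_def by blast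
          have Z0: "Zf 0 = Ov" and Zv: "Zf v = {v}" and Zs: "\<And>s. s \<in> S \<Longrightarrow> Zf s = Z s"
            unfolding Zf_def using pos by auto
          consider "j = 0" "k = v" | "j = 0" "k \<in> S" | "j = v" "k = 0" | "j = v" "k \<in> S"
            | "j \<in> S" "k = 0" | "j \<in> S" "k = v" | "j \<in> S" "k \<in> S" using jk by blast
          then show "Zf j \<inter> Zf k = {}"
            by cases (use vZ OZ dis[OF _ _ jk(3)] in \<open>auto simp: Z0 Zv Zs\<close>)
        qed
      qed
      also have "\<dots> = measure_pmf.prob (random_subset (Zf 0) q) (Xf 0) * (measure_pmf.prob (random_subset (Zf v) q) (Xf v)
          * (\<Prod>s\<in>S. measure_pmf.prob (random_subset (Zf s) q) (Xf s)))"
        using finS pos by simp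
      also have "(\<Prod>s\<in>S. measure_pmf.prob (random_subset (Zf s) q) (Xf s)) = (\<Prod>s\<in>S. if s \<in> x then 1 - \<alpha> s else \<alpha> s)"
      proof (rule prod.cong[OF refl])
        fix s assume s: "s \<in> S"
        then have "s \<noteq> 0" "s \<noteq> v" using pos by metis+
        then have eqs: "Zf s = Z s" "Xf s = (if s \<in> x then {A. A \<noteq> {}} else {{}})" unfolding Zf_def Xf_def by auto
        have "finite (Z s)" using finT[OF s] unfolding Z_def by simp
        then show "measure_pmf.prob (random_subset (Zf s) q) (Xf s) = (if s \<in> x then 1 - \<alpha> s else \<alpha> s)"
          unfolding eqs \<alpha>_def using q(1) q1 by (simp add: prob_random_subset_hit prob_random_subset_empty)
      qed
      also have "measure_pmf.prob (random_subset (Zf 0) q) (Xf 0) = (1 - q) ^ card Ov"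
      proof -
        have "finite Ov" using finite_subset[OF OvB] finB by simp
        then show ?thesis unfolding Zf_def Xf_def using q(1) q1 by (simp add: prob_random_subset_empty)
      qed
      also have "measure_pmf.prob (random_subset (Zf v) q) (Xf v) = q"
        unfolding Zf_def Xf_def using q(1) q1 pos by (simp add: prob_random_subset_hit)
      finally show ?thesis unfolding \<rho>_def by simp
    qed
    have \<rho>0: "0 \<le> \<rho> x" for x
      unfolding \<rho>_def using q \<alpha>01 by (intro mult_nonneg_nonneg prod_nonneg) auto
    have sum\<rho>: "(\<Sum>x\<in>Pow S. \<rho> x) = q * (1 - q) ^ card Ov"
    proof -
      have "(\<Sum>x\<in>Pow S. \<rho> x) = q * (1 - q) ^ card Ov * (\<Prod>s\<in>S. (1 - \<alpha> s) + \<alpha> s)"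
        unfolding \<rho>_def sum_distrib_left[symmetric] sum_Pow_prod_if[OF finS] ..
      then show ?thesis by simp
    qed
    \<comment> \<open>Labels factor over \<open>S\<close>, so the squared norm is a product of
      agreement probabilities at single sensors.\<close>
    have sum\<rho>2: "(\<Sum>x\<in>Pow S. (\<rho> x)\<^sup>2) = (q * (1 - q) ^ card Ov)\<^sup>2 * (\<Prod>s\<in>S. (1 - \<alpha> s)\<^sup>2 + (\<alpha> s)\<^sup>2)"
    proof -
      have "(\<rho> x)\<^sup>2 = (q * (1 - q) ^ card Ov)\<^sup>2 * (\<Prod>s\<in>S. if s \<in> x then (1 - \<alpha> s)\<^sup>2 else (\<alpha> s)\<^sup>2)" for x
        unfolding \<rho>_def power_mult_distrib prod_power_distrib
        by (intro arg_cong2[where f = "(*)"] prod.cong refl) auto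
      then show ?thesis unfolding sum_Pow_prod_if[OF finS, symmetric] by (simp add: sum_distrib_left)
    qed
    have setN: "set_pmf N \<subseteq> insert None (Some ` Pow S)" unfolding N_def lab_def by auto
    have q0: "pmf N None = 1 - (\<Sum>x\<in>Pow S. \<rho> x)"
    proof -
      have "1 = sum (pmf N) (insert None (Some ` Pow S))"
        by (rule sum_pmf_eq_1[symmetric]) (use setN finS in auto)
      also have "\<dots> = pmf N None + (\<Sum>x\<in>Pow S. pmf N (Some x))"
        using finS by (subst sum.insert) (auto simp: sum.reindex)
      also have "(\<Sum>x\<in>Pow S. pmf N (Some x)) = (\<Sum>x\<in>Pow S. \<rho> x)"
        using pmfN by (intro sum.cong) auto
      finally show ?thesis by simp
    qed
    have sq: "(\<Sum>x\<in>Pow S. \<rho> x) \<le> q"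
      unfolding sum\<rho> using q by (simp add: mult_left_le power_le_one)
    have q0pos: "0 < pmf N None" using q0 sq q by simp
    let ?N = "real (card ?W)"
    have W: "(1 - \<tau>) * n \<le> ?N" using sz S finS sub D by (intro card_fresh_ge) auto
    have Wn: "?N \<le> n" using card_mono[of "{1..n}" ?W] by (auto simp: fresh_vertices_def)
    have YN: "Y\<^sup>2 \<le> ?N\<^sup>2 * (\<Sum>x\<in>Pow S. (\<rho> x)\<^sup>2)"
    proof -
      have "Y \<le> ?N * q * (\<omega> * \<gamma>) ^ card S"
        using Y(2) mult_right_mono[OF W, of "q * (\<omega> * \<gamma>) ^ card S"] q \<gamma>(2) \<omega>(2) by (simp add: mult.assoc)
      also have "\<dots> = ?N * (q * \<omega> ^ card S * \<gamma> ^ card S)" by (simp add: power_mult_distrib)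
      finally have "Y\<^sup>2 \<le> (?N * (q * \<omega> ^ card S * \<gamma> ^ card S))\<^sup>2" using Y(1) by (intro power_mono) auto
      also have "\<dots> = ?N\<^sup>2 * ((q * \<omega> ^ card S)\<^sup>2 * (\<gamma>\<^sup>2) ^ card S)"
        by (simp add: power_mult_distrib flip: power_mult) (simp add: mult.commute)
      also have "\<dots> \<le> ?N\<^sup>2 * (\<Sum>x\<in>Pow S. (\<rho> x)\<^sup>2)"
        unfolding sum\<rho>2
      proof (intro mult_left_mono mult_mono)
        show "(q * \<omega> ^ card S)\<^sup>2 \<le> (q * (1 - q) ^ card Ov)\<^sup>2"
          using \<omega>(1)[OF OvL] \<omega>(2) q by (intro power_mono mult_left_mono) auto
        have "(\<gamma>\<^sup>2) ^ card S = (\<Prod>s\<in>S. \<gamma>\<^sup>2)" by simp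
        also have "\<dots> \<le> (\<Prod>s\<in>S. (1 - \<alpha> s)\<^sup>2 + (\<alpha> s)\<^sup>2)"
        proof (rule prod_mono, intro conjI)
          fix s assume s: "s \<in> S"
          have "card (Z s) \<le> card (T s)" using finT[OF s] unfolding Z_def by (intro card_mono) auto
          then have "real (card (Z s)) \<le> H2" using sz s unfolding sized_def by force
          then have "a \<le> \<alpha> s" unfolding \<alpha>_def by (rule a)
          from \<gamma>(1)[OF this \<alpha>01(2)] show "\<gamma>\<^sup>2 \<le> (1 - \<alpha> s)\<^sup>2 + (\<alpha> s)\<^sup>2" by simp
        qed simp
        finally show "(\<gamma>\<^sup>2) ^ card S \<le> (\<Prod>s\<in>S. (1 - \<alpha> s)\<^sup>2 + (\<alpha> s)\<^sup>2)" .
      qed auto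
      finally show ?thesis .
    qed
    have comp: "map_pmf (\<lambda>h. lab \<circ> h) (Pi_pmf ?W {} (\<lambda>_. ?R)) = Pi_pmf ?W None (\<lambda>_. N)"
      unfolding N_def by (rule Pi_pmf_map[symmetric]) (use finW in \<open>auto simp: lab_def\<close>)
    let ?C = "{g. (\<forall>u\<in>?W. g u \<in> insert None (Some ` Pow S)) \<and>
      (\<forall>u\<in>?W. \<forall>u'\<in>?W. u \<noteq> u' \<longrightarrow> g u = g u' \<longrightarrow> g u = None)}"
    have subC: "{\<nu>. Bad P T \<nu>} \<subseteq> (\<lambda>h. lab \<circ> h) -` ?C"
    proof (rule subsetI, unfold vimage_eq mem_Collect_eq, intro conjI ballI impI)
      fix \<nu> u assume "u \<in> ?W"
      show "(lab \<circ> \<nu>) u \<in> insert None (Some ` Pow S)" unfolding lab_def by auto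
    next
      fix \<nu> u u' assume bad: "Bad P T \<nu>" and u: "u \<in> ?W" "u' \<in> ?W" "u \<noteq> u'" and eq: "(lab \<circ> \<nu>) u = (lab \<circ> \<nu>) u'"
      show "(lab \<circ> \<nu>) u = None"
      proof (rule ccontr)
        assume "(lab \<circ> \<nu>) u \<noteq> None"
        then have l: "v \<in> \<nu> u" "\<nu> u \<inter> Ov = {}" unfolding lab_def comp_def by (metis)+
        have "(lab \<circ> \<nu>) u' \<noteq> None" using eq \<open>(lab \<circ> \<nu>) u \<noteq> None\<close> by simp
        then have l': "v \<in> \<nu> u'" "\<nu> u' \<inter> Ov = {}" unfolding lab_def comp_def by (metis)+
        have "{s\<in>S. \<nu> u \<inter> Z s \<noteq> {}} = {s\<in>S. \<nu> u' \<inter> Z s \<noteq> {}}"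
          using eq l l' unfolding lab_def comp_def by simp
        moreover have "\<nu> u \<inter> Z s = \<nu> u \<inter> (T s - P)" "\<nu> u' \<inter> Z s = \<nu> u' \<inter> (T s - P)" for s
          using l(2) l'(2) unfolding Z_def by blast+
        ultimately have "\<forall>s\<in>S. (\<nu> u \<inter> (T s - P) \<noteq> {}) = (\<nu> u' \<inter> (T s - P) \<noteq> {})" by blast
        then show False using bad u l(1) l'(1) unfolding Bad_def by blast
      qed
    qed
    have "measure_pmf.prob (Pi_pmf ?W {} (\<lambda>_. ?R)) {\<nu>. Bad P T \<nu>}
        \<le> measure_pmf.prob (Pi_pmf ?W {} (\<lambda>_. ?R)) ((\<lambda>h. lab \<circ> h) -` ?C)"
      by (rule measure_pmf.finite_measure_mono[OF subC]) simp
    also have "\<dots> = measure_pmf.prob (Pi_pmf ?W None (\<lambda>_. N)) ?C"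
      unfolding comp[symmetric] measure_map_pmf ..
    also have "\<dots> \<le> pmf N None ^ card ?W * (\<Prod>x\<in>Pow S. 1 + ?N * pmf N (Some x) / pmf N None)"
      using finS by (intro prob_labels_distinct_le finW q0pos) simp
    also have "\<dots> = pmf N None ^ card ?W * (\<Prod>x\<in>Pow S. 1 + ?N * \<rho> x / pmf N None)"
      using pmfN by (intro arg_cong2[where f = "(*)"] refl prod.cong) auto
    also have "\<dots> \<le> exp (2 * ?N * q\<^sup>2 - Y / 8)"
      using finS by (intro distinct_labels_bound \<rho>0 q0 sq q(2) Y(1) YN refl) simp
    also have "\<dots> \<le> ?\<beta>" using Wn by (simp add: mult_right_mono)
    finally show "measure_pmf.prob (Pi_pmf ?W {} (\<lambda>_. ?R)) {\<nu>. Bad P T \<nu>} \<le> ?\<beta>" .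
  next
    fix f assume no: "\<not> twins (edges_of n f) r v S"
    let ?E = "delete_vertices (edges_of n f) {v}"
    show "Bad (core n S ?D r f) (cells n S ?D r f) (fresh_nbhds n S ?D r f)"
      unfolding Bad_def
    proof (intro ballI impI, rule ccontr)
      fix w w' assume w: "w \<in> fresh_vertices n ?D (\<Union>(cells n S ?D r f ` S))"
        and w': "w' \<in> fresh_vertices n ?D (\<Union>(cells n S ?D r f ` S))" and "w \<noteq> w'"
        and vw: "v \<in> fresh_nbhds n S ?D r f w" "v \<in> fresh_nbhds n S ?D r f w'"
        and same: "\<not> (\<exists>s\<in>S. (fresh_nbhds n S ?D r f w \<inter> (cells n S ?D r f s - core n S ?D r f) \<noteq> {})
          \<noteq> (fresh_nbhds n S ?D r f w' \<inter> (cells n S ?D r f s - core n S ?D r f) \<noteq> {}))"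
      have "{w, v} \<in> edges_of n f" "{w', v} \<in> edges_of n f"
        using vw unfolding fresh_nbhds_eq[OF S(1) D w] fresh_nbhds_eq[OF S(1) D w'] by blast+
      moreover have "w \<in> nball ?E {s} (Suc (Suc r)) \<longleftrightarrow> w' \<in> nball ?E {s} (Suc (Suc r))" if "s \<in> S" for s
        unfolding fresh_nbhds_ball_iff[OF S(1) D w that] fresh_nbhds_ball_iff[OF S(1) D w' that]
        using same that by blast
      moreover have "w \<notin> nball ?E {s} (Suc r)" "w' \<notin> nball ?E {s} (Suc r)" if "s \<in> S" for s
        using fresh_notin_ball[OF w that] fresh_notin_ball[OF w' that] .
      ultimately show False using no \<open>w \<noteq> w'\<close> unfolding twins_def by blast
    qed
  qed simp_all
qed

end

section \<open>From graphs to the game\<close>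

text \<open>\<open>small\<close> contains the square of the growth factor of a closed neighbourhood
  because pairs of candidates are counted.\<close>

lemma cops_can_win_if_separated:
  fixes \<kappa> d \<epsilon> m :: real
  assumes E: "E \<subseteq> vertex_pairs n" and ex: "expanding n \<epsilon> d m E" and k: "k \<le> n" and \<kappa>: "\<kappa> \<le> 1"
    and sep: "\<And>u u'. u \<in> {1..n} \<Longrightarrow> u' \<in> {1..n} \<Longrightarrow> u \<noteq> u' \<Longrightarrow>
      \<kappa> * n \<le> card {z\<in>{1..n}. gdist E u z \<noteq> gdist E u' z}"
    and small: "(1 + (1 + \<epsilon>) * d)\<^sup>2 * (1 - \<kappa>) ^ k \<le> 1 / 4"
  shows "cops_can_win {1..n} E k"
proof (rule cops_can_win_if_shrinking)
  fix R assume R: "R \<subseteq> {1..n}" "2 \<le> card R"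
  have del: "delete_vertices E {} = E" unfolding delete_vertices_def by simp
  have sub: "closed_nbhd {1..n} E R \<subseteq> nball E R 1"
    unfolding closed_nbhd_def adj_def by auto
  have "finite (nball E R 1)"
    using finite_subset[OF nball_delete_subset[OF E, of R "{}" 1]] R(1) unfolding del by simp
  from card_mono[OF this sub] have "real (card (closed_nbhd {1..n} E R)) \<le> (1 + (1 + \<epsilon>) * d) * card R"
    using card_nball_le[OF E _ ex, of R "{}" 1] R(1) unfolding del by simp
  then show "\<exists>S\<subseteq>{1..n}. card S = k \<and> (\<forall>C\<subseteq>closed_nbhd {1..n} E R.
      (\<forall>x\<in>C. \<forall>y\<in>C. dist_vec E S x = dist_vec E S y) \<longrightarrow> card C < card R)"
    using k \<kappa> sep small R unfolding closed_nbhd_def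
    by (intro exists_sensors_small_classes[where s = \<kappa> and D = "1 + (1 + \<epsilon>) * d"]) auto
qed (use k in auto)

text \<open>A sensor on \<open>v\<close> sees both twins at distance 1 and is removed before
  \<open>twins\<close> is applied; hence that assumption speaks of sets with at most
  \<open>k\<close> elements.\<close>

lemma not_cops_can_win_if_twins:
  assumes E: "E \<subseteq> vertex_pairs n" and n: "1 \<le> n"
    and near: "\<And>u s. u \<in> {1..n} \<Longrightarrow> s \<in> {1..n} \<Longrightarrow> u \<noteq> s \<Longrightarrow> u \<in> nball E {s} (Suc (Suc (Suc r)))"
    and twins: "\<And>v S. v \<in> {1..n} \<Longrightarrow> S \<subseteq> {1..n} - {v} \<Longrightarrow> card S \<le> k \<Longrightarrow> twins E r v S"
  shows "\<not> cops_can_win {1..n} E k"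
proof (rule not_cops_can_win)
  show "1 \<in> {1..n}" using n by simp
  fix v S assume v: "v \<in> {1..n}" and S: "S \<subseteq> {1..n}" "card S = k"
  have "card (S - {v}) \<le> k" using S(2) card_Diff1_le[of S v] by simp
  moreover have "S - {v} \<subseteq> {1..n} - {v}" using S(1) by blast
  ultimately obtain u u' where u: "u \<noteq> u'" "{u, v} \<in> E" "{u', v} \<in> E" and
    far: "\<And>s. s \<in> S - {v} \<Longrightarrow> u \<notin> nball (delete_vertices E {v}) {s} (Suc r)"
      "\<And>s. s \<in> S - {v} \<Longrightarrow> u' \<notin> nball (delete_vertices E {v}) {s} (Suc r)" and
    eq: "\<And>s. s \<in> S - {v} \<Longrightarrow> u \<in> nball (delete_vertices E {v}) {s} (Suc (Suc r)) \<longleftrightarrow>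
             u' \<in> nball (delete_vertices E {v}) {s} (Suc (Suc r))"
    using twins[OF v, of "S - {v}"] unfolding twins_def by blast
  have uv: "u \<in> {1..n}" "u' \<in> {1..n}" "u \<noteq> v" "u' \<noteq> v"
    using u(2,3) E pair_in_vertex_pairs by blast+
  have self: "w \<in> nball E {w} (Suc (Suc (Suc r)))" for w
    using nball_le[of 0 "Suc (Suc (Suc r))" E "{w}"] by auto
  have near': "w \<in> nball E {s} (Suc (Suc (Suc r)))" if "w \<in> {1..n}" "s \<in> {1..n}" for w s
    using near[OF that] self by metis
  have "gdist E u s = gdist E u' s" if s: "s \<in> S" for s
  proof (cases "s = v")
    case True
    then show ?thesis using gdist_neighbours_self[OF u(2) uv(3) u(3) uv(4)] by simp
  next
    case False
    then have s': "s \<in> S - {v}" using s by blast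
    have "s \<in> {1..n}" using s S(1) by blast
    then show ?thesis
      by (intro gdist_eq_of_neighbours[OF u(2) uv(3) u(3) uv(4) far(1)[OF s'] far(2)[OF s'] eq[OF s']] near' uv)
  qed
  then show "\<exists>a\<in>{1..n}. \<exists>b\<in>{1..n}. a \<noteq> b \<and> {a, v} \<in> E \<and> {b, v} \<in> E \<and> (\<forall>s\<in>S. gdist E a s = gdist E b s)"
    using u uv by blast
qed

lemma prob_bad_pairs_le:
  assumes "1 \<le> n" and far: "\<And>u u'. u \<in> {1..n} \<Longrightarrow> u' \<in> {1..n} \<Longrightarrow> u \<noteq> u' \<Longrightarrow>
    measure_pmf.prob M {f. G f \<and> R u u' f} \<le> \<beta>" and "0 \<le> \<beta>"
  shows "measure_pmf.prob M {f. \<exists>z\<in>{1..n} \<times> {1..n}. fst z \<noteq> snd z \<and> G f \<and> R (fst z) (snd z) f} \<le> real n ^ 2 * \<beta>"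
proof -
  have "measure_pmf.prob M {f. \<exists>z\<in>{1..n} \<times> {1..n}. fst z \<noteq> snd z \<and> G f \<and> R (fst z) (snd z) f}
      \<le> (\<Sum>z\<in>{1..n} \<times> {1..n}. measure_pmf.prob M {f. fst z \<noteq> snd z \<and> G f \<and> R (fst z) (snd z) f})"
    by (rule prob_ex_le) simp
  also have "\<dots> \<le> (\<Sum>z\<in>{1..n} \<times> {1..n}. \<beta>)"
  proof (rule sum_mono)
    fix z assume z: "z \<in> {1..n} \<times> {1..n}"
    show "measure_pmf.prob M {f. fst z \<noteq> snd z \<and> G f \<and> R (fst z) (snd z) f} \<le> \<beta>"
    proof (cases "fst z = snd z")
      case False
      then show ?thesis using far[of "fst z" "snd z"] z by auto
    qed (use assms(3) in simp)
  qed
  finally show ?thesis by (simp add: power2_eq_square card_cartesian_product)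
qed

lemma card_small_subsets_le:
  assumes "1 \<le> n"
  shows "card {S. S \<subseteq> {1..n} \<and> card S \<le> K} \<le> (K + 1) * n ^ K"
proof -
  have "{S. S \<subseteq> {1..n} \<and> card S \<le> K} = (\<Union>j\<in>{..K}. {S. S \<subseteq> {1..n} \<and> card S = j})" by auto
  then have "card {S. S \<subseteq> {1..n} \<and> card S \<le> K} \<le> (\<Sum>j\<in>{..K}. card {S. S \<subseteq> {1..n} \<and> card S = j})"
    by (simp add: card_UN_le)
  also have "\<dots> \<le> (\<Sum>j\<in>{..K}. n ^ K)"
  proof (rule sum_mono)
    fix j assume "j \<in> {..K}"
    have "card {S. S \<subseteq> {1..n} \<and> card S = j} = n choose j" using n_subsets[of "{1..n}" j] by simp
    also have "\<dots> \<le> n ^ j"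
      by (cases "j \<le> n") (auto simp: binomial_le_pow binomial_eq_0)
    also have "\<dots> \<le> n ^ K" using assms \<open>j \<in> {..K}\<close> by (intro power_increasing) auto
    finally show "card {S. S \<subseteq> {1..n} \<and> card S = j} \<le> n ^ K" .
  qed
  finally show ?thesis by simp
qed

section \<open>Combining asymptotically almost sure events\<close>

lemma aasI:
  assumes "\<forall>\<^sub>F n in sequentially. measure_pmf.prob (edge_bits n (p n)) {f. \<not> P n (edges_of n f)} \<le> \<beta> n"
    and "\<beta> \<longlonglongrightarrow> 0"
  shows "aas p P"
  unfolding aas_def
proof (rule tendsto_sandwich[OF _ _ _ tendsto_const])
  have "measure_pmf.prob (gnp n (p n)) {E. P n E} = 1 - measure_pmf.prob (edge_bits n (p n)) {f. \<not> P n (edges_of n f)}" for n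
  proof -
    have "{f. P n (edges_of n f)} = space (edge_bits n (p n)) - {f. \<not> P n (edges_of n f)}" by auto
    then show ?thesis
      unfolding prob_gnp using measure_pmf.prob_compl[of "{f. \<not> P n (edges_of n f)}" "edge_bits n (p n)"]
      by (simp del: space_measure_pmf)
  qed
  then show "\<forall>\<^sub>F n in sequentially. 1 - \<beta> n \<le> measure_pmf.prob (gnp n (p n)) {E. P n E}"
    using assms(1) by (auto elim: eventually_mono)
  show "(\<lambda>n. 1 - \<beta> n) \<longlonglongrightarrow> 1" using tendsto_diff[OF tendsto_const assms(2), of 1] by simp
qed auto

lemma aas_conj:
  assumes "aas p P" "aas p R"
  shows "aas p (\<lambda>n E. P n E \<and> R n E)"
proof -
  have neg: "(\<lambda>n. measure_pmf.prob (gnp n (p n)) {E. \<not> Q n E}) \<longlonglongrightarrow> 0" if "aas p Q" for Q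
  proof -
    have "measure_pmf.prob (gnp n (p n)) {E. \<not> Q n E} = 1 - measure_pmf.prob (gnp n (p n)) {E. Q n E}" for n
    proof -
      have "{E. \<not> Q n E} = space (gnp n (p n)) - {E. Q n E}" by auto
      then show ?thesis using measure_pmf.prob_compl[of "{E. Q n E}" "gnp n (p n)"] by (simp del: space_measure_pmf)
    qed
    then show ?thesis using tendsto_diff[OF tendsto_const that[unfolded aas_def], of 1] by simp
  qed
  show ?thesis
  proof (rule aasI[where \<beta> = "\<lambda>n. measure_pmf.prob (gnp n (p n)) {E. \<not> P n E} + measure_pmf.prob (gnp n (p n)) {E. \<not> R n E}"])
    show "(\<lambda>n. measure_pmf.prob (gnp n (p n)) {E. \<not> P n E} + measure_pmf.prob (gnp n (p n)) {E. \<not> R n E}) \<longlonglongrightarrow> 0"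
      using tendsto_add[OF neg[OF assms(1)] neg[OF assms(2)]] by simp
    have "{f. \<not> (P n (edges_of n f) \<and> R n (edges_of n f))} = {f. \<not> P n (edges_of n f)} \<union> {f. \<not> R n (edges_of n f)}" for n
      by auto
    then show "\<forall>\<^sub>F n in sequentially. measure_pmf.prob (edge_bits n (p n)) {f. \<not> (P n (edges_of n f) \<and> R n (edges_of n f))}
      \<le> measure_pmf.prob (gnp n (p n)) {E. \<not> P n E} + measure_pmf.prob (gnp n (p n)) {E. \<not> R n E}"
      unfolding prob_gnp by (intro always_eventually allI) (simp add: measure_Un_le)
  qed
qed

lemma aas_mono:
  assumes "aas p P" "\<forall>\<^sub>F n in sequentially. \<forall>E. P n E \<longrightarrow> R n E"
  shows "aas p R"
  unfolding aas_def
proof (rule tendsto_sandwich[OF _ _ assms(1)[unfolded aas_def] tendsto_const])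
  show "\<forall>\<^sub>F n in sequentially. measure_pmf.prob (gnp n (p n)) {E. P n E} \<le> measure_pmf.prob (gnp n (p n)) {E. R n E}"
    using assms(2) by eventually_elim (auto intro: measure_pmf.finite_measure_mono)
qed auto

text \<open>Take for \<open>\<delta> n\<close> slightly more than the infimum of all \<open>x\<close> for which \<open>P x n\<close> fails with probability
  at most \<open>x\<close>.\<close>

lemma aas_diagonal:
  fixes P :: "real \<Rightarrow> nat \<Rightarrow> nat set set \<Rightarrow> bool"
  assumes aas: "\<And>x. 0 < x \<Longrightarrow> aas p (P x)"
    and mono: "\<And>x y n E. 0 < x \<Longrightarrow> x \<le> y \<Longrightarrow> P x n E \<Longrightarrow> P y n E"
  shows "\<exists>\<delta>. \<delta> \<longlonglongrightarrow> 0 \<and> aas p (\<lambda>n. P (\<delta> n) n)"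
proof -
  define b where "b = (\<lambda>x n. 1 - measure_pmf.prob (gnp n (p n)) {E. P x n E})"
  have b0: "0 \<le> b x n" "b x n \<le> 1" for x n unfolding b_def by auto
  have bmono: "b y n \<le> b x n" if "0 < x" "x \<le> y" for x y n
    unfolding b_def using mono[OF that] by (intro diff_left_mono measure_pmf.finite_measure_mono) auto
  have blim: "(\<lambda>n. b x n) \<longlonglongrightarrow> 0" if "0 < x" for x
    unfolding b_def using tendsto_diff[OF tendsto_const aas[OF that, unfolded aas_def], of 1] by simp
  define X where "X = (\<lambda>n. {x. 0 < x \<and> b x n \<le> x})"
  have X1: "1 \<in> X n" for n unfolding X_def using b0 by simp
  have bdd: "bdd_below (X n)" for n unfolding X_def by (rule bdd_belowI[of _ 0]) auto
  define h where "h = (\<lambda>n. Inf (X n))"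
  have h0: "0 \<le> h n" for n unfolding h_def
  proof (rule cInf_greatest)
    show "X n \<noteq> {}" using X1 by blast
  qed (auto simp: X_def)
  have hlim: "h \<longlonglongrightarrow> 0"
  proof (rule LIMSEQ_I)
    fix x :: real assume x: "0 < x"
    then have "\<forall>\<^sub>F n in sequentially. b (x / 2) n < x / 2" using order_tendstoD(2)[OF blim[of "x / 2"], of "x / 2"] by simp
    then obtain N where N: "\<And>n. n \<ge> N \<Longrightarrow> b (x / 2) n < x / 2" unfolding eventually_sequentially by blast
    have "h n < x" if "n \<ge> N" for n
    proof -
      have "x / 2 \<in> X n" unfolding X_def using N[OF that] x by simp
      then have "h n \<le> x / 2" unfolding h_def by (rule cInf_lower[OF _ bdd])
      then show ?thesis using x by simp
    qed
    then show "\<exists>N. \<forall>n\<ge>N. norm (h n - 0) < x" using h0 by (intro exI[of _ N]) simp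
  qed
  define \<delta> where "\<delta> = (\<lambda>n. h n + 1 / (real n + 1))"
  have \<delta>lim: "\<delta> \<longlonglongrightarrow> 0"
  proof -
    have "(\<lambda>n. 1 / (real n + 1)) \<longlonglongrightarrow> 0" by real_asymp
    from tendsto_add[OF hlim this] show ?thesis unfolding \<delta>_def by simp
  qed
  have b\<delta>: "b (\<delta> n) n \<le> \<delta> n" for n
  proof -
    have "h n < \<delta> n" unfolding \<delta>_def by simp
    moreover have "X n \<noteq> {}" using X1 by blast
    ultimately obtain x where x: "x \<in> X n" "x < \<delta> n" unfolding h_def by (meson cInf_lessD)
    then have x': "0 < x" "b x n \<le> x" unfolding X_def by blast+
    have "b (\<delta> n) n \<le> b x n" using x'(1) x(2) by (intro bmono) simp_all
    then show ?thesis using x(2) x'(2) by linarith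
  qed
  have "(\<lambda>n. b (\<delta> n) n) \<longlonglongrightarrow> 0"
    by (rule tendsto_sandwich[OF _ _ tendsto_const \<delta>lim]) (auto simp: b0 b\<delta>)
  from tendsto_diff[OF tendsto_const this, of 1] have "aas p (\<lambda>n. P (\<delta> n) n)"
    unfolding aas_def b_def by simp
  then show ?thesis using \<delta>lim by blast
qed

section \<open>Asymptotics\<close>

locale sparse_regime =
  fixes p d :: "nat \<Rightarrow> real" and i :: "nat \<Rightarrow> nat" and A :: real
  assumes prob: "\<And>n. 0 \<le> p n \<and> p n \<le> 1"
    and d_def: "\<And>n. d n = p n * real n"
    and d_lower: "(\<lambda>n. ln (real n) ^ 3) \<in> o(d)"
    and d_upper: "d \<in> o(\<lambda>n. real n)"
    and A_pos: "A > 0"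
    and c_lim: "(\<lambda>n. d n ^ i n / real n) \<longlonglongrightarrow> A"
begin

section \<open>The orders of magnitude of d and i\<close>

lemma d_nonneg: "0 \<le> d n" using prob[of n] d_def[of n] by simp

lemma ev_ln_ge: "\<forall>\<^sub>F n in sequentially. C \<le> ln (real n)"
  by real_asymp

lemma ev_d_ge: "\<forall>\<^sub>F n in sequentially. C * ln (real n) ^ 3 \<le> d n"
proof -
  define C' where "C' = max C 1"
  have "\<forall>\<^sub>F n in sequentially. norm (ln (real n) ^ 3) \<le> 1 / C' * norm (d n)"
    using landau_o.smallD[OF d_lower, of "1 / C'"] unfolding C'_def by simp
  then show ?thesis using ev_ln_ge[of 1]
  proof eventually_elim
    case (elim n)
    have C': "0 < C'" "C \<le> C'" unfolding C'_def by auto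
    have "C * ln (real n) ^ 3 \<le> C' * ln (real n) ^ 3" using C' elim by (intro mult_right_mono) auto
    also have "\<dots> \<le> d n" using elim C' d_nonneg[of n] by (simp add: field_simps)
    finally show ?case .
  qed
qed

lemma d_at_top: "filterlim d at_top sequentially"
proof (rule filterlim_at_top_mono)
  show "filterlim (\<lambda>n. ln (real n) ^ 3) at_top sequentially" by real_asymp
  show "\<forall>\<^sub>F n in sequentially. ln (real n) ^ 3 \<le> d n" using ev_d_ge[of 1] by simp
qed

lemma ev_d_ge_const: "\<forall>\<^sub>F n in sequentially. C \<le> d n"
  using d_at_top unfolding filterlim_at_top by blast

lemma p_lim: "p \<longlonglongrightarrow> 0"
proof (rule Lim_transform_eventually)
  show "(\<lambda>n. d n / real n) \<longlonglongrightarrow> 0" by (rule smalloD_tendsto[OF d_upper])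
  show "\<forall>\<^sub>F n in sequentially. d n / real n = p n"
    using eventually_gt_at_top[of 0] by eventually_elim (simp add: d_def)
qed

lemma ev_d_le: "\<forall>\<^sub>F n in sequentially. d n \<le> real n"
  by (intro always_eventually allI) (use prob in \<open>simp add: d_def mult_left_le_one_le\<close>)

text \<open>For \<open>i n = 0\<close> or \<open>i n = 1\<close> the quotient would be
  \<open>1 / n\<close> or \<open>d n / n\<close>, and both tend to 0 instead of \<open>A\<close>.
  This makes \<open>i n - 2\<close> a true subtraction and later gives
  \<open>d\<^sup>2 = O(n)\<close>.\<close>

lemma ev_i_ge: "\<forall>\<^sub>F n in sequentially. 2 \<le> i n"
proof -
  have "\<forall>\<^sub>F n in sequentially. A / 2 < d n ^ i n / real n"
    using order_tendstoD(1)[OF c_lim, of "A / 2"] A_pos by simp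
  moreover have "\<forall>\<^sub>F n in sequentially. 1 / real n < A / 2"
    using A_pos by real_asymp
  moreover have "\<forall>\<^sub>F n in sequentially. d n / real n < A / 2"
    using order_tendstoD(2)[OF smalloD_tendsto[OF d_upper], of "A / 2"] A_pos by simp
  ultimately show ?thesis
  proof eventually_elim
    case (elim n)
    have "i n \<noteq> 0" using elim by (metis less_asym power_0)
    moreover have "i n \<noteq> 1" using elim by (metis less_asym power_one_right)
    ultimately show ?case by linarith
  qed
qed

lemma ev_power_le: "\<forall>\<^sub>F n in sequentially. d n ^ i n \<le> 2 * A * real n"
proof -
  have "\<forall>\<^sub>F n in sequentially. d n ^ i n / real n < 2 * A"
    using order_tendstoD(2)[OF c_lim, of "2 * A"] A_pos by simp
  then show ?thesis using eventually_gt_at_top[of 0]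
    by eventually_elim (simp add: field_simps)
qed

lemma ev_i_ln_le: "\<forall>\<^sub>F n in sequentially. real (i n) * ln (d n) \<le> 2 * ln (real n)"
  using ev_power_le ev_d_ge_const[of 1] eventually_gt_at_top[of 0] ev_ln_ge[of "ln (2 * A)"]
proof eventually_elim
  case (elim n)
  have "real (i n) * ln (d n) = ln (d n ^ i n)" using elim by (simp add: ln_realpow)
  also have "\<dots> \<le> ln (2 * A * real n)" using elim A_pos by (subst ln_le_cancel_iff) auto
  also have "\<dots> = ln (2 * A) + ln (real n)" using elim A_pos by (subst ln_mult) auto
  finally show ?case using elim by simp
qed

definition e :: "nat \<Rightarrow> real" where "e n = 1 / ln (real n)"

text \<open>One step multiplies a ball by a factor between \<open>d * (1 - x)\<close> and
  \<open>d * (1 + x)\<close>. The term \<open>1 / d\<close> accounts for the old ball in the upper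
  bound and for the deleted vertex in the lower one.\<close>

definition x :: "nat \<Rightarrow> real" where "x n = e n + 1 / d n"

text \<open>There are at most \<open>2 * ln n / ln d\<close> steps, each with error at most
  \<open>2 / ln n\<close>, which multiplies to \<open>4 / ln d\<close>.\<close>

lemma ix_lim: "(\<lambda>n. real (i n) * x n) \<longlonglongrightarrow> 0"
proof (rule tendsto_sandwich[OF _ _ tendsto_const])
  have "filterlim (\<lambda>n. ln (d n)) at_top sequentially"
    by (rule filterlim_compose[OF ln_at_top d_at_top])
  then show "(\<lambda>n. 4 / ln (d n)) \<longlonglongrightarrow> 0"
    by (intro tendsto_divide_0[OF tendsto_const] filterlim_at_top_imp_at_infinity)
  show "\<forall>\<^sub>F n in sequentially. 0 \<le> real (i n) * x n"
    using ev_ln_ge[of 1] by eventually_elim (simp add: x_def e_def d_nonneg)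
  show "\<forall>\<^sub>F n in sequentially. real (i n) * x n \<le> 4 / ln (d n)"
    using ev_ln_ge[of 1] ev_d_ge[of 1] ev_i_ln_le ev_d_ge_const[of 3]
  proof eventually_elim
    case (elim n)
    let ?l = "ln (real n)"
    have "?l ^ 1 \<le> ?l ^ 3" using elim by (intro power_increasing) auto
    then have "?l \<le> d n" using elim by simp
    then have "1 / d n \<le> 1 / ?l" using elim by (intro divide_left_mono) auto
    then have "real (i n) * x n \<le> real (i n) * (2 / ?l)" unfolding x_def e_def by (intro mult_left_mono) auto
    also have "\<dots> \<le> 4 / ln (d n)"
    proof -
      have "0 < ln (d n)" using elim by (intro ln_gt_zero) simp
      then show ?thesis using elim by (simp add: field_simps)
    qed
    finally show ?case .
  qed
qed

text \<open>\<open>hi\<close>, \<open>hi1\<close> and \<open>lo\<close> are the values of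
  \<open>H2\<close>, \<open>H1\<close> and \<open>L\<close> for the exploration with
  \<open>r = i n - 2\<close>.\<close>

definition hi :: "nat \<Rightarrow> real" where "hi n = (1 + (1 + e n) * (p n * real n)) ^ Suc (i n - 2)"
definition hi1 :: "nat \<Rightarrow> real" where "hi1 n = (1 + (1 + e n) * (p n * real n)) ^ (i n - 2)"
definition lo :: "nat \<Rightarrow> real" where "lo n = ((1 - e n) * (p n * real n) - 1) ^ Suc (i n - 2)"

lemma ev_x: "\<forall>\<^sub>F n in sequentially. 0 \<le> x n \<and> real (i n) * x n \<le> 1 / 2 \<and> x n \<le> 1 / 2"
proof -
  have "\<forall>\<^sub>F n in sequentially. real (i n) * x n < 1 / 2"
    using order_tendstoD(2)[OF ix_lim, of "1 / 2"] by simp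
  then show ?thesis using ev_ln_ge[of 1] ev_i_ge
  proof eventually_elim
    case (elim n)
    have x0: "0 \<le> x n" using elim by (simp add: x_def e_def d_nonneg)
    have "1 * x n \<le> real (i n) * x n" using elim x0 by (intro mult_right_mono) auto
    then show ?case using elim x0 by simp
  qed
qed

text \<open>\<open>p n * d n ^ (i n - 1) = d n ^ i n / n\<close> tends to \<open>A\<close>, and the
  errors of the \<open>i n - 1\<close> steps multiply to a factor tending to 1. So the expected
  number of neighbours of a fresh vertex in a cell is about \<open>A\<close>.\<close>

lemma p_hi_lim: "(\<lambda>n. p n * hi n) \<longlonglongrightarrow> A"
proof (rule Lim_transform_eventually)
  have "(\<lambda>n. (1 + x n) ^ (i n - 1)) \<longlonglongrightarrow> 1"
  proof (rule tendsto_sandwich[OF _ _ tendsto_const])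
    show "(\<lambda>n. exp (real (i n) * x n)) \<longlonglongrightarrow> 1" using tendsto_exp[OF ix_lim] by simp
    show "\<forall>\<^sub>F n in sequentially. 1 \<le> (1 + x n) ^ (i n - 1)"
      using ev_x by eventually_elim (simp add: one_le_power)
    show "\<forall>\<^sub>F n in sequentially. (1 + x n) ^ (i n - 1) \<le> exp (real (i n) * x n)"
      using ev_x
    proof eventually_elim
      case (elim n)
      have "(1 + x n) ^ (i n - 1) \<le> (1 + x n) ^ i n" using elim by (intro power_increasing) auto
      also have "\<dots> \<le> exp (x n) ^ i n" using elim exp_ge_add_one_self[of "x n"] by (intro power_mono) auto
      finally show ?case by (simp add: exp_of_nat_mult)
    qed
  qed
  from tendsto_mult[OF c_lim this]
  show "(\<lambda>n. d n ^ i n / real n * (1 + x n) ^ (i n - 1)) \<longlonglongrightarrow> A" by simp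
  show "\<forall>\<^sub>F n in sequentially. d n ^ i n / real n * (1 + x n) ^ (i n - 1) = p n * hi n"
    using ev_d_ge_const[of 1] ev_i_ge eventually_gt_at_top[of 0]
  proof eventually_elim
    case (elim n)
    have "1 + (1 + e n) * d n = d n * (1 + x n)" unfolding x_def using elim by (simp add: algebra_simps)
    moreover have j: "i n = Suc (i n - 1)" "Suc (i n - 2) = i n - 1" using elim by auto
    ultimately have "hi n = d n ^ (i n - 1) * (1 + x n) ^ (i n - 1)"
      unfolding hi_def d_def[symmetric] by (simp add: power_mult_distrib)
    moreover have "p n * d n ^ (i n - 1) = d n ^ i n / real n"
    proof -
      have "d n ^ i n = d n * d n ^ (i n - 1)" using j(1) by (metis power_Suc)
      moreover have "d n / real n = p n" using elim unfolding d_def by simp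
      ultimately show ?thesis by (metis times_divide_eq_left)
    qed
    ultimately show ?case by (metis mult.assoc)
  qed
qed

lemma p_lo_lim: "(\<lambda>n. p n * lo n) \<longlonglongrightarrow> A"
proof (rule Lim_transform_eventually)
  have "(\<lambda>n. (1 - x n) ^ (i n - 1)) \<longlonglongrightarrow> 1"
  proof (rule tendsto_sandwich[OF _ _ _ tendsto_const])
    show "(\<lambda>n. 1 - real (i n) * x n) \<longlonglongrightarrow> 1" using tendsto_diff[OF tendsto_const ix_lim, of 1] by simp
    show "\<forall>\<^sub>F n in sequentially. (1 - x n) ^ (i n - 1) \<le> 1"
      using ev_x by eventually_elim (simp add: power_le_one)
    show "\<forall>\<^sub>F n in sequentially. 1 - real (i n) * x n \<le> (1 - x n) ^ (i n - 1)"
      using ev_x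
    proof eventually_elim
      case (elim n)
      have "1 - real (i n) * x n \<le> (1 - x n) ^ i n"
        using Bernoulli_inequality[of "- x n" "i n"] elim by simp
      also have "\<dots> \<le> (1 - x n) ^ (i n - 1)" using elim by (intro power_decreasing) auto
      finally show ?case .
    qed
  qed
  from tendsto_mult[OF c_lim this]
  show "(\<lambda>n. d n ^ i n / real n * (1 - x n) ^ (i n - 1)) \<longlonglongrightarrow> A" by simp
  show "\<forall>\<^sub>F n in sequentially. d n ^ i n / real n * (1 - x n) ^ (i n - 1) = p n * lo n"
    using ev_d_ge_const[of 1] ev_i_ge eventually_gt_at_top[of 0]
  proof eventually_elim
    case (elim n)
    have "(1 - e n) * d n - 1 = d n * (1 - x n)" unfolding x_def using elim by (simp add: algebra_simps)
    moreover have j: "i n = Suc (i n - 1)" "Suc (i n - 2) = i n - 1" using elim by auto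
    ultimately have "lo n = d n ^ (i n - 1) * (1 - x n) ^ (i n - 1)"
      unfolding lo_def d_def[symmetric] by (simp add: power_mult_distrib)
    moreover have "p n * d n ^ (i n - 1) = d n ^ i n / real n"
    proof -
      have "d n ^ i n = d n * d n ^ (i n - 1)" using j(1) by (metis power_Suc)
      moreover have "d n / real n = p n" using elim unfolding d_def by simp
      ultimately show ?thesis by (metis times_divide_eq_left)
    qed
    ultimately show ?case by (metis mult.assoc)
  qed
qed

lemma ev_hi1_le: "\<forall>\<^sub>F n in sequentially. 0 \<le> hi1 n \<and> hi1 n \<le> hi n / d n"
  using ev_d_ge_const[of 1] ev_ln_ge[of 1]
proof eventually_elim
  case (elim n)
  define b where "b = 1 + (1 + e n) * (p n * real n)"
  have "0 \<le> e n" using elim unfolding e_def by simp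
  then have b: "d n \<le> b" unfolding b_def d_def[symmetric] using elim by (simp add: algebra_simps)
  have "hi1 n * d n \<le> hi n"
    unfolding hi1_def hi_def b_def[symmetric] power_Suc mult.commute[of b] using b elim by (intro mult_left_mono) auto
  moreover have "0 \<le> hi1 n" unfolding hi1_def b_def[symmetric] using b elim by simp
  ultimately show ?case using elim by (simp add: field_simps)
qed

lemma p_hi1_lim: "(\<lambda>n. p n * hi1 n) \<longlonglongrightarrow> 0"
proof (rule tendsto_sandwich[OF _ _ tendsto_const])
  show "(\<lambda>n. p n * hi n / d n) \<longlonglongrightarrow> 0"
    by (rule real_tendsto_divide_at_top[OF p_hi_lim d_at_top])
  show "\<forall>\<^sub>F n in sequentially. 0 \<le> p n * hi1 n" using ev_hi1_le by eventually_elim (use prob in simp)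
  show "\<forall>\<^sub>F n in sequentially. p n * hi1 n \<le> p n * hi n / d n"
    using ev_hi1_le by eventually_elim (use prob mult_left_mono in fastforce)
qed

text \<open>The lower bound considers sets of at most \<open>ln d / A \<le> ln n / A\<close>
  sensors; the summand 2 makes room for the pair of centres in the upper bound.\<close>

definition K :: "nat \<Rightarrow> nat" where "K n = nat \<lfloor>ln (real n) / A\<rfloor> + 2"
definition m :: "nat \<Rightarrow> real" where "m n = e n * real n / (2 * (1 + d n))"

text \<open>\<open>K * hi\<close> is at most of order \<open>n * ln n / d\<close>, hence below any
  fixed fraction of \<open>n\<close>. \<open>K * hi1\<close> is smaller by another factor
  \<open>d\<close>, which puts it below \<open>m\<close> once \<open>d\<close> exceeds a multiple of
  \<open>(ln n)\<^sup>2\<close>.\<close>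

lemma ev_exploration:
  assumes \<tau>: "0 < \<tau>" "\<tau> \<le> 1 / 2"
  shows "\<forall>\<^sub>F n in sequentially. exploration n (i n - 2) (K n) (p n) (e n) (m n) \<tau>"
proof -
  have "\<forall>\<^sub>F n in sequentially. p n < 1 / 2" using order_tendstoD(2)[OF p_lim, of "1 / 2"] by simp
  moreover have "\<forall>\<^sub>F n in sequentially. p n * hi n < 2 * A"
    using order_tendstoD(2)[OF p_hi_lim, of "2 * A"] A_pos by simp
  moreover have "\<forall>\<^sub>F n in sequentially. 2 / \<tau> \<le> real n" by real_asymp
  ultimately show ?thesis
    using ev_ln_ge[of 2] ev_d_ge_const[of 4] ev_d_ge[of "2 * (2 + 4 * A) / \<tau>"] ev_d_ge[of "4 * (2 + 4 * A)"]
      ev_hi1_le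
  proof eventually_elim
    case (elim n)
    let ?l = "ln (real n)"
    have e: "0 \<le> e n" "e n \<le> 1 / 2" using elim unfolding e_def by (auto simp: divide_simps)
    have dn: "0 < d n" using elim by simp
    have n: "0 < real n" using dn unfolding d_def by (metis mult_zero_right not_less_iff_gr_or_eq of_nat_0_le_iff order_le_less)
    have hi: "hi n \<le> 2 * A * real n / d n"
    proof -
      have "d n * hi n = real n * (p n * hi n)" unfolding d_def by simp
      also have "\<dots> \<le> real n * (2 * A)" using elim n by (intro mult_left_mono) auto
      finally show ?thesis using dn by (simp add: field_simps)
    qed
    have K: "real (K n) \<le> ?l / A + 2" unfolding K_def using elim A_pos by simp
    have K0: "0 \<le> real (K n)" by simp
    have KA: "real (K n) * (2 * A) \<le> (2 + 4 * A) * ?l"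
    proof -
      have "real (K n) * (2 * A) \<le> (?l / A + 2) * (2 * A)" using K A_pos by (intro mult_right_mono) auto
      also have "\<dots> = 2 * ?l + 4 * A" using A_pos by (simp add: field_simps)
      also have "\<dots> \<le> 2 * ?l + 4 * A * ?l" using elim A_pos by simp
      finally show ?thesis by (simp add: algebra_simps)
    qed
    have l13: "?l \<le> ?l ^ 3" "?l\<^sup>2 \<le> ?l ^ 3"
      using power_increasing[of 1 3 ?l] power_increasing[of 2 3 ?l] elim by simp_all
    have Khi: "real (K n) * hi n \<le> (2 + 4 * A) * ?l * real n / d n"
    proof -
      have "real (K n) * hi n \<le> real (K n) * (2 * A * real n / d n)" using hi K0 by (rule mult_left_mono)
      also have "\<dots> = (real (K n) * (2 * A)) * (real n / d n)" by simp
      also have "\<dots> \<le> ((2 + 4 * A) * ?l) * (real n / d n)" using KA dn by (intro mult_right_mono) auto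
      finally show ?thesis by simp
    qed
    show ?case
    proof (unfold_locales)
      show "0 \<le> p n" "p n \<le> 1 / 2" using prob[of n] elim by auto
      have "1 \<le> (1 - e n) * d n" using mult_mono[of "1 / 2" "1 - e n" 2 "d n"] e elim by simp
      then show "0 \<le> (1 - e n) * (p n * real n) - 1" unfolding d_def by simp
      show "0 \<le> (1 + e n) * (p n * real n)" using e dn unfolding d_def[symmetric] by simp
      have "1 + (2 + 4 * A) * ?l * real n / d n \<le> \<tau> * real n"
      proof -
        have "(2 * (2 + 4 * A) / \<tau>) * ?l \<le> (2 * (2 + 4 * A) / \<tau>) * ?l ^ 3"
          using l13 \<tau> A_pos by (intro mult_left_mono) auto
        then have "(2 * (2 + 4 * A) / \<tau>) * ?l \<le> d n" using elim by linarith
        then have "(2 + 4 * A) * ?l \<le> \<tau> / 2 * d n" using \<tau> by (simp add: field_simps)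
        then have "(2 + 4 * A) * ?l / d n \<le> \<tau> / 2" using dn by (simp add: field_simps)
        from mult_right_mono[OF this, of "real n"] have "(2 + 4 * A) * ?l * real n / d n \<le> \<tau> / 2 * real n" by simp
        moreover have "1 \<le> \<tau> / 2 * real n" using elim \<tau> by (simp add: field_simps)
        ultimately show ?thesis by simp
      qed
      then show "1 + real (K n) * (1 + (1 + e n) * (p n * real n)) ^ Suc (i n - 2) \<le> \<tau> * real n"
        using Khi unfolding hi_def by linarith
      have "real (K n) * hi1 n \<le> real (K n) * (hi n / d n)" using elim K0 by (intro mult_left_mono) auto
      also have "\<dots> \<le> ((2 + 4 * A) * ?l * real n / d n) / d n"
        using divide_right_mono[OF Khi, of "d n"] dn by simp
      also have "\<dots> \<le> m n"
      proof -
        have "4 * (2 + 4 * A) * ?l\<^sup>2 \<le> 4 * (2 + 4 * A) * ?l ^ 3" using l13 A_pos by (intro mult_left_mono) auto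
        then have "4 * (2 + 4 * A) * ?l\<^sup>2 \<le> d n" using elim by linarith
        then have "(2 + 4 * A) * ?l / d n \<le> 1 / (4 * ?l)"
          using dn elim by (simp add: field_simps power2_eq_square)
        then have "(2 + 4 * A) * ?l / d n * (real n / d n) \<le> 1 / (4 * ?l) * (real n / d n)"
          using dn n by (intro mult_right_mono) auto
        also have "\<dots> = (1 / ?l) * real n / (4 * d n)" by simp
        also have "\<dots> \<le> (1 / ?l) * real n / (2 * (1 + d n))"
          using dn n elim by (intro divide_left_mono mult_pos_pos) auto
        finally show ?thesis unfolding m_def e_def by simp
      qed
      finally show "real (K n) * (1 + (1 + e n) * (p n * real n)) ^ (i n - 2) \<le> m n" unfolding hi1_def .
      show "2 \<le> K n" unfolding K_def by simp
      show "1 \<le> n" using n by simp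
    qed (use \<tau> in auto)
  qed
qed

lemma ev_expanding:
  "\<forall>\<^sub>F n in sequentially. measure_pmf.prob (edge_bits n (p n)) {f. \<not> expanding n (e n) (d n) (m n) (edges_of n f)} \<le> 3 / real n"
  using ev_ln_ge[of 1] ev_d_ge[of 48] eventually_ge_at_top[of 1]
proof eventually_elim
  case (elim n)
  let ?l = "ln (real n)"
  define \<eta> where "\<eta> = exp (- ((e n)\<^sup>2 * (p n * real n) / 16))"
  \<comment> \<open>Here the cube of the logarithm is used: with \<open>e n = 1 / ln n\<close> the
    exponent is \<open>d / (16 * (ln n)\<^sup>2)\<close>, which is at least \<open>3 * ln n\<close>
    for \<open>d \<ge> 48 * (ln n) ^ 3\<close>.\<close>
  have "3 * ?l \<le> (e n)\<^sup>2 * d n / 16"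
  proof -
    have "48 * ?l * ?l\<^sup>2 \<le> d n" using elim by (simp add: power2_eq_square power3_eq_cube mult_ac)
    moreover have l0: "0 < ?l" using elim(1) by linarith
    have "0 < 16 * ?l\<^sup>2" by (rule mult_pos_pos[OF _ zero_less_power[OF l0]]) simp
    then have "3 * ?l \<le> d n / (16 * ?l\<^sup>2) \<longleftrightarrow> 3 * ?l * (16 * ?l\<^sup>2) \<le> d n" by (rule pos_le_divide_eq)
    ultimately have "3 * ?l \<le> d n / (16 * ?l\<^sup>2)" by (simp add: mult_ac)
    then show ?thesis unfolding e_def by (simp add: power_divide mult.commute)
  qed
  then have "\<eta> \<le> exp (- (3 * ?l))" unfolding \<eta>_def d_def by simp
  also have "\<dots> = 1 / real n ^ 3"
    using elim by (simp add: exp_minus exp_of_nat_mult[of 3, simplified] inverse_eq_divide)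
  finally have \<eta>: "\<eta> \<le> 1 / real n ^ 3" .
  have n\<eta>: "real n * \<eta> \<le> 1 / real n ^ 2"
    using mult_left_mono[OF \<eta>, of "real n"] elim by (simp add: power2_eq_square power3_eq_cube)
  have n2: "1 / real n ^ 2 \<le> 1 / real n" "1 / real n \<le> 1" using elim by (auto simp: field_simps power2_eq_square)
  have l0: "0 < ?l" using elim(1) by linarith
  have "0 < e n" unfolding e_def by (rule divide_pos_pos[OF zero_less_one l0])
  moreover have "e n \<le> 1" unfolding e_def using elim(1) pos_divide_le_eq[OF l0, of 1 1] by linarith
  moreover have "real n * \<eta> \<le> 1" using n\<eta> n2 by linarith
  ultimately have "measure_pmf.prob (edge_bits n (p n)) {f. \<not> expanding n (e n) (p n * real n)
      (e n * real n / (2 * (1 + p n * real n))) (edges_of n f)} \<le> 3 * real n * \<eta>"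
    using prob_not_expanding_le[of "p n" "e n" n] prob[of n] elim unfolding \<eta>_def by simp
  also have "\<dots> \<le> 3 * (1 / real n)" using n\<eta> n2 by linarith
  finally show ?case unfolding m_def d_def by simp
qed

lemma ev_power_ge:
  assumes "b < exp (- A)"
  shows "\<forall>\<^sub>F n in sequentially. \<forall>k. real k \<le> hi n \<longrightarrow> b \<le> (1 - p n) ^ k"
proof -
  have "(\<lambda>n. exp (- ((1 + 2 * p n) * (p n * hi n)))) \<longlonglongrightarrow> exp (- ((1 + 2 * 0) * A))"
    by (intro tendsto_intros p_lim p_hi_lim)
  then have "\<forall>\<^sub>F n in sequentially. b < exp (- ((1 + 2 * p n) * (p n * hi n)))"
    using assms by (intro order_tendstoD(1)) auto
  moreover have "\<forall>\<^sub>F n in sequentially. p n < 1 / 2" using order_tendstoD(2)[OF p_lim, of "1 / 2"] by simp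
  ultimately show ?thesis
  proof eventually_elim
    case (elim n)
    show ?case
    proof (intro allI impI)
      fix k assume k: "real k \<le> hi n"
      have "b \<le> exp (- ((p n + 2 * (p n)\<^sup>2) * hi n))" using elim by (simp add: algebra_simps power2_eq_square)
      also have "\<dots> \<le> exp (- (p n + 2 * (p n)\<^sup>2) * real k)" using k prob[of n]
        by (simp only: exp_le_cancel_iff minus_mult_left[symmetric] neg_le_iff_le) (intro mult_left_mono, auto)
      also have "\<dots> \<le> (1 - p n) ^ k" using power_one_minus_ge[of "p n" k] prob[of n] elim by simp
      finally show "b \<le> (1 - p n) ^ k" .
    qed
  qed
qed

text \<open>\<open>c\<close> is the number of cells to be missed: 1 for the diameter, 2 for a pair
  to be separated. Subtracting \<open>hi1\<close> discounts the core.\<close>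

lemma ev_power_le_exp:
  assumes "exp (- (c * A)) < b" "0 \<le> c"
  shows "\<forall>\<^sub>F n in sequentially. \<forall>k. c * (lo n - hi1 n) \<le> real k \<longrightarrow> (1 - p n) ^ k \<le> b"
proof -
  have "(\<lambda>n. exp (- (c * (p n * lo n - p n * hi1 n)))) \<longlonglongrightarrow> exp (- (c * (A - 0)))"
    by (intro tendsto_intros p_lo_lim p_hi1_lim)
  then have "\<forall>\<^sub>F n in sequentially. exp (- (c * (p n * lo n - p n * hi1 n))) < b"
    using assms by (intro order_tendstoD(2)) auto
  then show ?thesis
  proof eventually_elim
    case (elim n)
    show ?case
    proof (intro allI impI)
      fix k assume k: "c * (lo n - hi1 n) \<le> real k"
      have "(1 - p n) ^ k \<le> exp (- p n) ^ k"
        using prob[of n] exp_ge_add_one_self[of "- p n"] by (intro power_mono) auto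
      also have "\<dots> = exp (- (p n * real k))" by (simp add: exp_of_nat_mult[symmetric] mult.commute)
      also have "\<dots> \<le> exp (- (c * (p n * lo n - p n * hi1 n)))"
        using mult_left_mono[OF k, of "p n"] prob[of n] by (simp add: algebra_simps)
      also have "\<dots> \<le> b" using elim by simp
      finally show "(1 - p n) ^ k \<le> b" .
    qed
  qed
qed

section \<open>The upper bound for a fixed relative error\<close>

lemma aas_upper:
  assumes \<delta>: "0 < \<delta>"
  shows "aas p (\<lambda>n E. zeta_gnp n E \<le> (1 + \<delta>) * (ln (d n) + 2 * ln (ln (real n))) * (exp A / (1 - exp (- A))))"
proof -
  define a0 where "a0 = exp (- A)"
  have a0: "0 < a0" "a0 < 1" using A_pos unfolding a0_def by auto
  \<comment> \<open>\<open>2 * Q\<close> is the limiting proportion of sensors that separate two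
    given vertices.\<close>
  define Q where "Q = a0 * (1 - a0)"
  have Q: "0 < Q" "Q \<le> 1 / 4"
  proof -
    show "0 < Q" unfolding Q_def using a0 by simp
    have "Q = 1 / 4 - (a0 - 1 / 2)\<^sup>2" unfolding Q_def by (simp add: power2_eq_square algebra_simps)
    then show "Q \<le> 1 / 4" by simp
  qed
  have invQ: "exp A / (1 - exp (- A)) = 1 / Q"
    unfolding Q_def a0_def by (simp add: exp_minus field_simps)
  \<comment> \<open>The 7 collects the errors: \<open>\<tau>\<close> in each of \<open>a\<close> and
    \<open>b\<close>, which enter with a factor 2, and \<open>3 * \<tau>\<close> from the deviation.
    The value of \<open>\<tau>\<close> makes
    \<open>\<kappa> * ((1 + \<delta>) / Q) = 2 + \<delta>\<close>, so that
    \<open>\<kappa> * k\<close> is about \<open>(2 + \<delta>) * M\<close>.\<close>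
  define \<tau> where "\<tau> = \<delta> * Q / (7 * (1 + \<delta>))"
  define \<kappa> where "\<kappa> = 2 * Q - 7 * \<tau>"
  have \<tau>Q: "7 * \<tau> \<le> Q" "0 < \<tau>" unfolding \<tau>_def using \<delta> Q by (auto simp: field_simps)
  have \<tau>: "0 < \<tau>" "\<tau> \<le> 1 / 2" using \<tau>Q Q by auto
  have \<kappa>: "0 < \<kappa>" "\<kappa> \<le> 1 / 2" unfolding \<kappa>_def using \<tau>Q Q by auto
  have \<kappa>\<delta>: "\<kappa> * ((1 + \<delta>) / Q) = 2 + \<delta>"
  proof -
    have "7 * \<tau> = \<delta> * Q / (1 + \<delta>)" unfolding \<tau>_def using \<delta> by (simp add: field_simps)
    then have "\<kappa> * ((1 + \<delta>) / Q) = 2 * Q * ((1 + \<delta>) / Q) - \<delta> * Q / (1 + \<delta>) * ((1 + \<delta>) / Q)"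
      unfolding \<kappa>_def by (simp only: left_diff_distrib)
    also have "2 * Q * ((1 + \<delta>) / Q) = 2 * (1 + \<delta>)" using Q by simp
    also have "\<delta> * Q / (1 + \<delta>) * ((1 + \<delta>) / Q) = \<delta>" using Q \<delta> by simp
    finally show ?thesis by simp
  qed
  define M where "M = (\<lambda>n. ln (d n) + 2 * ln (ln (real n)))"
  define k where "k = (\<lambda>n. nat \<lfloor>(1 + \<delta>) * M n / Q\<rfloor>)"
  have ea: "exp (- (2 * A)) = a0\<^sup>2" unfolding a0_def by (simp add: power2_eq_square mult_exp_exp)
  have ev_ln: "\<forall>\<^sub>F n in sequentially. (1 + \<delta>) / Q * (3 * ln (real n)) \<le> real n"
    using \<delta> Q by real_asymp
  have good: "\<forall>\<^sub>F n in sequentially. \<forall>f. expanding n (e n) (d n) (m n) (edges_of n f) \<longrightarrow>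
      (\<forall>u\<in>{1..n}. \<forall>u'\<in>{1..n}. u \<noteq> u' \<longrightarrow>
        \<kappa> * n \<le> card {z\<in>{1..n}. gdist (edges_of n f) u z \<noteq> gdist (edges_of n f) u' z}) \<longrightarrow>
      zeta_gnp n (edges_of n f) \<le> (1 + \<delta>) * M n * (1 / Q)"
    using ev_ln_ge[of 4] ev_d_ge_const[of 1] ev_d_le ev_ln
  proof eventually_elim
    case (elim n)
    let ?l = "ln (real n)"
    have l0: "0 < ?l" "1 \<le> ?l" using elim(1) by linarith+
    have lnd: "0 \<le> ln (d n)" "ln (d n) \<le> ?l" using elim by auto
    have lnl: "0 \<le> ln ?l" "ln ?l \<le> ?l" using l0 ln_le_minus_one[of ?l] by auto
    have M: "0 \<le> M n" "M n \<le> 3 * ?l" using lnd lnl unfolding M_def by auto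
    have k: "real (k n) \<le> (1 + \<delta>) * M n / Q" "(1 + \<delta>) * M n / Q - 1 \<le> real (k n)"
      unfolding k_def using M \<delta> Q by (auto simp: of_nat_nat)
    have "(1 + \<delta>) * M n / Q \<le> (1 + \<delta>) / Q * (3 * ?l)"
      using mult_left_mono[OF M(2), of "(1 + \<delta>) / Q"] \<delta> Q by simp
    then have kn: "k n \<le> n" using k(1) elim by linarith
    have "2 * M n - 1 \<le> \<kappa> * real (k n)"
    proof -
      have "2 * M n - 1 \<le> (2 + \<delta>) * M n - \<kappa>" 
      proof -
        have "0 \<le> \<delta> * M n" using M(1) \<delta> by simp
        then show ?thesis using \<kappa> unfolding distrib_right by linarith
      qed
      also have "\<dots> = \<kappa> * ((1 + \<delta>) * M n / Q - 1)" 
      proof -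
        have "\<kappa> * ((1 + \<delta>) * M n / Q - 1) = \<kappa> * ((1 + \<delta>) / Q) * M n - \<kappa>" by (simp add: right_diff_distrib)
        then show ?thesis unfolding \<kappa>\<delta> by simp
      qed
      also have "\<dots> \<le> \<kappa> * real (k n)" using k \<kappa> by (intro mult_left_mono) auto
      finally show ?thesis .
    qed
    have "(1 - \<kappa>) ^ k n \<le> exp (- \<kappa>) ^ k n"
      using \<kappa> exp_ge_add_one_self[of "- \<kappa>"] by (intro power_mono) auto
    also have "\<dots> = exp (- (\<kappa> * real (k n)))" by (simp add: exp_of_nat_mult[symmetric] mult.commute)
    also have "\<dots> \<le> exp (1 - 2 * M n)" using \<open>2 * M n - 1 \<le> \<kappa> * real (k n)\<close> by simp
    also have "\<dots> = exp 1 / (d n ^ 2 * ?l ^ 4)"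
    proof -
      have "exp (2 * M n) = exp (ln (d n)) ^ 2 * exp (ln ?l) ^ 4"
        unfolding M_def exp_of_nat_mult[symmetric] mult_exp_exp by (simp add: algebra_simps)
      then show ?thesis using l0 elim by (simp add: exp_diff)
    qed
    also have "\<dots> \<le> 3 / (d n ^ 2 * ?l ^ 4)"
      using exp_le l0 elim by (intro divide_right_mono) auto
    finally have pw: "(1 - \<kappa>) ^ k n \<le> 3 / (d n ^ 2 * ?l ^ 4)" .
    have e: "0 \<le> e n" "e n \<le> 1" unfolding e_def using l0 by (auto simp: pos_divide_le_eq[OF l0(1)])
    have "1 + (1 + e n) * d n \<le> 3 * d n"
    proof -
      have "e n * d n \<le> 1 * d n" using e(2) elim(2) by (intro mult_right_mono) auto
      then show ?thesis using elim(2) unfolding distrib_right by linarith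
    qed
    then have "(1 + (1 + e n) * d n)\<^sup>2 \<le> (3 * d n)\<^sup>2" using e elim by (intro power_mono) auto
    then have "(1 + (1 + e n) * d n)\<^sup>2 * (1 - \<kappa>) ^ k n \<le> (3 * d n)\<^sup>2 * (3 / (d n ^ 2 * ?l ^ 4))"
      using pw \<kappa> by (intro mult_mono) auto
    \<comment> \<open>The powers of \<open>d\<close> cancel, and the summand
      \<open>2 * ln (ln n)\<close> of \<open>M\<close> has left \<open>ln n ^ 4\<close>, which for
      \<open>ln n \<ge> 4\<close> outweighs the constant 27.\<close>
    also have "\<dots> = 27 / ?l ^ 4" using elim by (simp add: power_mult_distrib field_simps)
    also have "\<dots> \<le> 27 / 4 ^ 4" using elim by (intro divide_left_mono power_mono) auto
    finally have small: "(1 + (1 + e n) * d n)\<^sup>2 * (1 - \<kappa>) ^ k n \<le> 1 / 4" by simp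
    show ?case
    proof (intro allI impI)
      fix f assume ex: "expanding n (e n) (d n) (m n) (edges_of n f)"
        and sep: "\<forall>u\<in>{1..n}. \<forall>u'\<in>{1..n}. u \<noteq> u' \<longrightarrow>
        \<kappa> * n \<le> card {z\<in>{1..n}. gdist (edges_of n f) u z \<noteq> gdist (edges_of n f) u' z}"
      have "cops_can_win {1..n} (edges_of n f) (k n)"
        by (rule cops_can_win_if_separated[OF edges_of_subset ex kn _ _ small]) (use \<kappa> sep in auto)
      from localization_number_le[OF this] show "zeta_gnp n (edges_of n f) \<le> (1 + \<delta>) * M n * (1 / Q)"
        using k(1) by simp
    qed
  qed
  have "\<forall>\<^sub>F n in sequentially. \<forall>k. real k \<le> hi n \<longrightarrow> a0 - \<tau> \<le> (1 - p n) ^ k"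
    using \<tau> by (intro ev_power_ge) (simp add: a0_def)
  moreover have "\<forall>\<^sub>F n in sequentially. \<forall>k. 2 * (lo n - hi1 n) \<le> real k \<longrightarrow> (1 - p n) ^ k \<le> a0\<^sup>2 + \<tau>"
    using \<tau> by (intro ev_power_le_exp) (simp_all add: ea)
  ultimately have "\<forall>\<^sub>F n in sequentially. measure_pmf.prob (edge_bits n (p n))
      {f. \<not> zeta_gnp n (edges_of n f) \<le> (1 + \<delta>) * M n * (1 / Q)} \<le> 3 / real n + real n ^ 2 * exp (- (\<tau>\<^sup>2 * n))"
    using good ev_expanding ev_exploration[OF \<tau>] eventually_ge_at_top[of 1]
  proof eventually_elim
    case (elim n)
    interpret X: exploration n "i n - 2" "K n" "p n" "e n" "m n" \<tau> by (rule elim(5))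
    have X: "X.d = d n" "X.H2 = hi n" "X.H1 = hi1 n" "X.L = lo n"
      unfolding X.d_def X.H1_def X.H2_def X.L_def d_def hi_def hi1_def lo_def by simp_all
    let ?M = "edge_bits n (p n)"
    let ?R = "\<lambda>u u' f. real (card {z\<in>{1..n}. gdist (edges_of n f) u z \<noteq> gdist (edges_of n f) u' z}) < \<kappa> * n"
    let ?G = "\<lambda>f. expanding n (e n) (d n) (m n) (edges_of n f)"
    have \<kappa>': "\<kappa> = 2 * (a0 - \<tau>) - 2 * (a0\<^sup>2 + \<tau>) - 3 * \<tau>"
      unfolding \<kappa>_def Q_def by (simp add: power2_eq_square algebra_simps)
    have ab: "a0\<^sup>2 + \<tau> \<le> a0 - \<tau>" using \<tau>Q unfolding Q_def by (simp add: power2_eq_square algebra_simps)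
    have pair: "measure_pmf.prob ?M {f. ?G f \<and> ?R u u' f} \<le> exp (- (\<tau>\<^sup>2 * n))"
      if "u \<in> {1..n}" "u' \<in> {1..n}" "u \<noteq> u'" for u u'
      using X.prob_not_separated_le[OF that, of "a0 - \<tau>" "a0\<^sup>2 + \<tau>"] elim(1,2) ab unfolding X \<kappa>' by blast
    have "{f. \<not> zeta_gnp n (edges_of n f) \<le> (1 + \<delta>) * M n * (1 / Q)}
        \<subseteq> {f. \<not> ?G f} \<union> {f. \<exists>z\<in>{1..n} \<times> {1..n}. fst z \<noteq> snd z \<and> ?G f \<and> ?R (fst z) (snd z) f}"
    proof (rule subsetI, rule ccontr)
      fix f assume f: "f \<in> {f. \<not> zeta_gnp n (edges_of n f) \<le> (1 + \<delta>) * M n * (1 / Q)}"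
        and nf: "f \<notin> {f. \<not> ?G f} \<union> {f. \<exists>z\<in>{1..n} \<times> {1..n}. fst z \<noteq> snd z \<and> ?G f \<and> ?R (fst z) (snd z) f}"
      have g: "?G f" using nf by blast
      have "\<not> ?R u u' f" if "u \<in> {1..n}" "u' \<in> {1..n}" "u \<noteq> u'" for u u'
      proof
        assume "?R u u' f"
        then have "\<exists>z\<in>{1..n} \<times> {1..n}. fst z \<noteq> snd z \<and> ?G f \<and> ?R (fst z) (snd z) f"
          using that g by (intro bexI[of _ "(u, u')"]) simp_all
        then show False using nf by blast
      qed
      then have "\<forall>u\<in>{1..n}. \<forall>u'\<in>{1..n}. u \<noteq> u' \<longrightarrow>
        \<kappa> * n \<le> card {z\<in>{1..n}. gdist (edges_of n f) u z \<noteq> gdist (edges_of n f) u' z}"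
        by (meson not_le)
      then show False using elim(3) g f by blast
    qed
    then have "measure_pmf.prob ?M {f. \<not> zeta_gnp n (edges_of n f) \<le> (1 + \<delta>) * M n * (1 / Q)}
        \<le> measure_pmf.prob ?M {f. \<not> ?G f}
          + measure_pmf.prob ?M {f. \<exists>z\<in>{1..n} \<times> {1..n}. fst z \<noteq> snd z \<and> ?G f \<and> ?R (fst z) (snd z) f}"
      by (rule order_trans[OF measure_pmf.finite_measure_mono measure_Un_le]) auto
    also have "\<dots> \<le> 3 / real n + real n ^ 2 * exp (- (\<tau>\<^sup>2 * n))"
      by (intro add_mono elim(4) prob_bad_pairs_le elim(6) pair) auto
    finally show ?case .
  qed
  moreover have "(\<lambda>n. 3 / real n + real n ^ 2 * exp (- (\<tau>\<^sup>2 * real n))) \<longlonglongrightarrow> 0"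
    using \<tau> by real_asymp
  ultimately have "aas p (\<lambda>n E. zeta_gnp n E \<le> (1 + \<delta>) * M n * (1 / Q))" by (rule aasI)
  then show ?thesis unfolding invQ M_def .
qed

section \<open>The lower bound\<close>

lemma aas_lower:
  "aas p (\<lambda>n E. (ln (d n) - 3 * ln (ln (real n))) * (1 / A) \<le> zeta_gnp n E)"
proof -
  define a0 where "a0 = exp (- A)"
  have a0: "0 < a0" "a0 < 1" using A_pos unfolding a0_def by auto
  \<comment> \<open>\<open>g\<close> is the squared distance from 1 to the midpoint of
    \<open>a0\<close> and 1. Above the midpoint \<open>y\<^sup>2\<close> alone is large enough,
    below it \<open>(1 - y)\<^sup>2 \<ge> g\<close>. So the agreement probability at one sensor
    exceeds \<open>a0\<^sup>2\<close> by at least \<open>g / 2\<close>, even for \<open>y\<close>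
    slightly below \<open>a0\<close>.\<close>
  define g where "g = ((1 - a0) / 2)\<^sup>2"
  have g: "0 < g" unfolding g_def using a0 by simp
  define \<gamma> where "\<gamma> = sqrt (a0\<^sup>2 + g / 2)"
  have \<gamma>2: "\<gamma>\<^sup>2 = a0\<^sup>2 + g / 2" unfolding \<gamma>_def using g by simp
  have \<gamma>a: "a0 < \<gamma>" unfolding \<gamma>_def using g a0 by (intro real_less_rsqrt) simp
  have gain: "\<gamma>\<^sup>2 \<le> y\<^sup>2 + (1 - y)\<^sup>2" if "a0 - g / 4 \<le> y" for y
  proof (cases "(1 + a0) / 2 \<le> y")
    case True
    then have "((1 + a0) / 2)\<^sup>2 \<le> y\<^sup>2" using a0 by (intro power_mono) auto
    moreover have "((1 + a0) / 2)\<^sup>2 = g + a0" unfolding g_def by (simp add: power2_eq_square field_simps)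
    moreover have "a0\<^sup>2 \<le> a0" using a0 unfolding power2_eq_square by (intro mult_left_le) auto
    moreover have "0 \<le> (1 - y)\<^sup>2" by simp
    ultimately show ?thesis using g unfolding \<gamma>2 by linarith
  next
    case False
    then have "g \<le> (1 - y)\<^sup>2" unfolding g_def using a0 by (intro power_mono) (auto simp: field_simps)
    moreover have "a0\<^sup>2 - g / 2 \<le> y\<^sup>2"
    proof -
      have "2 * a0 * (a0 - y) \<le> 2 * a0 * (g / 4)" using a0 that by (intro mult_left_mono) auto
      also have "\<dots> \<le> g / 2" using a0 g by (simp add: mult_left_le_one_le)
      finally have "2 * a0 * (a0 - y) \<le> g / 2" .
      moreover have "y\<^sup>2 = a0\<^sup>2 - 2 * a0 * (a0 - y) + (a0 - y)\<^sup>2" by (simp add: power2_eq_square algebra_simps)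
      ultimately show ?thesis by (smt (verit) zero_le_power2)
    qed
    ultimately show ?thesis unfolding \<gamma>2 by linarith
  qed
  \<comment> \<open>Chosen so that \<open>\<omega> * \<gamma>\<close> is exactly
    \<open>exp (- A)\<close>: the whole gain of \<open>\<gamma>\<close> over \<open>a0\<close> is
    spent on overlaps. As \<open>\<omega> < 1\<close> is fixed, an overlap of
    \<open>o(1 / p)\<close> vertices per sensor is affordable.\<close>
  define \<omega> where "\<omega> = a0 / \<gamma>"
  have \<omega>: "0 < \<omega>" "\<omega> < 1" "\<omega> * \<gamma> = a0" unfolding \<omega>_def using a0 \<gamma>a by auto
  define \<xi> where "\<xi> = - ln \<omega>"
  have \<xi>: "0 < \<xi>" "exp (- \<xi>) = \<omega>" unfolding \<xi>_def using \<omega> by auto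
  define b where "b = (1 + a0) / 2"
  have b: "a0 < b" "b < 1" unfolding b_def using a0 by auto
  define B where "B = (\<lambda>n. (ln (d n) - 3 * ln (ln (real n))) * (1 / A))"
  have ev_overlap: "\<forall>\<^sub>F n in sequentially. \<forall>k j. real k \<le> (hi n - lo n) * real j \<longrightarrow> \<omega> ^ j \<le> (1 - p n) ^ k"
  proof -
    have "(\<lambda>n. (1 + 2 * p n) * (p n * hi n - p n * lo n)) \<longlonglongrightarrow> (1 + 2 * 0) * (A - A)"
      by (intro tendsto_intros p_lim p_hi_lim p_lo_lim)
    then have "\<forall>\<^sub>F n in sequentially. (1 + 2 * p n) * (p n * hi n - p n * lo n) < \<xi>"
      using \<xi> by (intro order_tendstoD(2)) auto
    moreover have "\<forall>\<^sub>F n in sequentially. p n < 1 / 2" using order_tendstoD(2)[OF p_lim, of "1 / 2"] by simp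
    ultimately show ?thesis
    proof eventually_elim
      case (elim n)
      show ?case
      proof (intro allI impI)
        fix k j assume k: "real k \<le> (hi n - lo n) * real j"
        let ?c = "p n + 2 * (p n)\<^sup>2"
        have c: "0 \<le> ?c" using prob[of n] by simp
        have "?c * real k \<le> ?c * ((hi n - lo n) * real j)" using k c by (rule mult_left_mono)
        also have "\<dots> = ((1 + 2 * p n) * (p n * hi n - p n * lo n)) * real j"
          by (simp add: power2_eq_square algebra_simps)
        also have "\<dots> \<le> \<xi> * real j" using elim by (intro mult_right_mono) auto
        finally have "exp (- (\<xi> * real j)) \<le> exp (- ?c * real k)" by (simp add: algebra_simps)
        also have "\<dots> \<le> (1 - p n) ^ k" using power_one_minus_ge[of "p n" k] prob[of n] elim by simp
        also have "exp (- (\<xi> * real j)) = \<omega> ^ j"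
          unfolding \<xi>(2)[symmetric] by (simp add: exp_of_nat_mult[symmetric] mult.commute)
        finally show "\<omega> ^ j \<le> (1 - p n) ^ k" .
      qed
    qed
  qed
  have ev_a: "\<forall>\<^sub>F n in sequentially. \<forall>k. real k \<le> hi n \<longrightarrow> a0 - g / 4 \<le> (1 - p n) ^ k"
    using g by (intro ev_power_ge) (simp add: a0_def)
  have ev_b: "\<forall>\<^sub>F n in sequentially. \<forall>k. 1 * (lo n - hi1 n) \<le> real k \<longrightarrow> (1 - p n) ^ k \<le> b"
    using b by (intro ev_power_le_exp) (simp_all add: a0_def)
  \<comment> \<open>The terms of the final union bound: \<open>4 * A\<close> from
    \<open>2 * n * p\<^sup>2\<close>, \<open>ln n ^ 2 / A + 4 * ln n\<close> from the number of
    vertices and sensor sets, and one more \<open>ln n\<close> for the target \<open>1 / n\<close>,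
    all against \<open>Y / 8\<close>.\<close>
  have ev_num: "\<forall>\<^sub>F n in sequentially. 4 * A + ln (real n) ^ 2 / A + 5 * ln (real n) \<le> ln (real n) ^ 3 / 16"
    using A_pos by real_asymp
  have ev_K: "\<forall>\<^sub>F n in sequentially. ln (real n) / A + 3 \<le> real n"
    using A_pos by real_asymp
  have "\<forall>\<^sub>F n in sequentially. measure_pmf.prob (edge_bits n (p n))
      {f. \<not> B n \<le> zeta_gnp n (edges_of n f)} \<le> 5 / real n"
    using ev_overlap ev_a ev_b ev_num ev_K ev_expanding ev_exploration[of "1 / 2", simplified]
      ev_ln_ge[of 2] ev_d_ge_const[of 1] ev_d_le ev_power_le ev_i_ge ev_d_ge[of "12 / (1 - b)"]
  proof eventually_elim
    case (elim n)
    let ?l = "ln (real n)"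
    have l0: "0 < ?l" "1 \<le> ?l" using elim(8) by linarith+
    have n1: "1 \<le> n" using l0 by (cases n) auto
    have n0: "0 < real n" using n1 by simp
    have expl: "real n = exp ?l" using n0 by simp
    interpret X: exploration n "i n - 2" "K n" "p n" "e n" "m n" "1 / 2" by (rule elim(7))
    have X: "X.d = d n" "X.H2 = hi n" "X.H1 = hi1 n" "X.L = lo n"
      unfolding X.d_def X.H1_def X.H2_def X.L_def d_def hi_def hi1_def lo_def by simp_all
    let ?M = "edge_bits n (p n)"
    let ?G = "\<lambda>f. expanding n (e n) (d n) (m n) (edges_of n f)"
    let ?r = "i n - 2"
    let ?R = "\<lambda>u s f. u \<notin> nball (edges_of n f) {s} (Suc (Suc (Suc ?r)))"
    let ?tw = "\<lambda>v S f. twins (edges_of n f) ?r v S"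
    have far: "measure_pmf.prob ?M {f. ?G f \<and> ?R u s f} \<le> 1 / real n ^ 3"
      if "u \<in> {1..n}" "s \<in> {1..n}" "u \<noteq> s" for u s
    proof -
      have "measure_pmf.prob ?M {f. ?G f \<and> ?R u s f} \<le> exp (- (p n * (1 - b) * ((1 - 1 / 2) * real n)))"
        using X.prob_far_le[OF that, of b] elim(3) b unfolding X by auto
      also have "\<dots> \<le> exp (- (3 * ?l))"
      proof -
        have "?l ^ 1 \<le> ?l ^ 3" using l0 by (intro power_increasing) auto
        then have "12 / (1 - b) * ?l \<le> 12 / (1 - b) * ?l ^ 3" using b by (intro mult_left_mono) auto
        then have "12 / (1 - b) * ?l \<le> d n" using elim(13) by linarith
        then have "12 * ?l \<le> d n * (1 - b)" using b by (simp add: field_simps)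
        moreover have "p n * (1 - b) * ((1 - 1 / 2) * real n) = d n * (1 - b) / 2" by (simp add: d_def)
        ultimately show ?thesis using l0 unfolding exp_le_cancel_iff by linarith
      qed
      also have "\<dots> = 1 / real n ^ 3"
        using n0 by (simp add: exp_minus exp_of_nat_mult[of 3, simplified] inverse_eq_divide)
      finally show ?thesis .
    qed
    \<comment> \<open>Sets of at most \<open>B n\<close> sensors satisfy
      \<open>d * exp (- (A * card S)) \<ge> ln n ^ 3\<close>; the factor 1/2 is the guaranteed
      proportion of fresh vertices.\<close>
    define Y where "Y = ?l ^ 3 / 2"
    define \<beta> where "\<beta> = exp (2 * real n * (p n)\<^sup>2 - Y / 8)"
    have lnl: "0 \<le> ln ?l" using l0 by simp
    have BK: "card S \<le> K n" if "real (card S) \<le> B n" for S :: "nat set"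
    proof -
      have "ln (d n) \<le> ?l" using elim by simp
      then have "B n \<le> ?l / A" unfolding B_def using lnl A_pos by (simp add: divide_right_mono)
      then have "real (card S) \<le> ?l / A" using that by linarith
      then show ?thesis unfolding K_def by linarith
    qed
    have no_twins: "measure_pmf.prob ?M {f. ?G f \<and> \<not> ?tw v S f} \<le> \<beta>"
      if v: "v \<in> {1..n}" and S: "S \<subseteq> {1..n} - {v}" "real (card S) \<le> B n" for v S
    proof -
      have Y1: "1 \<le> Y" unfolding Y_def using power_mono[OF elim(8), of 3] by simp
      have "A * real (card S) \<le> ln (d n) - 3 * ln ?l" using S(2) A_pos unfolding B_def by (simp add: field_simps)
      then have "exp (ln ?l * 3 - ln (d n)) \<le> exp (- (A * real (card S)))" by simp
      moreover have "exp (ln ?l * 3 - ln (d n)) = ?l ^ 3 / d n"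
        unfolding exp_diff using l0 elim by (simp add: exp_of_nat2_mult[of _ 3, simplified])
      moreover have "exp (- (A * real (card S))) = (\<omega> * \<gamma>) ^ card S"
        unfolding \<omega>(3) a0_def by (simp add: exp_of_nat2_mult[symmetric])
      ultimately have "?l ^ 3 / d n \<le> (\<omega> * \<gamma>) ^ card S" by simp
      then have "?l ^ 3 \<le> d n * (\<omega> * \<gamma>) ^ card S" using elim by (simp add: field_simps)
      then have Y2: "Y \<le> (1 - 1 / 2) * real n * p n * (\<omega> * \<gamma>) ^ card S" unfolding Y_def d_def by (simp add: mult_ac)
      have pa: "a0 - g / 4 \<le> (1 - p n) ^ k" if "real k \<le> X.H2" for k
        using elim(2) that unfolding X by blast
      have po: "\<omega> ^ j \<le> (1 - p n) ^ k" if "real k \<le> (X.H2 - X.L) * real j" for k j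
        using elim(1) that unfolding X by blast
      have "0 \<le> \<gamma>" "0 \<le> \<omega>" using \<gamma>a a0 \<omega> by simp_all
      from X.prob_no_twins_le[OF v S(1) BK[OF S(2)] pa gain this(1) po this(2) Y1 Y2]
      show ?thesis unfolding \<beta>_def X by blast
    qed
    define \<S> where "\<S> = {S. S \<subseteq> {1..n} \<and> card S \<le> K n}"
    have fin\<S>: "finite \<S>" unfolding \<S>_def by simp
    let ?T = "\<lambda>z f. snd z \<subseteq> {1..n} - {fst z} \<and> real (card (snd z)) \<le> B n \<and> ?G f \<and> \<not> ?tw (fst z) (snd z) f"
    have "{f. \<not> B n \<le> zeta_gnp n (edges_of n f)} \<subseteq> ({f. \<not> ?G f} \<union>
        {f. \<exists>z\<in>{1..n} \<times> {1..n}. fst z \<noteq> snd z \<and> ?G f \<and> ?R (fst z) (snd z) f}) \<union> {f. \<exists>z\<in>{1..n} \<times> \<S>. ?T z f}"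
    proof (rule subsetI, rule ccontr)
      fix f assume f: "f \<in> {f. \<not> B n \<le> zeta_gnp n (edges_of n f)}"
        and nf: "f \<notin> ({f. \<not> ?G f} \<union> {f. \<exists>z\<in>{1..n} \<times> {1..n}. fst z \<noteq> snd z \<and> ?G f \<and> ?R (fst z) (snd z) f})
          \<union> {f. \<exists>z\<in>{1..n} \<times> \<S>. ?T z f}"
      have ex: "?G f" using nf by blast
      have near: "u \<in> nball (edges_of n f) {s} (Suc (Suc (Suc ?r)))" if "u \<in> {1..n}" "s \<in> {1..n}" "u \<noteq> s" for u s
      proof (rule ccontr)
        assume "?R u s f"
        then have "\<exists>z\<in>{1..n} \<times> {1..n}. fst z \<noteq> snd z \<and> ?G f \<and> ?R (fst z) (snd z) f"
          using that ex by (intro bexI[of _ "(u, s)"]) simp_all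
        then show False using nf by blast
      qed
      have tw: "?tw v S f" if "v \<in> {1..n}" "S \<subseteq> {1..n} - {v}" "real (card S) \<le> B n" for v S
      proof (rule ccontr)
        assume "\<not> ?tw v S f"
        moreover have "S \<in> \<S>" unfolding \<S>_def using that BK by blast
        ultimately have "\<exists>z\<in>{1..n} \<times> \<S>. ?T z f"
          using that ex by (intro bexI[of _ "(v, S)"]) simp_all
        then show False using nf by blast
      qed
      have "B n \<le> zeta_gnp n (edges_of n f)"
      proof (rule le_localization_number)
        fix k assume k: "real k < B n"
        show "\<not> cops_can_win {1..n} (edges_of n f) k"
        proof (rule not_cops_can_win_if_twins[OF edges_of_subset n1 near])
          fix v S assume v: "v \<in> {1..n}" "S \<subseteq> {1..n} - {v}" "card S \<le> k"
          then have "real (card S) \<le> B n" using k by linarith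
          then show "twins (edges_of n f) ?r v S" by (rule tw[OF v(1,2)])
        qed
      qed simp
      then show False using f by blast
    qed
    then have "measure_pmf.prob ?M {f. \<not> B n \<le> zeta_gnp n (edges_of n f)} \<le>
        measure_pmf.prob ?M (({f. \<not> ?G f} \<union>
        {f. \<exists>z\<in>{1..n} \<times> {1..n}. fst z \<noteq> snd z \<and> ?G f \<and> ?R (fst z) (snd z) f}) \<union> {f. \<exists>z\<in>{1..n} \<times> \<S>. ?T z f})"
      by (rule measure_pmf.finite_measure_mono) simp
    also have "\<dots> \<le> (measure_pmf.prob ?M {f. \<not> ?G f}
        + measure_pmf.prob ?M {f. \<exists>z\<in>{1..n} \<times> {1..n}. fst z \<noteq> snd z \<and> ?G f \<and> ?R (fst z) (snd z) f})
        + measure_pmf.prob ?M {f. \<exists>z\<in>{1..n} \<times> \<S>. ?T z f}"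
      by (rule order_trans[OF measure_Un_le add_right_mono[OF measure_Un_le]]) simp_all
    also have "\<dots> \<le> (3 / real n + 1 / real n) + 1 / real n"
    proof (intro add_mono elim(6))
      have "measure_pmf.prob ?M {f. \<exists>z\<in>{1..n} \<times> {1..n}. fst z \<noteq> snd z \<and> ?G f \<and> ?R (fst z) (snd z) f}
          \<le> real n ^ 2 * (1 / real n ^ 3)"
        by (intro prob_bad_pairs_le n1 far) simp_all
      then show "measure_pmf.prob ?M {f. \<exists>z\<in>{1..n} \<times> {1..n}. fst z \<noteq> snd z \<and> ?G f \<and> ?R (fst z) (snd z) f} \<le> 1 / real n"
        using n0 by (simp add: power2_eq_square power3_eq_cube)
      have "measure_pmf.prob ?M {f. \<exists>z\<in>{1..n} \<times> \<S>. ?T z f} \<le> (\<Sum>z\<in>{1..n} \<times> \<S>. measure_pmf.prob ?M {f. ?T z f})"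
        using fin\<S> by (intro prob_ex_le) simp
      also have "\<dots> \<le> (\<Sum>z\<in>{1..n} \<times> \<S>. \<beta>)"
      proof (rule sum_mono)
        fix z assume z: "z \<in> {1..n} \<times> \<S>"
        show "measure_pmf.prob ?M {f. ?T z f} \<le> \<beta>"
        proof (cases "snd z \<subseteq> {1..n} - {fst z} \<and> real (card (snd z)) \<le> B n")
          case True
          then have "{f. ?T z f} = {f. ?G f \<and> \<not> ?tw (fst z) (snd z) f}" by blast
          moreover have "fst z \<in> {1..n}" using z by auto
          ultimately show ?thesis using no_twins[of "fst z" "snd z"] True by simp
        next
          case False
          then have "{f. ?T z f} = {}" by blast
          then show ?thesis unfolding \<beta>_def by (simp only: measure_empty exp_ge_zero)
        qed
      qed
      also have "\<dots> = real n * real (card \<S>) * \<beta>" by (simp add: card_cartesian_product)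
      also have "\<dots> \<le> real n * (real n * real n powr (?l / A + 2)) * \<beta>"
      proof (intro mult_right_mono mult_left_mono)
        have "real (card \<S>) \<le> real ((K n + 1) * n ^ K n)"
          unfolding \<S>_def using card_small_subsets_le[OF n1, of "K n"] by (simp only: of_nat_le_iff)
        also have "\<dots> = (real (K n) + 1) * real n ^ K n" by (simp add: distrib_right)
        also have "\<dots> \<le> real n * real n powr (?l / A + 2)"
        proof (intro mult_mono)
          have K: "real (K n) \<le> ?l / A + 2" unfolding K_def using l0 A_pos by simp
          then show "real (K n) + 1 \<le> real n" using elim(5) by linarith
          have "real n ^ K n = real n powr (real (K n))" using n0 by (simp add: powr_realpow)
          also have "\<dots> \<le> real n powr (?l / A + 2)" using K n1 by (intro powr_mono) auto
          finally show "real n ^ K n \<le> real n powr (?l / A + 2)" .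
        qed (use n0 in auto)
        finally show "real (card \<S>) \<le> real n * real n powr (?l / A + 2)" .
      qed (auto simp: \<beta>_def)
      also have "\<dots> = exp (?l + (?l + (?l / A + 2) * ?l) + (2 * real n * (p n)\<^sup>2 - Y / 8))"
        unfolding \<beta>_def exp_add powr_def using n0 by simp
      also have "\<dots> \<le> exp (- ?l)"
      proof -
        \<comment> \<open>Because \<open>i n \<ge> 2\<close>, the quantity
          \<open>n * p\<^sup>2 = d\<^sup>2 / n\<close> is at most \<open>2 * A\<close>.\<close>
        have "d n ^ 2 \<le> d n ^ i n" using elim by (intro power_increasing) auto
        then have "d n ^ 2 \<le> 2 * A * real n" using elim(11) by linarith
        then have "real n * (p n)\<^sup>2 * real n \<le> 2 * A * real n" unfolding d_def by (simp add: power2_eq_square mult_ac)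
        then have "real n * (p n)\<^sup>2 \<le> 2 * A" using n0 by (simp add: mult.commute)
        moreover have "(?l / A + 2) * ?l = ?l ^ 2 / A + 2 * ?l" by (simp add: power2_eq_square algebra_simps)
        moreover have "Y / 8 = ?l ^ 3 / 16" unfolding Y_def by simp
        ultimately show ?thesis using elim(4) unfolding exp_le_cancel_iff by linarith
      qed
      also have "\<dots> = 1 / real n" using n0 by (simp add: exp_minus inverse_eq_divide)
      finally show "measure_pmf.prob ?M {f. \<exists>z\<in>{1..n} \<times> \<S>. ?T z f} \<le> 1 / real n" .
    qed
    finally show ?case by simp
  qed
  moreover have "(\<lambda>n. 5 / real n) \<longlonglongrightarrow> 0" by real_asymp
  ultimately have "aas p (\<lambda>n E. B n \<le> zeta_gnp n E)" by (rule aasI)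
  then show ?thesis unfolding B_def .
qed

end

section \<open>The localization number\<close>

theorem theorem2p2:
  fixes p d :: "nat \<Rightarrow> real" and i :: "nat \<Rightarrow> nat" and A :: real
  assumes prob: "\<And>n. 0 \<le> p n \<and> p n \<le> 1"
    and d_def: "\<And>n. d n = p n * real n"
    and d_lower: "(\<lambda>n. ln (real n) ^ 3) \<in> o(d)"
    and d_upper: "d \<in> o(\<lambda>n. real n)"
    and A_pos: "A > 0"
    and c_lim: "(\<lambda>n. d n ^ i n / real n) \<longlonglongrightarrow> A"
  shows "(\<exists>\<delta> :: nat \<Rightarrow> real. \<delta> \<longlonglongrightarrow> 0 \<and>
            aas p (\<lambda>n E.
              (ln (d n) - 3 * ln (ln (real n))) * (1 / A) \<le> zeta_gnp n E \<and>
              zeta_gnp n E \<le> (1 + \<delta> n) * (ln (d n) + 2 * ln (ln (real n)))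
                                * (exp A / (1 - exp (- A)))))
         \<and> (\<forall>\<epsilon>>0. (\<forall>\<^sub>F n in sequentially. d n \<ge> ln (real n) powr (3 + \<epsilon>)) \<longrightarrow>
              (\<exists>C\<^sub>1>0. \<exists>C\<^sub>2>0. aas p (\<lambda>n E.
                C\<^sub>1 * (real n * ln (d n) / d n ^ i n) \<le> zeta_gnp n E \<and>
                zeta_gnp n E \<le> C\<^sub>2 * (real n * ln (d n) / d n ^ i n))))"
proof -
  interpret sparse_regime p d i A
    by unfold_locales (fact prob d_def d_lower d_upper A_pos c_lim)+
  define c where "c = exp A / (1 - exp (- A))"
  have c: "0 < c" unfolding c_def using A_pos by simp
  define M where "M n = ln (d n) + 2 * ln (ln (real n))" for n
  have ev_pos: "\<forall>\<^sub>F n in sequentially. 0 \<le> ln (d n) \<and> 0 \<le> ln (ln (real n))"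
    using ev_d_ge_const[of 1] ev_ln_ge[of 1] by eventually_elim auto
  \<comment> \<open>The diagonal argument needs a bound that is monotone in its parameter for every
    \<open>n\<close>, and \<open>M n\<close> may be negative for small \<open>n\<close>; hence
    \<open>max 0\<close>.\<close>
  have "\<exists>\<delta>. \<delta> \<longlonglongrightarrow> 0 \<and> aas p (\<lambda>n E. zeta_gnp n E \<le> (1 + \<delta> n) * max 0 (M n) * c)"
  proof (rule aas_diagonal)
    fix y :: real assume y: "0 < y"
    have "(1 + y) * M n * c \<le> (1 + y) * max 0 (M n) * c" for n
      using y c by (intro mult_right_mono mult_left_mono) auto
    then have "\<forall>\<^sub>F n in sequentially. \<forall>E. zeta_gnp n E \<le> (1 + y) * M n * c \<longrightarrow> zeta_gnp n E \<le> (1 + y) * max 0 (M n) * c"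
      by (intro always_eventually allI impI) (rule order_trans)
    from aas_mono[OF aas_upper[OF y, folded c_def M_def] this]
    show "aas p (\<lambda>n E. zeta_gnp n E \<le> (1 + y) * max 0 (M n) * c)" .
  next
    fix y z :: real and n E assume yz: "0 < y" "y \<le> z" and "zeta_gnp n E \<le> (1 + y) * max 0 (M n) * c"
    moreover have "(1 + y) * max 0 (M n) * c \<le> (1 + z) * max 0 (M n) * c"
      using yz c by (intro mult_right_mono) auto
    ultimately show "zeta_gnp n E \<le> (1 + z) * max 0 (M n) * c" by linarith
  qed
  then obtain \<delta> where \<delta>: "\<delta> \<longlonglongrightarrow> 0" "aas p (\<lambda>n E. zeta_gnp n E \<le> (1 + \<delta> n) * max 0 (M n) * c)" by blast
  have "\<forall>\<^sub>F n in sequentially. \<forall>E. zeta_gnp n E \<le> (1 + \<delta> n) * max 0 (M n) * c \<longrightarrow> zeta_gnp n E \<le> (1 + \<delta> n) * M n * c"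
    using ev_pos by eventually_elim (auto simp: M_def max_def)
  from aas_conj[OF aas_lower aas_mono[OF \<delta>(2) this]]
  have first: "\<exists>\<delta> :: nat \<Rightarrow> real. \<delta> \<longlonglongrightarrow> 0 \<and> aas p (\<lambda>n E.
      (ln (d n) - 3 * ln (ln (real n))) * (1 / A) \<le> zeta_gnp n E \<and> zeta_gnp n E \<le> (1 + \<delta> n) * M n * c)"
    using \<delta>(1) by blast
  have second: "\<exists>C\<^sub>1>0. \<exists>C\<^sub>2>0. aas p (\<lambda>n E. C\<^sub>1 * (real n * ln (d n) / d n ^ i n) \<le> zeta_gnp n E \<and>
      zeta_gnp n E \<le> C\<^sub>2 * (real n * ln (d n) / d n ^ i n))"
    if \<epsilon>: "0 < \<epsilon>" and large: "\<forall>\<^sub>F n in sequentially. d n \<ge> ln (real n) powr (3 + \<epsilon>)" for \<epsilon>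
  proof (intro exI conjI)
    \<comment> \<open>For \<open>?C1\<close>:
      \<open>ln (ln n) \<le> ln d / (3 + \<epsilon>)\<close>, so the fraction
      \<open>\<epsilon> / (3 + \<epsilon>)\<close> of \<open>ln d\<close> survives the subtraction,
      and the 2 comes from \<open>d ^ i / n > A / 2\<close>. For \<open>?C2\<close>: the upper bound
      with error 1 is at most \<open>6 * ln d * c\<close>, and
      \<open>d ^ i / n < 2 * A\<close>.\<close>
    let ?C1 = "\<epsilon> / (2 * (3 + \<epsilon>))" and ?C2 = "12 * A * c"
    show "0 < ?C1" "0 < ?C2" using \<epsilon> A_pos c by auto
    have "\<forall>\<^sub>F n in sequentially. A / 2 < d n ^ i n / real n"
      using order_tendstoD(1)[OF c_lim, of "A / 2"] A_pos by simp
    moreover have "\<forall>\<^sub>F n in sequentially. d n ^ i n / real n < 2 * A"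
      using order_tendstoD(2)[OF c_lim, of "2 * A"] A_pos by simp
    ultimately have "\<forall>\<^sub>F n in sequentially. \<forall>E. (ln (d n) - 3 * ln (ln (real n))) * (1 / A) \<le> zeta_gnp n E \<and>
        zeta_gnp n E \<le> (1 + 1) * M n * c \<longrightarrow>
        ?C1 * (real n * ln (d n) / d n ^ i n) \<le> zeta_gnp n E \<and> zeta_gnp n E \<le> ?C2 * (real n * ln (d n) / d n ^ i n)"
      using large ev_pos ev_ln_ge[of 1]
    proof eventually_elim
      case (elim n)
      define l where "l = ln (d n)"
      define ll where "ll = ln (ln (real n))"
      define c' where "c' = d n ^ i n / real n"
      have c': "A / 2 < c'" "c' < 2 * A" "0 < c'" using elim A_pos unfolding c'_def by auto
      have q: "real n * ln (d n) / d n ^ i n = l / c'" unfolding l_def c'_def by simp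
      have l0: "0 \<le> l" "0 \<le> ll" using elim unfolding l_def ll_def by auto
      have "ln (ln (real n) powr (3 + \<epsilon>)) \<le> l"
        unfolding l_def using elim by (intro ln_mono) auto
      then have ll: "(3 + \<epsilon>) * ll \<le> l" unfolding ll_def using elim by (simp add: ln_powr)
      have lower: "?C1 * (l / c') \<le> (l - 3 * ll) * (1 / A)"
      proof -
        have "l / c' \<le> l / (A / 2)" using c' l0 A_pos by (intro divide_left_mono) auto
        then have "?C1 * (l / c') \<le> ?C1 * (l / (A / 2))" using \<epsilon> by (intro mult_left_mono) auto
        also have "\<dots> = (\<epsilon> / (3 + \<epsilon>) * l) * (1 / A)"
        proof -
          have "\<epsilon> / (2 * t) * (l / (A / 2)) = (\<epsilon> / t * l) * (1 / A)" for t by simp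
          then show ?thesis .
        qed
        also have "\<dots> \<le> (l - 3 * ll) * (1 / A)"
        proof (rule mult_right_mono)
          have "\<epsilon> * l \<le> (3 + \<epsilon>) * (l - 3 * ll)" using ll by (simp add: algebra_simps)
          then show "\<epsilon> / (3 + \<epsilon>) * l \<le> l - 3 * ll" using \<epsilon> by (simp add: field_simps)
        qed (use A_pos in simp)
        finally show ?thesis .
      qed
      have upper: "(1 + 1) * M n * c \<le> ?C2 * (l / c')"
      proof -
        have "0 \<le> (2 + \<epsilon>) * ll" using \<epsilon> l0 by simp
        then have "ll \<le> l" using ll by (simp add: algebra_simps)
        then have "(1 + 1) * M n * c \<le> 6 * l * c" unfolding M_def l_def[symmetric] ll_def[symmetric]
          using c by (intro mult_right_mono) auto
        also have "\<dots> = ?C2 * (l / (2 * A))" using A_pos by simp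
        also have "\<dots> \<le> ?C2 * (l / c')" using c' l0 A_pos c by (intro mult_left_mono divide_left_mono) auto
        finally show ?thesis .
      qed
      show ?case unfolding q using lower upper unfolding l_def[symmetric] ll_def[symmetric] by (meson order_trans)
    qed
    from aas_mono[OF aas_conj[OF aas_lower aas_upper[OF zero_less_one, folded c_def M_def]] this]
    show "aas p (\<lambda>n E. ?C1 * (real n * ln (d n) / d n ^ i n) \<le> zeta_gnp n E \<and>
      zeta_gnp n E \<le> ?C2 * (real n * ln (d n) / d n ^ i n))" .
  qed
  show ?thesis using first second unfolding M_def c_def by blast
qed

end
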